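(* Fix any $d\in\mathbb{N}$ and let $C=[-d:d]$. There is a deterministic algorithm for average-case Generalized Subset Sum with coefficient set $C$ running in time \[ \tilde{O}\!\left(\bigl(18\sqrt{2\pi e}\bigr)^n\right)\approx\tilde{O}(2^{6.217n}). \] For any $M$ and integer $\tau$ with $|\tau|=o(nM)$, the algorithm succeeds on $(M,\tau,\mathbf{x})$ with probability at least $1-e^{-\Omega(n)}$ over $\mathbf{x}$ drawn uniformly from $\{0,\dots,M-1\}^n$.
   Context: $[-d:d]=\{-d,\dots,d\}$. Generalized Subset Sum with coefficient set $C$: given $M$, $\mathbf{x}\in\{0,\dots,M-1\}^n$ and $\tau\in\mathbb{Z}$, output $\mathbf{c}\in C^n$ with $\mathbf{c}\cdot\mathbf{x}=\tau$ if one exists, otherwise report that none exists; the algorithm "succeeds" if its answer is correct. Asymptotics are as $n\to\infty$ with $d$ constant. The paper's standing setting also assumes $M\ge4^n$. $\tilde{O}$ suppresses factors polynomial in $n$. *)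

theory Defs
  imports "HOL-Probability.Probability" "HOL-Library.Landau_Symbols"
begin

section \<open>Generalized Subset Sum\<close>

definition is_solution :: "int set \<Rightarrow> int list \<Rightarrow> int \<Rightarrow> int list \<Rightarrow> bool" where
  "is_solution C x \<tau> c \<longleftrightarrow>
     length c = length x \<and> set c \<subseteq> C \<and> (\<Sum>i<length x. c ! i * x ! i) = \<tau>"

text \<open>The answer \<open>None\<close> is the report that no solution exists.\<close>

definition correct_answer :: "int set \<Rightarrow> int list \<Rightarrow> int \<Rightarrow> int list option \<Rightarrow> bool" where
  "correct_answer C x \<tau> ans \<longleftrightarrow>
     (case ans of
        Some c \<Rightarrow> is_solution C x \<tau> c
      | None \<Rightarrow> \<not> (\<exists>c. is_solution C x \<tau> c))"

definition input_vectors :: "nat \<Rightarrow> int \<Rightarrow> int list set" where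
  "input_vectors n M = {x. length x = n \<and> set x \<subseteq> {0..M-1}}"

section \<open>Deterministic word-RAM programs\<close>

text \<open>
  The memory is an array of words, addressed by words. A word is an integer of absolute value at
  most \<open>B\<close>, so it has about \<open>log 2 B\<close> bits and a sign. Every operation on words takes unit time.
  Evaluating an expression fails, and then the program has no run, as soon as some value leaves the
  range of words. In particular a program cannot gain anything from operating on long integers.
\<close>

datatype binop = Add | Sub | Mul | Div | Mod | Less | Equal

datatype expr = Lit int | Load expr | Bin binop expr expr

datatype prog =
    Skip
  | Store expr expr  \<comment> \<open>address, value\<close>
  | Seq prog prog
  | Cond expr prog prog
  | Loop expr prog

fun apply_op :: "binop \<Rightarrow> int \<Rightarrow> int \<Rightarrow> int" where
  "apply_op Add a b = a + b"
| "apply_op Sub a b = a - b"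
| "apply_op Mul a b = a * b"
| "apply_op Div a b = a div b"
| "apply_op Mod a b = a mod b"
| "apply_op Less a b = (if a < b then 1 else 0)"
| "apply_op Equal a b = (if a = b then 1 else 0)"

definition to_word :: "int \<Rightarrow> int \<Rightarrow> int option" where
  "to_word B v = (if \<bar>v\<bar> \<le> B then Some v else None)"

fun eval_expr :: "int \<Rightarrow> (int \<Rightarrow> int) \<Rightarrow> expr \<Rightarrow> int option" where
  "eval_expr B m (Lit k) = to_word B k"
| "eval_expr B m (Load e) =
     (case eval_expr B m e of None \<Rightarrow> None | Some a \<Rightarrow> to_word B (m a))"
| "eval_expr B m (Bin f e1 e2) =
     (case (eval_expr B m e1, eval_expr B m e2) of
        (Some a, Some b) \<Rightarrow> to_word B (apply_op f a b)
      | _ \<Rightarrow> None)"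

fun expr_cost :: "expr \<Rightarrow> nat" where
  "expr_cost (Lit k) = 1"
| "expr_cost (Load e) = expr_cost e + 1"
| "expr_cost (Bin f e1 e2) = expr_cost e1 + expr_cost e2 + 1"

text \<open>
  \<open>exec B p m t m'\<close>: with word range \<open>B\<close>, the program \<open>p\<close> started in memory \<open>m\<close> halts after \<open>t\<close>
  time units in memory \<open>m'\<close>.
\<close>

inductive exec :: "int \<Rightarrow> prog \<Rightarrow> (int \<Rightarrow> int) \<Rightarrow> nat \<Rightarrow> (int \<Rightarrow> int) \<Rightarrow> bool" for B :: int where
  Skip: "exec B Skip m 1 m"
| Store: "eval_expr B m e1 = Some a \<Longrightarrow> eval_expr B m e2 = Some v \<Longrightarrow>
     exec B (Store e1 e2) m (expr_cost e1 + expr_cost e2 + 1) (m(a := v))"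
| Seq: "exec B p1 m t1 m1 \<Longrightarrow> exec B p2 m1 t2 m2 \<Longrightarrow> exec B (Seq p1 p2) m (t1 + t2) m2"
| Cond_True: "eval_expr B m e = Some v \<Longrightarrow> v \<noteq> 0 \<Longrightarrow> exec B p1 m t m' \<Longrightarrow>
     exec B (Cond e p1 p2) m (expr_cost e + 1 + t) m'"
| Cond_False: "eval_expr B m e = Some 0 \<Longrightarrow> exec B p2 m t m' \<Longrightarrow>
     exec B (Cond e p1 p2) m (expr_cost e + 1 + t) m'"
| Loop_False: "eval_expr B m e = Some 0 \<Longrightarrow> exec B (Loop e p) m (expr_cost e + 1) m"
| Loop_True: "eval_expr B m e = Some v \<Longrightarrow> v \<noteq> 0 \<Longrightarrow> exec B p m t1 m1 \<Longrightarrow>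
     exec B (Loop e p) m1 t2 m2 \<Longrightarrow> exec B (Loop e p) m (expr_cost e + 1 + t1 + t2) m2"

inductive_cases exec_SkipE: "exec B Skip m t m'"
inductive_cases exec_StoreE: "exec B (Store e1 e2) m t m'"
inductive_cases exec_SeqE: "exec B (Seq p1 p2) m t m'"
inductive_cases exec_CondE: "exec B (Cond e p1 p2) m t m'"
inductive_cases exec_LoopE: "exec B (Loop e p) m t m'"

lemma exec_deterministic:
  assumes "exec B p m t m'" and "exec B p m t' m''"
  shows "t = t' \<and> m' = m''"
  using assms
proof (induction arbitrary: t' m'' rule: exec.induct)
  case (Skip m)
  then show ?case by (rule exec_SkipE) simp
next
  case (Store m e1 a e2 v)
  from Store.prems show ?case by (rule exec_StoreE) (simp add: Store.hyps)
next
  case (Seq p1 m t1 m1 p2 t2 m2)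
  from Seq.prems show ?case
  proof (rule exec_SeqE)
    fix s1 n1 s2
    assume *: "t' = s1 + s2" "exec B p1 m s1 n1" "exec B p2 n1 s2 m''"
    have "t1 = s1" "m1 = n1" using Seq.IH(1)[OF *(2)] by simp_all
    with *(3) have "t2 = s2 \<and> m2 = m''" by (intro Seq.IH(2)) simp
    with \<open>t1 = s1\<close> *(1) show ?thesis by simp
  qed
next
  case (Cond_True m e v p1 t m' p2)
  from Cond_True.prems show ?case
  proof (rule exec_CondE)
    fix s
    assume *: "t' = Suc (expr_cost e + s)" "exec B p1 m s m''"
    from Cond_True.IH[OF *(2)] *(1) show ?thesis by simp
  next
    assume "eval_expr B m e = Some 0"
    with Cond_True.hyps show ?thesis by simp
  qed
next
  case (Cond_False m e p2 t m' p1)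
  from Cond_False.prems show ?case
  proof (rule exec_CondE)
    fix w :: int
    assume "eval_expr B m e = Some w" "w \<noteq> 0"
    with Cond_False.hyps show ?thesis by simp
  next
    fix s
    assume *: "t' = Suc (expr_cost e + s)" "exec B p2 m s m''"
    from Cond_False.IH[OF *(2)] *(1) show ?thesis by simp
  qed
next
  case (Loop_False m e p)
  from Loop_False.prems show ?case
    by (rule exec_LoopE) (simp_all add: Loop_False.hyps)
next
  case (Loop_True m e v p t1 m1 t2 m2)
  from Loop_True.prems show ?case
  proof (rule exec_LoopE)
    assume "eval_expr B m e = Some 0"
    with Loop_True.hyps show ?thesis by simp
  next
    fix s1 n1 s2
    assume *: "t' = Suc (expr_cost e + s1 + s2)" "exec B p m s1 n1" "exec B (Loop e p) n1 s2 m''"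
    have "t1 = s1" "m1 = n1" using Loop_True.IH(1)[OF *(2)] by simp_all
    with *(3) have "t2 = s2 \<and> m2 = m''" by (intro Loop_True.IH(2)) simp
    with \<open>t1 = s1\<close> *(1) show ?thesis by simp
  qed
qed

lemma eval_expr_mono:
  assumes "B \<le> B'"
  shows "eval_expr B m e = Some v \<Longrightarrow> eval_expr B' m e = Some v"
proof (induction e arbitrary: v)
  case (Lit k)
  then show ?case using assms by (simp add: to_word_def split: if_splits)
next
  case (Load e)
  then obtain a where a: "eval_expr B m e = Some a" "to_word B (m a) = Some v"
    by (simp split: option.splits)
  have "to_word B' (m a) = Some v" using a(2) assms by (simp add: to_word_def split: if_splits)
  then show ?case using Load.IH[OF a(1)] by simp
next
  case (Bin f e1 e2)
  then obtain a b where ab: "eval_expr B m e1 = Some a" "eval_expr B m e2 = Some b"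
    "to_word B (apply_op f a b) = Some v"
    by (simp split: option.splits)
  have "to_word B' (apply_op f a b) = Some v"
    using ab(3) assms by (simp add: to_word_def split: if_splits)
  then show ?case using Bin.IH(1)[OF ab(1)] Bin.IH(2)[OF ab(2)] by simp
qed

text \<open>Longer words do not change a run.\<close>

lemma exec_mono:
  assumes "exec B p m t m'" and "B \<le> B'"
  shows "exec B' p m t m'"
  using assms(1)
proof (induction rule: exec.induct)
  case (Skip m)
  show ?case by (rule exec.Skip)
next
  case Store
  show ?case by (rule exec.Store) (rule eval_expr_mono[OF assms(2)], rule Store.hyps)+
next
  case Seq
  show ?case by (rule exec.Seq) (rule Seq.IH)+
next
  case Cond_True
  show ?case
    by (rule exec.Cond_True[OF eval_expr_mono[OF assms(2) Cond_True.hyps(1)]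
          Cond_True.hyps(2) Cond_True.IH])
next
  case Cond_False
  show ?case
    by (rule exec.Cond_False[OF eval_expr_mono[OF assms(2) Cond_False.hyps(1)] Cond_False.IH])
next
  case Loop_False
  show ?case by (rule exec.Loop_False[OF eval_expr_mono[OF assms(2) Loop_False.hyps(1)]])
next
  case Loop_True
  show ?case
    by (rule exec.Loop_True[OF eval_expr_mono[OF assms(2) Loop_True.hyps(1)]
          Loop_True.hyps(2) Loop_True.IH])
qed

section \<open>Solving Generalized Subset Sum on a word RAM\<close>

definition input_memory :: "int \<Rightarrow> int \<Rightarrow> int list \<Rightarrow> int \<Rightarrow> int" where
  "input_memory M \<tau> x a =
     (if a = 0 then int (length x)
      else if a = 1 then M
      else if a = 2 then \<tau>
      else if 3 \<le> a \<and> a < 3 + int (length x) then x ! nat (a - 3)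
      else 0)"

text \<open>Cell \<open>0\<close> tells whether a solution is reported; it is then read off from cell \<open>1\<close> onwards.\<close>

definition output_answer :: "nat \<Rightarrow> (int \<Rightarrow> int) \<Rightarrow> int list option" where
  "output_answer n m = (if m 0 = 0 then None else Some (map (\<lambda>i. m (1 + int i)) [0..<n]))"

text \<open>
  The range of words is polynomial in the numbers of the input, that is, words have
  \<open>O(log M + log \<bar>\<tau>\<bar>)\<close> bits, where \<open>\<kappa>\<close> is the hidden constant. If \<open>M \<ge> 4 ^ n\<close>, this also covers
  \<open>n\<close>, and \<open>\<kappa>\<close> can be chosen such that \<open>b ^ n\<close> cells are addressable for a given constant \<open>b\<close>.
\<close>

definition word_bound :: "nat \<Rightarrow> int \<Rightarrow> int \<Rightarrow> int" where
  "word_bound \<kappa> M \<tau> = (M + \<bar>\<tau>\<bar> + 2) ^ \<kappa>"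

definition answers_in_time ::
  "prog \<Rightarrow> nat \<Rightarrow> int \<Rightarrow> int \<Rightarrow> int list \<Rightarrow> nat \<Rightarrow> int list option \<Rightarrow> bool" where
  "answers_in_time p \<kappa> M \<tau> x t ans \<longleftrightarrow>
     (\<exists>m. exec (word_bound \<kappa> M \<tau>) p (input_memory M \<tau> x) t m \<and> ans = output_answer (length x) m)"

definition succeeds :: "prog \<Rightarrow> nat \<Rightarrow> int set \<Rightarrow> int \<Rightarrow> int \<Rightarrow> int list \<Rightarrow> bool" where
  "succeeds p \<kappa> C M \<tau> x \<longleftrightarrow> (\<exists>t ans. answers_in_time p \<kappa> M \<tau> x t ans \<and> correct_answer C x \<tau> ans)"

definition soft_O :: "(nat \<Rightarrow> real) \<Rightarrow> (nat \<Rightarrow> real) set" where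
  "soft_O g = {f. \<exists>k. f \<in> O(\<lambda>n. real n ^ k * g n)}"

text \<open>Worst-case running time over all instances in the range \<open>M \<ge> 4 ^ n\<close>.\<close>

definition runs_in_time :: "prog \<Rightarrow> nat \<Rightarrow> (nat \<Rightarrow> real) \<Rightarrow> bool" where
  "runs_in_time p \<kappa> T \<longleftrightarrow>
     (\<forall>n M \<tau> x. 4 ^ n \<le> M \<longrightarrow> x \<in> input_vectors n M \<longrightarrow>
        (\<exists>t ans. answers_in_time p \<kappa> M \<tau> x t ans \<and> real t \<le> T n))"

definition success_prob :: "prog \<Rightarrow> nat \<Rightarrow> int set \<Rightarrow> nat \<Rightarrow> int \<Rightarrow> int \<Rightarrow> real" where
  "success_prob p \<kappa> C n M \<tau> =
     measure_pmf.prob (pmf_of_set (input_vectors n M)) {x. succeeds p \<kappa> C M \<tau> x}"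

lemma finite_input_vectors: "finite (input_vectors n M)"
  using finite_lists_length_eq[of "{0..M-1}" n]
  by (simp add: input_vectors_def conj_commute)

lemma input_vectors_nonempty: "0 < M \<Longrightarrow> input_vectors n M \<noteq> {}"
  by (auto simp: input_vectors_def intro!: exI[of _ "replicate n 0"])

end

(*
A solution with entries of absolute value at most R is found as a sum of two vectors with entries at
most about 3R/4, and so on until the entries are at most 36 and all vectors can be listed. Level j keeps
the vectors c for which 2^j (c . x) is close to tau modulo M, with a window that makes the expected
number of kept vectors smaller than (43/5)^n. Such a vector c can be split as (c+e)/2 + (c-e)/2 within
the next level as soon as some short e congruent to c modulo 2 has e . x in a small window; by
Chebyshev's inequality, for most x this holds for all parity classes at once. Joining all pairs of a
level takes about (43/5)^(2n) = 73.96^n < (18 sqrt(2 pi e))^n steps.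

The expected sizes of the levels are under control only while R^n is at most M. This suffices, because
the search runs over all R up to d, and a solution exists with high probability once (2R+1)^n exceeds M
by an exponential factor: the values of a first block of coordinates are mostly distinct and so fill an
exponentially small part of a residue system modulo M; on each further coordinate with coefficients
-1, 0, 1 the set S of reachable targets grows, M/|S| - 1 contracting by 5/6 in the mean; and a last block
hits the large set thus obtained. When no such R exists, all solutions are found, and so
the answer is correct even if there is none.
*)
theory Submission
  imports Defs
begin

subsection \<open>Total evaluation of word-RAM programs\<close>

text \<open>The constants balance three demands. To serve all 2^n parity classes at once, each class
  should have of the order of (5/2)^n hits in expectation, so the window has half width about M
  (5/2)^n / \<rho>^n, where \<rho> bounds the entries of e; second moments then let a class fail
  with probability of order (2/5)^n. A split of radius R into radius R' allows \<rho> = 2 R' - R, so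
  the level of radius R' has about (5/2 (2 R' + 1) / \<rho>)^n vectors. For R' near 3 R / 4 the
  quotient (2 R' + 1) / \<rho> is near 3; 392/125 leaves room for rounding and gives 7.84^n, below
  the capacity (43/5)^n. The square of the capacity and the 73^n vectors of radius 36 both stay
  below (18 sqrt(2 pi e))^n, about 74.39^n. The time bound is a worst-case bound while level sizes
  are controlled on average only, so every list is cut off at the capacity. A reported vector is
  then always a solution, and only the report \<open>None\<close> relies on complete lists. M is
  arbitrary, so coefficients may share factors with it, and the equation holds over the integers
  while the windows live modulo M; the existence argument therefore keeps track of quotients by
  M.\<close>

fun ev :: "(int \<Rightarrow> int) \<Rightarrow> expr \<Rightarrow> int" where
  "ev m (Lit k) = k"
| "ev m (Load e) = m (ev m e)"
| "ev m (Bin f a b) = apply_op f (ev m a) (ev m b)"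

text \<open>A bound that depends on the program text and on a bound \<open>U\<close> for the cells
  only, so overflow is excluded separately from what the program computes. The sum for
  \<open>Mod\<close> also covers division by 0, where the first operand is returned.\<close>

fun emax :: "int \<Rightarrow> expr \<Rightarrow> int" where
  "emax U (Lit k) = \<bar>k\<bar>"
| "emax U (Load e) = U"
| "emax U (Bin f a b) = (case f of Add \<Rightarrow> emax U a + emax U b | Sub \<Rightarrow> emax U a + emax U b
     | Mul \<Rightarrow> emax U a * emax U b | Div \<Rightarrow> emax U a | Mod \<Rightarrow> emax U a + emax U b
     | Less \<Rightarrow> 1 | Equal \<Rightarrow> 1)"

text \<open>\<open>eval_expr\<close> checks every intermediate value against the word range, hence
  the recursion into all subexpressions.\<close>

fun esafe :: "int \<Rightarrow> int \<Rightarrow> expr \<Rightarrow> bool" where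
  "esafe U B (Lit k) \<longleftrightarrow> \<bar>k\<bar> \<le> B"
| "esafe U B (Load e) \<longleftrightarrow> esafe U B e \<and> U \<le> B"
| "esafe U B (Bin f a b) \<longleftrightarrow> esafe U B a \<and> esafe U B b \<and> emax U (Bin f a b) \<le> B"

fun psafe :: "int \<Rightarrow> int \<Rightarrow> prog \<Rightarrow> bool" where
  "psafe U B Skip \<longleftrightarrow> True"
| "psafe U B (Store a e) \<longleftrightarrow> esafe U B a \<and> esafe U B e"
| "psafe U B (Seq p q) \<longleftrightarrow> psafe U B p \<and> psafe U B q"
| "psafe U B (Cond e p q) \<longleftrightarrow> esafe U B e \<and> psafe U B p \<and> psafe U B q"
| "psafe U B (Loop e p) \<longleftrightarrow> esafe U B e \<and> psafe U B p"

definition bnd :: "int \<Rightarrow> (int \<Rightarrow> int) \<Rightarrow> bool" where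
  "bnd U m \<longleftrightarrow> (\<forall>a. \<bar>m a\<bar> \<le> U)"

lemma bndD: "bnd U m \<Longrightarrow> \<bar>m a\<bar> \<le> U"
  by (simp add: bnd_def)

lemma abs_div_le: "\<bar>a div b\<bar> \<le> \<bar>a\<bar>" for a b :: int
proof -
  have *: "\<bar>a div b\<bar> \<le> \<bar>a\<bar>" if "b > 0" for a b :: int
  proof (cases "a \<ge> 0")
    case True
    have "a div b \<le> a div 1" using that True by (intro zdiv_mono2) auto
    then show ?thesis using that True by (simp add: pos_imp_zdiv_nonneg_iff)
  next
    case False
    then have "a div b < 0" using that by (simp add: neg_imp_zdiv_neg_iff pos_imp_zdiv_neg_iff)
    moreover have "a \<le> a div b"
      using that False by (metis div_by_1 int_one_le_iff_zero_less linorder_not_le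
        order_less_imp_le zdiv_mono2_neg zero_less_one)
    ultimately show ?thesis by simp
  qed
  show ?thesis
  proof (cases "b > 0")
    case True then show ?thesis by (rule *)
  next
    case False
    show ?thesis
    proof (cases "b = 0")
      case False
      with \<open>\<not> b > 0\<close> have "\<bar>(-a) div (-b)\<bar> \<le> \<bar>-a\<bar>" by (intro *) simp
      then show ?thesis by simp
    qed simp
  qed
qed

lemma abs_mod_le: "\<bar>a mod b\<bar> \<le> \<bar>a\<bar> + \<bar>b\<bar>" for a b :: int
proof (cases "b = 0")
  case False
  then have "\<bar>a mod b\<bar> < \<bar>b\<bar>" by (rule abs_mod_less)
  then show ?thesis by simp
qed simp

lemma emax_nonneg: "0 \<le> U \<Longrightarrow> 0 \<le> emax U e"
  by (induction e) (auto split: binop.splits)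

lemma ev_emax:
  assumes "bnd U m" shows "\<bar>ev m e\<bar> \<le> emax U e"
proof -
  have U: "0 \<le> U" using bndD[OF assms, of 0] by simp
  show ?thesis
  proof (induction e)
    case (Load e)
    then show ?case using bndD[OF assms] by simp
  next
    case (Bin f a b)
    show ?case
    proof (cases f)
      case Mul
      then show ?thesis using Bin emax_nonneg[OF U] by (simp add: abs_mult mult_mono)
    next
      case Div
      then show ?thesis using Bin abs_div_le[of "ev m a" "ev m b"] by simp
    next
      case Mod
      then show ?thesis using Bin abs_mod_le[of "ev m a" "ev m b"] by simp
    qed (use Bin in auto)
  qed simp
qed

lemma eval_expr_ev:
  assumes "bnd U m" "esafe U B e" shows "eval_expr B m e = Some (ev m e)"
  using assms(2)
proof (induction e)
  case (Load e)
  then show ?case using bndD[OF assms(1), of "ev m e"] by (simp add: to_word_def)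
next
  case (Bin f a b)
  have "\<bar>ev m (Bin f a b)\<bar> \<le> B" using ev_emax[OF assms(1), of "Bin f a b"] Bin.prems by simp
  then show ?case using Bin by (simp add: to_word_def)
qed (simp add: to_word_def)

lemma esafe_mono: "esafe U B e \<Longrightarrow> B \<le> B' \<Longrightarrow> esafe U B' e"
  by (induction e) auto

lemma psafe_mono: "psafe U B p \<Longrightarrow> B \<le> B' \<Longrightarrow> psafe U B' p"
  by (induction p) (auto intro: esafe_mono)

lemma int_le_two_power: "\<bar>k\<bar> \<le> 2 ^ nat \<bar>k\<bar>" for k :: int
proof -
  have "int (nat \<bar>k\<bar>) \<le> int (2 ^ nat \<bar>k\<bar>)" by (metis less_imp_le of_nat_le_iff less_exp)
  then show ?thesis by simp
qed

text \<open>Powers of \<open>U\<close> are closed under the operations: products add exponents, and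
  since \<open>U\<close> is at least 2 one more factor absorbs the sum of two bounds. Literals are
  covered by |k| \<le> 2^|k|.\<close>

lemma esafe_ex: "\<exists>k. \<forall>U\<ge>2. emax U e \<le> U ^ k \<and> esafe U (U ^ k) e"
proof (induction e)
  case (Lit j)
  have "\<bar>j\<bar> \<le> U ^ nat \<bar>j\<bar>" if "U \<ge> 2" for U :: int
    using int_le_two_power[of j] power_mono[of 2 U "nat \<bar>j\<bar>"] that by linarith
  then show ?case by auto
next
  case (Load e)
  then obtain k where k: "\<And>U. U \<ge> 2 \<Longrightarrow> esafe U (U ^ k) e" by blast
  have "emax U (Load e) \<le> U ^ Suc k \<and> esafe U (U ^ Suc k) (Load e)" if "U \<ge> 2" for U
  proof -
    have "U ^ k \<le> U ^ Suc k" "U ^ 1 \<le> U ^ Suc k"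
      using that by (intro power_increasing; simp)+
    then show ?thesis using esafe_mono[OF k[OF that]] by simp
  qed
  then show ?case by blast
next
  case (Bin f a b)
  then obtain k l where k: "\<And>U. U \<ge> 2 \<Longrightarrow> emax U a \<le> U ^ k \<and> esafe U (U ^ k) a"
    and l: "\<And>U. U \<ge> 2 \<Longrightarrow> emax U b \<le> U ^ l \<and> esafe U (U ^ l) b" by blast
  define s where "s = Suc (k + l)"
  have "emax U (Bin f a b) \<le> U ^ s \<and> esafe U (U ^ s) (Bin f a b)" if U: "U \<ge> 2" for U
  proof -
    have p: "1 \<le> U ^ k" "1 \<le> U ^ l" using U by (auto intro: one_le_power)
    have kl: "U ^ k \<le> U ^ (k + l)" "U ^ l \<le> U ^ (k + l)" "U ^ k \<le> U ^ s" "U ^ l \<le> U ^ s"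
      unfolding s_def using U by (intro power_increasing; simp)+
    have s2: "2 * U ^ (k + l) \<le> U ^ s" using U by (simp add: s_def)
    have nn: "0 \<le> emax U a" "0 \<le> emax U b" using U by (auto intro: emax_nonneg)
    have mul: "emax U a * emax U b \<le> U ^ (k + l)"
      using k[OF U] l[OF U] nn by (simp add: power_add mult_mono)
    have "1 \<le> U ^ s" using p kl by linarith
    then have "emax U (Bin f a b) \<le> U ^ s"
      using k[OF U] l[OF U] mul s2 kl nn p by (cases f; simp; linarith)
    then show ?thesis using k[OF U] l[OF U] kl by (auto intro: esafe_mono)
  qed
  then show ?case by blast
qed

text \<open>The exponent depends on the program alone and not on the instance; it is one of the two
  factors of the constant \<open>\<kappa>\<close> of the word size.\<close>

lemma psafe_ex: "\<exists>k. \<forall>U\<ge>2. psafe U (U ^ k) p"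
proof -
  have up: "psafe U (U ^ (i + j)) p" "psafe U (U ^ (j + i)) p" if "U \<ge> 2" "psafe U (U ^ i) p" for U i j p
    using that by (auto intro!: psafe_mono[OF that(2)] power_increasing)
  have eup: "esafe U (U ^ (i + j)) p" "esafe U (U ^ (j + i)) p" if "U \<ge> 2" "esafe U (U ^ i) p" for U i j p
    using that by (auto intro!: esafe_mono[OF that(2)] power_increasing)
  show ?thesis
  proof (induction p)
    case (Store a e)
    obtain i j where "\<forall>U\<ge>2. esafe U (U ^ i) a" "\<forall>U\<ge>2. esafe U (U ^ j) e" using esafe_ex by meson
    then show ?case by (intro exI[of _ "i + j"]) (simp add: eup)
  next
    case (Seq p q)
    then obtain i j where "\<forall>U\<ge>2. psafe U (U ^ i) p" "\<forall>U\<ge>2. psafe U (U ^ j) q" by meson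
    then show ?case by (intro exI[of _ "i + j"]) (simp add: up)
  next
    case (Cond e p q)
    then obtain i j where "\<forall>U\<ge>2. psafe U (U ^ i) p" "\<forall>U\<ge>2. psafe U (U ^ j) q" by meson
    moreover obtain l where "\<forall>U\<ge>2. esafe U (U ^ l) e" using esafe_ex by meson
    ultimately show ?case by (intro exI[of _ "l + (i + j)"]) (simp add: up eup)
  next
    case (Loop e p)
    then obtain i where "\<forall>U\<ge>2. psafe U (U ^ i) p" by meson
    moreover obtain l where "\<forall>U\<ge>2. esafe U (U ^ l) e" using esafe_ex by meson
    ultimately show ?case by (intro exI[of _ "l + i"]) (simp add: up eup)
  qed simp
qed

text \<open>A triple with a time bound that also preserves the bound \<open>U\<close> on the cells.
  The word range is quantified inside and thus disappears from all later reasoning. A postcondition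
  may itself be a \<open>runs\<close> statement, which is how sequences are composed.\<close>

definition runs :: "int \<Rightarrow> prog \<Rightarrow> (int \<Rightarrow> int) \<Rightarrow> nat \<Rightarrow> ((int \<Rightarrow> int) \<Rightarrow> bool) \<Rightarrow> bool" where
  "runs U p m T Q \<longleftrightarrow> (\<forall>B. psafe U B p \<longrightarrow> bnd U m \<longrightarrow>
     (\<exists>t m'. exec B p m t m' \<and> t \<le> T \<and> bnd U m' \<and> Q m'))"

lemma runs_bnd: "(bnd U m \<Longrightarrow> runs U p m T Q) \<Longrightarrow> runs U p m T Q"
  by (auto simp: runs_def)

lemma runs_conseq:
  assumes "runs U p m T Q" "T \<le> T'" "\<And>m'. bnd U m' \<Longrightarrow> Q m' \<Longrightarrow> Q' m'"
  shows "runs U p m T' Q'"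
  using assms unfolding runs_def by (meson order_trans)

lemma runs_Seq:
  assumes "runs U p m T1 (\<lambda>m'. runs U q m' T2 Q)"
  shows "runs U (Seq p q) m (T1 + T2) Q"
  unfolding runs_def
proof (intro allI impI)
  fix B assume s: "psafe U B (Seq p q)" and b: "bnd U m"
  then obtain t1 m1 where 1: "exec B p m t1 m1" "t1 \<le> T1" "bnd U m1" "runs U q m1 T2 Q"
    using assms by (auto simp: runs_def)
  then obtain t2 m2 where "exec B q m1 t2 m2" "t2 \<le> T2" "bnd U m2" "Q m2"
    using s by (auto simp: runs_def)
  with 1 show "\<exists>t m'. exec B (Seq p q) m t m' \<and> t \<le> T1 + T2 \<and> bnd U m' \<and> Q m'"
    by (intro exI[of _ "t1 + t2"] exI[of _ m2]) (auto intro: exec.Seq)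
qed

lemma runs_Seq':
  assumes "runs U p m T1 Q1" "\<And>m'. bnd U m' \<Longrightarrow> Q1 m' \<Longrightarrow> runs U q m' T2 Q"
  shows "runs U (Seq p q) m (T1 + T2) Q"
  by (rule runs_Seq, rule runs_conseq[OF assms(1) order_refl], rule assms(2))

lemma runs_Cond:
  assumes "ev m e \<noteq> 0 \<Longrightarrow> runs U p m T Q" "ev m e = 0 \<Longrightarrow> runs U q m T Q"
  shows "runs U (Cond e p q) m (expr_cost e + 1 + T) Q"
  unfolding runs_def
proof (intro allI impI)
  fix B assume s: "psafe U B (Cond e p q)" and b: "bnd U m"
  have e: "eval_expr B m e = Some (ev m e)" using s b by (auto intro: eval_expr_ev)
  show "\<exists>t m'. exec B (Cond e p q) m t m' \<and> t \<le> expr_cost e + 1 + T \<and> bnd U m' \<and> Q m'"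
  proof (cases "ev m e = 0")
    case True
    then obtain t m' where "exec B q m t m'" "t \<le> T" "bnd U m'" "Q m'"
      using assms(2) s b by (auto simp: runs_def)
    then show ?thesis using exec.Cond_False[of B m e q t m' p] e True
      by (intro exI[of _ "expr_cost e + 1 + t"] exI[of _ m']) simp
  next
    case False
    then obtain t m' where "exec B p m t m'" "t \<le> T" "bnd U m'" "Q m'"
      using assms(1) s b by (auto simp: runs_def)
    then show ?thesis using exec.Cond_True[of B m e "ev m e" p t m' q] e False
      by (intro exI[of _ "expr_cost e + 1 + t"] exI[of _ m']) simp
  qed
qed

text \<open>The number N of passes is known beforehand and indexes the invariant, which takes the
  place of a variant and yields the time bound at the same time.\<close>

lemma runs_Loop:
  assumes I0: "I 0 m"
    and step: "\<And>k m. k < N \<Longrightarrow> I k m \<Longrightarrow> bnd U m \<Longrightarrow> ev m g \<noteq> 0 \<and> runs U p m T (I (Suc k))"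
    and fin: "\<And>m. I N m \<Longrightarrow> ev m g = 0"
  shows "runs U (Loop g p) m (N * (expr_cost g + 1 + T) + (expr_cost g + 1)) (I N)"
proof -
  have "\<exists>t m'. exec B (Loop g p) m t m' \<and> t \<le> (N - k) * (expr_cost g + 1 + T) + (expr_cost g + 1)
      \<and> bnd U m' \<and> I N m'"
    if "psafe U B (Loop g p)" "bnd U m" "I k m" "k \<le> N" for B m k
    using that
  proof (induction "N - k" arbitrary: m k)
    case 0
    then have "k = N" by simp
    then have "eval_expr B m g = Some 0" using 0 fin eval_expr_ev[of U m B g] by simp
    then have "exec B (Loop g p) m (expr_cost g + 1) m" by (rule exec.Loop_False)
    then show ?case using 0 \<open>k = N\<close> by auto
  next
    case (Suc r)
    then have k: "k < N" by simp
    from step[OF k] Suc.prems have g: "ev m g \<noteq> 0" and r: "runs U p m T (I (Suc k))" by auto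
    obtain t1 m1 where 1: "exec B p m t1 m1" "t1 \<le> T" "bnd U m1" "I (Suc k) m1"
      using r Suc.prems by (auto simp: runs_def)
    obtain t2 m2 where 2: "exec B (Loop g p) m1 t2 m2"
      "t2 \<le> (N - Suc k) * (expr_cost g + 1 + T) + (expr_cost g + 1)" "bnd U m2" "I N m2"
      using Suc.hyps(1)[OF _ Suc.prems(1) 1(3,4)] Suc.hyps(2) k by force
    have "exec B (Loop g p) m (expr_cost g + 1 + t1 + t2) m2"
      using eval_expr_ev[of U m B g] Suc.prems g 1 2 by (intro exec.Loop_True) auto
    moreover have "N - k = Suc (N - Suc k)" using k by simp
    then have "expr_cost g + 1 + t1 + t2 \<le> (N - k) * (expr_cost g + 1 + T) + (expr_cost g + 1)"
      using 1 2 by simp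
    ultimately show ?case using 2 by blast
  qed
  from this[of _ m 0] show ?thesis using I0 by (simp add: runs_def)
qed

section \<open>Symbolic execution of loop-free code\<close>

fun loopfree :: "prog \<Rightarrow> bool" where
  "loopfree Skip = True"
| "loopfree (Store a e) = True"
| "loopfree (Seq p q) = (loopfree p \<and> loopfree q)"
| "loopfree (Cond e p q) = (loopfree p \<and> loopfree q)"
| "loopfree (Loop e p) = False"

fun srun :: "prog \<Rightarrow> (int \<Rightarrow> int) \<Rightarrow> (int \<Rightarrow> int)" where
  "srun Skip m = m"
| "srun (Store a e) m = m(ev m a := ev m e)"
| "srun (Seq p q) m = srun q (srun p m)"
| "srun (Cond e p q) m = (if ev m e \<noteq> 0 then srun p m else srun q m)"
| "srun (Loop e p) m = m"

text \<open>Intermediate values may reach a power of \<open>U\<close>, but what is written back must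
  again be at most \<open>U\<close>. Only this part depends on the actual values and is left to each
  use of loop-free code.\<close>

fun sok :: "int \<Rightarrow> prog \<Rightarrow> (int \<Rightarrow> int) \<Rightarrow> bool" where
  "sok U Skip m = True"
| "sok U (Store a e) m = (\<bar>ev m e\<bar> \<le> U)"
| "sok U (Seq p q) m = (sok U p m \<and> sok U q (srun p m))"
| "sok U (Cond e p q) m = (if ev m e \<noteq> 0 then sok U p m else sok U q m)"
| "sok U (Loop e p) m = True"

text \<open>Both branches of a conditional are charged, which makes this an upper bound that does
  not depend on the memory.\<close>

fun pcost :: "prog \<Rightarrow> nat" where
  "pcost Skip = 1"
| "pcost (Store a e) = expr_cost a + expr_cost e + 1"
| "pcost (Seq p q) = pcost p + pcost q"
| "pcost (Cond e p q) = expr_cost e + 1 + (pcost p + pcost q)"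
| "pcost (Loop e p) = 0"

lemma runs_loopfree:
  assumes "loopfree p" "bnd U m \<Longrightarrow> sok U p m" "bnd U m \<Longrightarrow> Q (srun p m)"
  shows "runs U p m (pcost p) Q"
proof -
  have *: "runs U p m (pcost p) Q"
    if "loopfree p" "sok U p m" "Q (srun p m)" for m Q
    using that
  proof (induction p arbitrary: m Q)
    case Skip
    then show ?case unfolding runs_def by (metis exec.Skip order_refl pcost.simps(1) srun.simps(1))
  next
    case (Store a e)
    show ?case unfolding runs_def
    proof (intro allI impI)
      fix B assume "psafe U B (Store a e)" and b: "bnd U m"
      then have "exec B (Store a e) m (expr_cost a + expr_cost e + 1) (m(ev m a := ev m e))"
        by (intro exec.Store eval_expr_ev[OF b]) auto
      moreover have "bnd U (m(ev m a := ev m e))" using b Store by (simp add: bnd_def)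
      ultimately show "\<exists>t m'. exec B (Store a e) m t m' \<and> t \<le> pcost (Store a e) \<and> bnd U m' \<and> Q m'"
        using Store.prems
        by (intro exI[of _ "expr_cost a + expr_cost e + 1"] exI[of _ "m(ev m a := ev m e)"])
          (simp add: fun_upd_def)
    qed
  next
    case (Seq p q)
    then show ?case by (auto intro!: runs_Seq)
  next
    case (Cond e p q)
    show ?case
    proof (simp, rule runs_Cond[simplified])
      assume "ev m e \<noteq> 0"
      then have "runs U p m (pcost p) Q" using Cond by auto
      then show "runs U p m (pcost p + pcost q) Q" by (rule runs_conseq) auto
    next
      assume "ev m e = 0"
      then have "runs U q m (pcost q) Q" using Cond by auto
      then show "runs U q m (pcost p + pcost q) Q" by (rule runs_conseq) auto
    qed
  qed simp
  show ?thesis using assms * runs_bnd by blast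
qed

subsection \<open>Vectors as words\<close>

lemma zdiv_less_if:
  fixes v b c :: int
  assumes "v < b * c" "0 < b"
  shows "v div b < c"
proof (rule ccontr)
  assume "\<not> v div b < c"
  then have "b * c \<le> b * (v div b)" using assms(2) by simp
  also have "\<dots> \<le> v" using pos_mod_sign[OF assms(2), of v] minus_mod_eq_mult_div[of v b] by linarith
  finally show False using assms(1) by simp
qed

lemma digit_sum:
  fixes a :: "nat \<Rightarrow> int"
  assumes "\<And>i. i < n \<Longrightarrow> 0 \<le> a i \<and> a i < b" "k < n"
  shows "(\<Sum>i<n. a i * b ^ i) div b ^ k mod b = a k"
  using assms
proof (induction n arbitrary: a k)
  case (Suc n)
  have b: "0 < b" using Suc.prems(1)[of 0] by simp
  define s where "s = (\<Sum>i<n. a (Suc i) * b ^ i)"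
  have eq: "(\<Sum>i<Suc n. a i * b ^ i) = a 0 + b * s"
    unfolding sum.lessThan_Suc_shift s_def sum_distrib_left by (auto intro!: sum.cong simp: algebra_simps)
  have 0: "0 \<le> a 0" "a 0 < b" using Suc.prems(1)[of 0] by auto
  show ?case
  proof (cases k)
    case 0
    then show ?thesis unfolding eq using \<open>0 \<le> a 0\<close> \<open>a 0 < b\<close> by simp
  next
    case (Suc k')
    have "(a 0 + b * s) div b = s" using 0 b by simp
    then have "(a 0 + b * s) div b ^ k = s div b ^ k'"
      using Suc b by (metis div_mult2_eq' less_le power_Suc zdiv_zmult2_eq zero_le_power)
    then show ?thesis unfolding eq using Suc.IH[of "\<lambda>i. a (Suc i)" k'] Suc.prems Suc
      by (simp add: s_def)
  qed
qed simp

lemma sum_digits: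
  fixes v :: int
  assumes "0 \<le> v" "v < b ^ n" "0 < b"
  shows "(\<Sum>i<n. (v div b ^ i mod b) * b ^ i) = v"
  using assms(1,2)
proof (induction n arbitrary: v)
  case (Suc n)
  have "v div b < b ^ n" using Suc.prems assms(3) 
    by (intro zdiv_less_if) simp_all
  moreover have "0 \<le> v div b" using Suc.prems assms(3) by (simp add: pos_imp_zdiv_nonneg_iff)
  ultimately have IH: "(\<Sum>i<n. (v div b div b ^ i mod b) * b ^ i) = v div b"
    by (intro Suc.IH)
  have "v div b ^ Suc i = v div b div b ^ i" for i
    using assms(3) by (metis less_le power_Suc zdiv_zmult2_eq zero_le_power)
  then have "(\<Sum>i<Suc n. (v div b ^ i mod b) * b ^ i) =
      v mod b + b * (\<Sum>i<n. (v div b div b ^ i mod b) * b ^ i)"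
    unfolding sum.lessThan_Suc_shift sum_distrib_left by (auto intro!: sum.cong simp: algebra_simps)
  then show ?case by (simp add: IH)
qed simp

definition base :: "nat \<Rightarrow> int" where "base d = 4 * int d + 1"

text \<open>The word whose balanced digits are all 2 d, that is (\<open>base d ^ n\<close> - 1) / 2.
  Adding it turns balanced digits into ordinary ones, and the encodable words are exactly those of
  absolute value at most \<open>offset d n\<close>.\<close>

definition offset :: "nat \<Rightarrow> nat \<Rightarrow> int" where "offset d n = (\<Sum>i<n. 2 * int d * base d ^ i)"

text \<open>Vectors are stored as single words, in a numeral system with the balanced digits
  \<open>- 2 * d, \<dots>, 2 * d\<close>, so that the sum of two vectors with entries in \<open>{- d..d}\<close> is a sum of words.\<close>

definition enc :: "nat \<Rightarrow> nat \<Rightarrow> (nat \<Rightarrow> int) \<Rightarrow> int" where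
  "enc d n c = (\<Sum>i<n. c i * base d ^ i)"

definition digit :: "nat \<Rightarrow> nat \<Rightarrow> int \<Rightarrow> nat \<Rightarrow> int" where
  "digit d n v i = (v + offset d n) div base d ^ i mod base d - 2 * int d"

lemma base_pos [simp]: "0 < base d" "1 \<le> base d" "base d \<noteq> 0"
  by (auto simp: base_def)

lemma base_power_nonneg [simp]: "0 \<le> base d ^ i" "\<bar>base d ^ i\<bar> = base d ^ i"
  by (simp_all add: base_def)

lemma offset_eq: "2 * offset d n + 1 = base d ^ n"
  by (induction n) (auto simp: offset_def algebra_simps base_def)

lemma offset_nonneg: "0 \<le> offset d n"
  by (auto simp: offset_def intro!: sum_nonneg)

lemma enc_offset: "enc d n c + offset d n = (\<Sum>i<n. (c i + 2 * int d) * base d ^ i)"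
  by (simp add: enc_def offset_def sum.distrib algebra_simps)

lemma dg_enc:
  assumes "\<And>i. i < n \<Longrightarrow> \<bar>c i\<bar> \<le> 2 * int d" "i < n"
  shows "digit d n (enc d n c) i = c i"
  unfolding digit_def enc_offset
  by (subst digit_sum) (use assms in \<open>force simp: base_def abs_le_iff\<close>)+

lemma enc_dg:
  assumes "\<bar>v\<bar> \<le> offset d n"
  shows "enc d n (digit d n v) = v"
proof -
  have "enc d n (digit d n v) + offset d n = v + offset d n"
    unfolding enc_offset digit_def using assms offset_eq[of d n]
    by (simp, subst sum_digits) auto
  then show ?thesis by simp
qed

lemma dg_bound: "\<bar>digit d n v i\<bar> \<le> 2 * int d"
proof -
  define q where "q = (v + offset d n) div base d ^ i mod base d"
  have "0 \<le> q" "q < 4 * int d + 1" using pos_mod_bound[of "base d"] by (simp_all add: q_def base_def)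
  then show ?thesis unfolding digit_def q_def[symmetric] by linarith
qed

lemma abs_enc_le:
  assumes "\<And>i. i < n \<Longrightarrow> \<bar>c i\<bar> \<le> 2 * int d"
  shows "\<bar>enc d n c\<bar> \<le> offset d n"
proof -
  have "\<bar>enc d n c\<bar> \<le> (\<Sum>i<n. \<bar>c i * base d ^ i\<bar>)" unfolding enc_def by (rule sum_abs)
  also have "\<dots> \<le> offset d n" unfolding offset_def
    by (intro sum_mono) (use assms in \<open>simp add: abs_mult mult_right_mono\<close>)
  finally show ?thesis .
qed

lemma enc_add: "enc d n a + enc d n b = enc d n (\<lambda>i. a i + b i)"
  by (simp add: enc_def sum.distrib algebra_simps)

text \<open>Digits of absolute value at most d add up to digits of absolute value at most 2 d, so no
  carry occurs. This is the reason for the base 4 d + 1 instead of 2 d + 1.\<close>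

lemma abs_add_le_offset:
  assumes "\<bar>v\<bar> \<le> offset d n" "\<bar>w\<bar> \<le> offset d n"
    "\<And>i. i < n \<Longrightarrow> \<bar>digit d n v i\<bar> \<le> int d" "\<And>i. i < n \<Longrightarrow> \<bar>digit d n w i\<bar> \<le> int d"
  shows "\<bar>v + w\<bar> \<le> offset d n"
proof -
  have "v + w = enc d n (\<lambda>i. digit d n v i + digit d n w i)"
    using enc_add[of d n "digit d n v" "digit d n w"] enc_dg assms(1,2) by simp
  also have "\<bar>\<dots>\<bar> \<le> offset d n"
    by (intro abs_enc_le) (use assms(3,4) in force)
  finally show ?thesis .
qed

subsection \<open>The program\<close>

text \<open>The nonnegative addresses belong to the input and the output. The registers and the three arrays
  interleave on the negative addresses, in the residue classes modulo \<open>4\<close>.\<close>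

definition reg :: "nat \<Rightarrow> int" where "reg k = - 1 - 4 * int k"
definition arr :: "nat \<Rightarrow> int \<Rightarrow> int" where "arr r i = - 1 - int r - 4 * i"
definition arr_addr :: "nat \<Rightarrow> expr \<Rightarrow> expr" where
  "arr_addr r e = Bin Sub (Lit (- 1 - int r)) (Bin Mul (Lit 4) e)"

lemma reg_eq [simp]: "reg i = reg j \<longleftrightarrow> i = j" by (simp add: reg_def)
lemma reg_neg [simp]: "reg i < 0" by (simp add: reg_def)
lemma arr_neg: "0 \<le> i \<Longrightarrow> arr r i < 0" by (simp add: arr_def)
lemma arr_eq [simp]: "arr r i = arr r j \<longleftrightarrow> i = j" by (simp add: arr_def)
lemma arr_neq: "r < 4 \<Longrightarrow> s < 4 \<Longrightarrow> r \<noteq> s \<Longrightarrow> arr r i \<noteq> arr s j"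
  by (simp add: arr_def) presburger
lemma arr_reg: "0 < r \<Longrightarrow> r < 4 \<Longrightarrow> arr r i \<noteq> reg k" "0 < r \<Longrightarrow> r < 4 \<Longrightarrow> reg k \<noteq> arr r i"
  by (simp_all add: arr_def reg_def) presburger+
lemma reg_nonneg [simp]: "0 \<le> a \<Longrightarrow> reg k \<noteq> a" "0 \<le> a \<Longrightarrow> a \<noteq> reg k"
  "reg k \<noteq> 3 + int i" "3 + int i \<noteq> reg k" "reg k \<noteq> 1" "1 \<noteq> reg k" "reg k \<noteq> 2" "2 \<noteq> reg k"
  "reg k \<noteq> 0" "0 \<noteq> reg k"
  using reg_neg[of k] by linarith+
lemma ev_Ax [simp]: "ev m (arr_addr r e) = arr r (ev m e)" by (simp add: arr_addr_def arr_def)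
lemma expr_cost_Ax [simp]: "expr_cost (arr_addr r e) = expr_cost e + 4" by (simp add: arr_addr_def)

abbreviation Rg :: "nat \<Rightarrow> expr" where "Rg k \<equiv> Load (Lit (reg k))"
abbreviation St :: "nat \<Rightarrow> expr \<Rightarrow> prog" where "St k e \<equiv> Store (Lit (reg k)) e"

text \<open>\<open>rN\<close>, \<open>rH\<close> and \<open>rCap\<close> hold n, the offset and the
  capacity; \<open>rC r\<close> holds the length of list r, for r = 1, 2. Building a level must
  preserve the first three and the result found so far in \<open>rFound\<close> and
  \<open>rSol\<close>: these are the numbers 0, 1, 2, 15, 16 in the frame conditions below.\<close>

abbreviation (input) rN :: nat where "rN \<equiv> 0"
abbreviation (input) rH :: nat where "rH \<equiv> 1"
abbreviation (input) rCap :: nat where "rCap \<equiv> 2"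
abbreviation (input) rV :: nat where "rV \<equiv> 3"
abbreviation (input) rEnc :: nat where "rEnc \<equiv> 4"
abbreviation (input) rX :: nat where "rX \<equiv> 5"
abbreviation (input) rI :: nat where "rI \<equiv> 6"
abbreviation (input) rDot :: nat where "rDot \<equiv> 7"
abbreviation (input) rOk :: nat where "rOk \<equiv> 8"
abbreviation (input) rDg :: nat where "rDg \<equiv> 9"
abbreviation (input) rZ :: nat where "rZ \<equiv> 10"
abbreviation (input) rZM :: nat where "rZM \<equiv> 11"
abbreviation (input) rA :: nat where "rA \<equiv> 12"
abbreviation (input) rB :: nat where "rB \<equiv> 13"
abbreviation (input) rDup :: nat where "rDup \<equiv> 14"
abbreviation (input) rFound :: nat where "rFound \<equiv> 15"
abbreviation (input) rSol :: nat where "rSol \<equiv> 16"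
abbreviation (input) rC :: "nat \<Rightarrow> nat" where "rC r \<equiv> 16 + r"
abbreviation (input) rP :: nat where "rP \<equiv> 19"
abbreviation (input) rQ :: nat where "rQ \<equiv> 20"
abbreviation (input) rPw :: nat where "rPw \<equiv> 21"

text \<open>A frame condition: at most the registers in \<open>K\<close> and the arrays in
  \<open>L\<close> have changed. Input and output cells, being the nonnegative addresses, are always
  preserved.\<close>

definition same :: "nat set \<Rightarrow> nat set \<Rightarrow> (int \<Rightarrow> int) \<Rightarrow> (int \<Rightarrow> int) \<Rightarrow> bool" where
  "same K L m m' \<longleftrightarrow> (\<forall>a\<ge>0. m' a = m a) \<and> (\<forall>k. k \<notin> K \<longrightarrow> m' (reg k) = m (reg k)) \<and>
     (\<forall>r i. r \<in> {1,2,3} - L \<longrightarrow> m' (arr r i) = m (arr r i))"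

lemma same_refl [simp]: "same K L m m" by (simp add: same_def)

lemma same_mono: "same K L m m' \<Longrightarrow> K \<subseteq> K'' \<Longrightarrow> L \<subseteq> L'' \<Longrightarrow> same K'' L'' m m'"
  unfolding same_def by (meson Diff_iff subsetD)

lemma same_trans:
  assumes "same K L m m'" "same K' L' m' m''" "K \<union> K' \<subseteq> K''" "L \<union> L' \<subseteq> L''"
  shows "same K'' L'' m m''"
proof -
  have "same K'' L'' m m'" "same K'' L'' m' m''"
    using assms by (auto intro: same_mono[OF assms(1)] same_mono[OF assms(2)])
  then show ?thesis by (simp add: same_def)
qed

lemma same_upd_reg: "same K L m m' \<Longrightarrow> k \<in> K \<Longrightarrow> same K L m (m'(reg k := v))"
  unfolding same_def by (auto simp: arr_reg)

lemma same_upd_arr: "same K L m m' \<Longrightarrow> r \<in> L \<Longrightarrow> r \<in> {1,2,3} \<Longrightarrow> 0 \<le> i \<Longrightarrow> same K L m (m'(arr r i := v))"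
  unfolding same_def by (auto simp: arr_reg arr_neq dest: arr_neg[of i r])

section \<open>Subroutines that test and store a single word\<close>

definition store_power :: "nat \<Rightarrow> int \<Rightarrow> prog" where
  "store_power k b = Seq (St k (Lit 1)) (Seq (St rI (Lit 0))
     (Loop (Bin Less (Rg rI) (Rg rN))
        (Seq (St k (Bin Mul (Rg k) (Lit b))) (St rI (Bin Add (Rg rI) (Lit 1))))))"

text \<open>The window {- V..V} modulo M is shifted by V, so that one remainder and one comparison
  decide it. Level 0 asks for an equation over the integers and not for a congruence.\<close>

definition window_test :: "nat \<Rightarrow> expr" where
  "window_test j = (if j = 0 then Bin Equal (Rg rDot) (Load (Lit 2))
     else Bin Less (Bin Mod (Bin Add (Bin Sub (Bin Mul (Lit (2 ^ j)) (Rg rDot)) (Load (Lit 2))) (Rg rV)) (Load (Lit 1)))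
       (Bin Add (Bin Mul (Lit 2) (Rg rV)) (Lit 1)))"

definition proc_init :: prog where
  "proc_init = Seq (St rX (Bin Add (Rg rEnc) (Rg rH))) (Seq (St rI (Lit 0)) (Seq (St rDot (Lit 0)) (St rOk (Lit 1))))"

text \<open>Digits are split off from the least significant end while the scalar product is
  accumulated. The machine has no absolute value, so |digit| \<le> R is tested on squares; the flag
  \<open>rOk\<close> is a running product of these tests.\<close>

definition proc_body :: "nat \<Rightarrow> nat \<Rightarrow> prog" where
  "proc_body d R = Seq (St rDg (Bin Sub (Bin Mod (Rg rX) (Lit (base d))) (Lit (2 * int d))))
     (Seq (St rX (Bin Div (Rg rX) (Lit (base d))))
     (Seq (St rDot (Bin Add (Rg rDot) (Bin Mul (Rg rDg) (Load (Bin Add (Lit 3) (Rg rI))))))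
     (Seq (St rOk (Bin Mul (Rg rOk) (Bin Less (Bin Mul (Rg rDg) (Rg rDg)) (Lit (int R * int R + 1)))))
       (St rI (Bin Add (Rg rI) (Lit 1))))))"

text \<open>A full list drops further words silently. This bounds the time on every input; that
  nothing is lost has to be shown with high probability.\<close>

definition insert_prog :: "nat \<Rightarrow> prog" where
  "insert_prog r = Seq (St rDg (Load (arr_addr 3 (Bin Add (Rg rEnc) (Rg rH)))))
     (Seq (St rDup (Lit 0))
     (Seq (Cond (Bin Mul (Bin Less (Lit (-1)) (Rg rDg)) (Bin Less (Rg rDg) (Rg (rC r))))
            (St rDup (Bin Equal (Load (arr_addr r (Rg rDg))) (Rg rEnc))) Skip)
       (Cond (Rg rDup) Skip
         (Cond (Bin Less (Rg (rC r)) (Rg rCap))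
           (Seq (Store (arr_addr r (Rg (rC r))) (Rg rEnc))
             (Seq (Store (arr_addr 3 (Bin Add (Rg rEnc) (Rg rH))) (Rg (rC r)))
               (St (rC r) (Bin Add (Rg (rC r)) (Lit 1))))) Skip))))"

definition process :: "nat \<Rightarrow> nat \<Rightarrow> nat \<Rightarrow> nat \<Rightarrow> prog" where
  "process d j R r = Seq (Seq proc_init (Loop (Bin Less (Rg rI) (Rg rN)) (proc_body d R)))
     ((Cond (Bin Mul (Rg rOk) (window_test j)) (insert_prog r) Skip))"

text \<open>One instance with a common bound \<open>U\<close> on all cell contents:
  \<open>U1\<close> is for encoded vectors, \<open>U2\<close> for partial scalar products,
  \<open>U4\<close> for the power behind the capacity, \<open>U5\<close> for the windows and
  \<open>U6\<close> for their denominators.\<close>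

locale instance_data =
  fixes d n :: nat and M \<tau> U :: int and x :: "int list"
  assumes M: "4 ^ n \<le> M" and x: "x \<in> input_vectors n M"
    and U1: "base d ^ n \<le> U" and U2: "(int n + 1) * (2 * int d + 1) * M \<le> U"
    and U3: "\<bar>\<tau>\<bar> \<le> U" and U4: "43 ^ n \<le> U" and U5: "2 ^ d * (M * 5 ^ n) \<le> U"
    and U6: "(2 * (int d + 1)) ^ n \<le> U"
begin

text \<open>The integer part of (43/5)^n. The base has to exceed 196/25 = 7.84, the growth of the
  levels, and its square may not exceed 18 sqrt(2 pi e).\<close>

definition cap :: int where "cap = 43 ^ n div 5 ^ n"

abbreviation "H \<equiv> offset d n"

text \<open>The factor 2^j makes room for a split: if the parent window is at most 2^j w, then
  adding 2^j times a number within w stays within 2^(j+1) w.\<close>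

definition V :: "nat \<Rightarrow> nat \<Rightarrow> int" where "V j \<rho> = 2 ^ j * ((M * 5 ^ n) div (2 * int \<rho>) ^ n)"

definition in_window :: "nat \<Rightarrow> nat \<Rightarrow> int \<Rightarrow> bool" where
  "in_window j \<rho> y \<longleftrightarrow> (if j = 0 then y = \<tau> else (2 ^ j * y - \<tau> + V j \<rho>) mod M \<le> 2 * V j \<rho>)"

definition partial_dot :: "int \<Rightarrow> nat \<Rightarrow> int" where "partial_dot v k = (\<Sum>i<k. digit d n v i * x ! i)"

definition accepts :: "nat \<Rightarrow> nat \<Rightarrow> nat \<Rightarrow> int \<Rightarrow> bool" where
  "accepts j \<rho> R v \<longleftrightarrow> (\<forall>i<n. \<bar>digit d n v i\<bar> \<le> int R) \<and> in_window j \<rho> (partial_dot v n)"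

definition Env :: "(int \<Rightarrow> int) \<Rightarrow> bool" where
  "Env m \<longleftrightarrow> m (reg rN) = int n \<and> m (reg rH) = H \<and> m (reg rCap) = cap \<and> m 1 = M \<and> m 2 = \<tau> \<and>
     (\<forall>i<n. m (3 + int i) = x ! i)"

text \<open>The entries are required to be distinct so that the length of the list is the
  cardinality of the set, to which the capacity refers.\<close>

definition stores :: "nat \<Rightarrow> int set \<Rightarrow> (int \<Rightarrow> int) \<Rightarrow> bool" where
  "stores r S m \<longleftrightarrow> 0 \<le> m (reg (rC r)) \<and> inj_on (\<lambda>i. m (arr r i)) {0..<m (reg (rC r))} \<and>
     S = (\<lambda>i. m (arr r i)) ` {0..<m (reg (rC r))}"

text \<open>Array \<open>3\<close> maps a word to its position in the list, which makes the search for duplicates take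
  constant time. An entry is trusted only if the list confirms it, so the array needs no
  initialization.\<close>

definition marked :: "nat \<Rightarrow> (int \<Rightarrow> int) \<Rightarrow> bool" where
  "marked r m \<longleftrightarrow> (\<forall>i\<in>{0..<m (reg (rC r))}. m (arr 3 (m (arr r i) + H)) = i)"

lemma Env_same: "Env m \<Longrightarrow> same K L m m' \<Longrightarrow> K \<inter> {0,1,2} = {} \<Longrightarrow> Env m'"
  unfolding Env_def same_def by auto

lemma lst_same: "stores r S m \<Longrightarrow> same K L m m' \<Longrightarrow> rC r \<notin> K \<Longrightarrow> r \<in> {1,2} \<Longrightarrow> r \<notin> L \<Longrightarrow> stores r S m'"
  unfolding stores_def same_def by auto

lemma mk_same: "marked r m \<Longrightarrow> same K L m m' \<Longrightarrow> rC r \<notin> K \<Longrightarrow> r \<in> {1,2} \<Longrightarrow> r \<notin> L \<Longrightarrow> 3 \<notin> L \<Longrightarrow> marked r m'"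
  unfolding marked_def same_def by auto

lemma len: "length x = n" using x by (simp add: input_vectors_def)

lemma x_range: "i < n \<Longrightarrow> 0 \<le> x ! i \<and> x ! i < M"
  using x nth_mem[of i x] unfolding input_vectors_def by fastforce

lemma M_pos: "0 < M" using M by (meson less_le_trans zero_less_numeral zero_less_power)

lemma nU: "int n + 1 \<le> U"
proof -
  have "int n + 1 \<le> (int n + 1) * ((2 * int d + 1) * M)"
    using mult_left_mono[of 1 "(2 * int d + 1) * M" "int n + 1"] mult_pos_pos[OF _ M_pos, of "2 * int d + 1"] by simp
  also have "\<dots> \<le> U" using U2 by (simp add: mult.assoc)
  finally show ?thesis .
qed

lemma hU: "2 * int d + 1 \<le> U"
proof -
  have "2 * int d + 1 \<le> (2 * int d + 1) * ((int n + 1) * M)"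
    using mult_left_mono[of 1 "(int n + 1) * M" "2 * int d + 1"] mult_pos_pos[OF _ M_pos, of "int n + 1"] by simp
  also have "\<dots> \<le> U" using U2 by (simp add: mult.assoc mult.left_commute)
  finally show ?thesis .
qed

lemma U_pos: "1 \<le> U" using nU by simp

lemma cap_bounds: "1 \<le> cap" "cap \<le> 43 ^ n" "cap \<le> U"
proof -
  have "(5::int) ^ n \<le> 43 ^ n" by (rule power_mono) auto
  then have "5 ^ n div 5 ^ n \<le> (43 ^ n div 5 ^ n :: int)" by (intro zdiv_mono1) auto
  then show "1 \<le> cap" by (simp add: cap_def)
  have "(43::int) ^ n div 5 ^ n \<le> 43 ^ n div 1" by (rule zdiv_mono2) auto
  then show "cap \<le> 43 ^ n" by (simp add: cap_def)
  then show "cap \<le> U" using U4 by simp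
qed

lemma dt_bound: "k \<le> n \<Longrightarrow> \<bar>partial_dot v k\<bar> \<le> U"
proof -
  assume k: "k \<le> n"
  have "\<bar>partial_dot v k\<bar> \<le> (\<Sum>i<k. \<bar>digit d n v i * x ! i\<bar>)" unfolding partial_dot_def by (rule sum_abs)
  also have "\<dots> \<le> (\<Sum>i<k. (2 * int d) * M)"
  proof (rule sum_mono)
    fix i assume "i \<in> {..<k}"
    then have "0 \<le> x ! i \<and> x ! i < M" using x_range k by auto
    then show "\<bar>digit d n v i * x ! i\<bar> \<le> (2 * int d) * M"
      unfolding abs_mult using dg_bound[of d n v i] by (intro mult_mono) auto
  qed
  also have "\<dots> = int k * (2 * int d * M)" by simp
  also have "\<dots> \<le> (int n + 1) * ((2 * int d + 1) * M)"
    using k M_pos by (intro mult_mono) auto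
  finally show ?thesis using U2 by (simp add: mult.assoc)
qed

lemma runs_powp:
  assumes "m (reg rN) = int n" "k \<noteq> rN" "k \<noteq> rI" "1 \<le> b" "b ^ n \<le> U"
  shows "runs U (store_power k b) m (40 * (n + 1)) (\<lambda>m'. same {k, rI} {} m m' \<and> m' (reg k) = b ^ n)"
proof -
  define I where "I i m' \<longleftrightarrow> same {k, rI} {} m m' \<and> m' (reg k) = b ^ i \<and> m' (reg rI) = int i" for i m'
  have L: "runs U (Loop (Bin Less (Rg rI) (Rg rN))
      (Seq (St k (Bin Mul (Rg k) (Lit b))) (St rI (Bin Add (Rg rI) (Lit 1))))) m'
      (n * (expr_cost (Bin Less (Rg rI) (Rg rN)) + 1 +
        pcost (Seq (St k (Bin Mul (Rg k) (Lit b))) (St rI (Bin Add (Rg rI) (Lit 1))))) +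
        (expr_cost (Bin Less (Rg rI) (Rg rN)) + 1)) (I n)" if "I 0 m'" for m'
  proof (rule runs_Loop[where I = I])
    fix i m' assume i: "i < n" and I: "I i m'"
    have N: "m' (reg rN) = int n" using I assms by (simp add: I_def same_def)
    have "b ^ Suc i \<le> b ^ n" using i assms by (intro power_increasing) auto
    then have "b ^ Suc i \<le> U" using assms by linarith
    moreover have "0 \<le> b ^ Suc i" using assms by simp
    ultimately have b: "\<bar>b ^ i * b\<bar> \<le> U" by (simp add: mult.commute)
    show "ev m' (Bin Less (Rg rI) (Rg rN)) \<noteq> 0 \<and>
      runs U (Seq (St k (Bin Mul (Rg k) (Lit b))) (St rI (Bin Add (Rg rI) (Lit 1)))) m'
       (pcost (Seq (St k (Bin Mul (Rg k) (Lit b))) (St rI (Bin Add (Rg rI) (Lit 1))))) (I (Suc i))"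
      using I i N assms b nU
      by (intro conjI runs_loopfree) (auto simp: I_def intro!: same_upd_reg)
  qed (use that assms in \<open>auto simp: I_def same_def\<close>)
  have "runs U (store_power k b) m (pcost (St k (Lit 1)) + (pcost (St rI (Lit 0)) + (n * (expr_cost (Bin Less (Rg rI) (Rg rN)) + 1 +
        pcost (Seq (St k (Bin Mul (Rg k) (Lit b))) (St rI (Bin Add (Rg rI) (Lit 1))))) +
        (expr_cost (Bin Less (Rg rI) (Rg rN)) + 1)))) (I n)"
    unfolding store_power_def
    by (intro runs_Seq runs_loopfree L) (use assms U_pos in \<open>auto simp: I_def intro!: same_upd_reg\<close>)
  then show ?thesis by (rule runs_conseq) (auto simp: I_def)
qed

definition decoded :: "nat \<Rightarrow> int \<Rightarrow> nat \<Rightarrow> (int \<Rightarrow> int) \<Rightarrow> bool" where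
  "decoded R v k m \<longleftrightarrow> m (reg rX) = (v + H) div base d ^ k \<and> m (reg rI) = int k \<and>
     m (reg rDot) = partial_dot v k \<and> m (reg rOk) = of_bool (\<forall>i<k. \<bar>digit d n v i\<bar> \<le> int R)"

lemma runs_proc_decode:
  assumes "Env m" "m (reg rEnc) = v" "\<bar>v\<bar> \<le> H"
  shows "runs U (Seq proc_init (Loop (Bin Less (Rg rI) (Rg rN)) (proc_body d R))) m (60 * (n + 1))
     (\<lambda>m'. same {rX, rI, rDot, rOk, rDg} {} m m' \<and> decoded R v n m')"
proof -
  define I where "I k m' \<longleftrightarrow> same {rX, rI, rDot, rOk, rDg} {} m m' \<and> decoded R v k m'" for k m'
  have vU: "0 \<le> v + H" "v + H < U" using assms(3) offset_eq[of d n] U1 by auto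
  have L: "runs U (Loop (Bin Less (Rg rI) (Rg rN)) (proc_body d R)) m'
      (n * (expr_cost (Bin Less (Rg rI) (Rg rN)) + 1 + pcost (proc_body d R)) +
        (expr_cost (Bin Less (Rg rI) (Rg rN)) + 1)) (I n)" if "I 0 m'" for m'
  proof (rule runs_Loop[where I = I])
    fix k m' assume k: "k < n" and I: "I k m'" and bd: "bnd U m'"
    have N: "m' (reg rN) = int n" and xk: "m' (3 + int k) = x ! k"
      using I assms(1) k by (auto simp: I_def Env_def same_def)
    have g: "(v + H) div base d ^ k mod base d - 2 * int d = digit d n v k" by (simp add: digit_def)
    have dgU: "\<bar>digit d n v k\<bar> \<le> U" using dg_bound[of d n v k] hU by simp
    have dv: "(v + H) div base d ^ k div base d = (v + H) div base d ^ Suc k"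
      by (metis base_pos(1) less_le power_Suc2 zdiv_zmult2_eq)
    have dvU: "\<bar>(v + H) div base d ^ Suc k\<bar> \<le> U"
      using abs_div_le[of "v + H" "base d ^ Suc k"] vU by linarith
    have dtS: "partial_dot v k + digit d n v k * x ! k = partial_dot v (Suc k)" by (simp add: partial_dot_def)
    have dtU: "\<bar>partial_dot v (Suc k)\<bar> \<le> U" using dt_bound[of "Suc k" v] k by simp
    have sq: "digit d n v k * digit d n v k < int R * int R + 1 \<longleftrightarrow> \<bar>digit d n v k\<bar> \<le> int R"
      "digit d n v k * digit d n v k \<le> int R * int R \<longleftrightarrow> \<bar>digit d n v k\<bar> \<le> int R"
      using abs_le_square_iff[of "digit d n v k" "int R"] by (simp_all add: power2_eq_square)
    have all: "(\<forall>i<Suc k. \<bar>digit d n v i\<bar> \<le> int R) \<longleftrightarrow>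
      (\<forall>i<k. \<bar>digit d n v i\<bar> \<le> int R) \<and> \<bar>digit d n v k\<bar> \<le> int R" by (auto simp: less_Suc_eq)
    have r: "m' (reg rX) = (v + H) div base d ^ k" "m' (reg rI) = int k" "m' (reg rDot) = partial_dot v k"
       "m' (reg rOk) = of_bool (\<forall>i<k. \<bar>digit d n v i\<bar> \<le> int R)"
       "same {rX, rI, rDot, rOk, rDg} {} m m'"
      using I by (auto simp: I_def decoded_def)
    show "ev m' (Bin Less (Rg rI) (Rg rN)) \<noteq> 0 \<and> runs U (proc_body d R) m' (pcost (proc_body d R)) (I (Suc k))"
    proof (intro conjI runs_loopfree)
      show "ev m' (Bin Less (Rg rI) (Rg rN)) \<noteq> 0" using r N k by simp
      show "loopfree (proc_body d R)" by (simp add: proc_body_def)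
      show "sok U (proc_body d R) m'"
        using U_pos nU k by (simp add: proc_body_def r N xk g dv dgU dvU dtS dtU sq del: power_Suc)
      show "I (Suc k) (srun (proc_body d R) m')"
        unfolding I_def decoded_def all
        by (auto simp: proc_body_def r N xk g dv dtS sq intro!: same_upd_reg)
    qed
  qed (use that assms in \<open>auto simp: I_def same_def decoded_def Env_def\<close>)
  have "runs U (Seq proc_init (Loop (Bin Less (Rg rI) (Rg rN)) (proc_body d R))) m (pcost proc_init + (n * (expr_cost (Bin Less (Rg rI) (Rg rN)) + 1 +
        pcost (proc_body d R)) +
        (expr_cost (Bin Less (Rg rI) (Rg rN)) + 1))) (I n)"
    using assms vU U_pos
    by (intro runs_Seq runs_loopfree L)
      (auto simp: I_def proc_init_def Env_def decoded_def partial_dot_def intro!: same_upd_reg)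
  then show ?thesis by (rule runs_conseq) (auto simp: I_def proc_body_def proc_init_def)
qed

lemma runs_insert_prog:
  assumes E: "Env m" and v: "m (reg rEnc) = v" "\<bar>v\<bar> \<le> H" and r: "r \<in> {1, 2}"
    and l: "stores r S m" "marked r m" "int (card S) \<le> cap"
  shows "runs U (insert_prog r) m 100 (\<lambda>m'. same {rDg, rDup, rC r} {r, 3} m m' \<and> marked r m' \<and>
     stores r (if int (card S) < cap then insert v S else S) m')"
proof -
  define c where "c = m (reg (rC r))"
  define f where "f i = m (arr r i)" for i
  have c0: "0 \<le> c" and inj: "inj_on f {0..<c}" and S: "S = f ` {0..<c}"
    using l(1) unfolding stores_def c_def f_def by auto
  have cS: "int (card S) = c" using S inj c0 by (simp add: card_image)
  have mkc: "\<And>i. 0 \<le> i \<Longrightarrow> i < c \<Longrightarrow> m (arr 3 (f i + H)) = i"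
    using l(2) by (auto simp: marked_def c_def f_def)
  have r': "0 < r" "r < 4" "r \<noteq> 3" "3 \<noteq> r" "r \<noteq> 0" using r by auto
  have Ef: "m (reg rH) = H" "m (reg (Suc 0)) = H" "m (reg rCap) = cap" "m (reg (rC r)) = c" using E by (auto simp: Env_def c_def)
  have v0: "0 \<le> v + H" using v(2) by simp
  define K where "K = m (arr 3 (v + H))"
  \<comment> \<open>If \<open>v\<close> sits at position i, then \<open>marked\<close> yields K = i;
    conversely, a position within the list that holds \<open>v\<close> proves membership. Arbitrary
    contents of array 3 cannot pass this test.\<close>
  have mem: "v \<in> S \<longleftrightarrow> 0 \<le> K \<and> K < c \<and> m (arr r K) = v"
    unfolding S K_def using mkc by (auto simp: f_def image_iff Bex_def)
  note A = arr_neq arr_reg r' reg_eq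
  define upd where "upd m' = m'(arr r c := v, arr 3 (v + H) := c, reg (rC r) := c + 1)" for m' :: "int \<Rightarrow> int"
  have new: "same {rDg, rDup, rC r} {r, 3} m (upd m') \<and> marked r (upd m') \<and> stores r (insert v S) (upd m')"
    if m': "same {rDg, rDup} {} m m'" and vS: "v \<notin> S" for m'
  proof -
    have fi: "m' (arr r i) = f i" "m' (arr 3 i) = m (arr 3 i)" "m' (reg (rC r)) = c" for i
      using m' r Ef by (auto simp: same_def f_def)
    have ne: "f i \<noteq> v" if "0 \<le> i" "i < c" for i using that vS S by auto
    have "same {rDg, rDup, rC r} {r, 3} m (upd m')"
      unfolding upd_def using same_mono[OF m', of "{rDg, rDup, rC r}" "{r, 3}"] c0 v0 r
      by (intro same_upd_reg same_upd_arr) auto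
    moreover have "marked r (upd m')"
      unfolding marked_def upd_def using mkc ne c0 by (auto simp: A fi)
    moreover have "stores r (insert v S) (upd m')"
    proof -
      have im: "{0..<c + 1} = insert c {0..<c}" using c0 by auto
      have fr: "upd m' (arr r i) = (if i = c then v else f i)" for i
        by (auto simp: upd_def A fi)
      have "inj_on (\<lambda>i. upd m' (arr r i)) {0..<c + 1}"
        unfolding fr im
      proof (rule inj_onI)
        fix i k assume i: "i \<in> insert c {0..<c}" and k: "k \<in> insert c {0..<c}"
          and eq: "(if i = c then v else f i) = (if k = c then v else f k)"
        show "i = k"
        proof (cases "i = c \<or> k = c")
          case True
          then show ?thesis using eq ne[of i] ne[of k] i k by (auto split: if_splits)
        next
          case False
          then show ?thesis using eq i k inj_onD[OF inj, of i k] by auto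
        qed
      qed
      moreover have "insert v S = (\<lambda>i. upd m' (arr r i)) ` {0..<c + 1}"
        unfolding fr im S by auto
      moreover have "upd m' (reg (rC r)) = c + 1" by (simp add: upd_def)
      ultimately show ?thesis using c0 unfolding stores_def by simp
    qed
    ultimately show ?thesis by blast
  qed
  define res where "res = srun (insert_prog r) m"
  have res: "res = (let m1 = m(reg rDg := K, reg rDup := of_bool (v \<in> S)) in
      if v \<notin> S \<and> c < cap then upd m1 else m1)"
  proof (cases "0 \<le> K \<and> K < c")
    case True
    show ?thesis
    proof (cases "m (arr r K) = v")
      case eq: True
      have "v \<in> S" using True eq mem by simp
      then show ?thesis using True eq
        by (simp add: res_def insert_prog_def Ef v(1) A K_def[symmetric] Let_def)
    next
      case neq: False
      have "v \<notin> S" using neq mem by simp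
      then show ?thesis using True neq
        by (simp add: res_def insert_prog_def Ef v(1) A K_def[symmetric] upd_def Let_def)
    qed
  next
    case False
    then have "v \<notin> S" using mem by blast
    moreover have "(if - 1 < K then 1 else 0) * (if K < c then 1 else 0) = (0::int)"
      using False by auto
    ultimately show ?thesis
      using False by (simp add: res_def insert_prog_def Ef v(1) A K_def[symmetric] upd_def Let_def)
  qed
  have "runs U (insert_prog r) m (pcost (insert_prog r)) (\<lambda>m'. same {rDg, rDup, rC r} {r, 3} m m' \<and> marked r m' \<and>
     stores r (if int (card S) < cap then insert v S else S) m')"
  proof (intro runs_loopfree)
    show "loopfree (insert_prog r)" by (simp add: insert_prog_def)
  next
    assume b: "bnd U m"
    have KU: "\<bar>K\<bar> \<le> U" "\<bar>v\<bar> \<le> U" "\<bar>c\<bar> \<le> U" using bndD[OF b] v(1) Ef by (auto simp: K_def)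
    have "c < cap \<Longrightarrow> \<bar>c + 1\<bar> \<le> U" using cap_bounds c0 by simp
    then show "sok U (insert_prog r) m"
      using KU U_pos by (auto simp: insert_prog_def Ef v(1) A K_def[symmetric])
  next
    have s1: "same {rDg, rDup} {} m (m(reg rDg := a, reg rDup := b))" for a b
      by (intro same_upd_reg) auto
    show "same {rDg, rDup, rC r} {r, 3} m (srun (insert_prog r) m) \<and> marked r (srun (insert_prog r) m) \<and>
      stores r (if int (card S) < cap then insert v S else S) (srun (insert_prog r) m)"
    proof (cases "v \<notin> S \<and> c < cap")
      case True
      then show ?thesis using new[OF s1, of K 0] unfolding res_def[symmetric] res cS by (simp add: Let_def)
    next
      case False
      then have S': "(if c < cap then insert v S else S) = S" by auto
      show ?thesis unfolding res_def[symmetric] res cS S' using False s1 l(1,2) r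
        by (auto simp: Let_def simp del: fun_upd_apply intro: same_mono[OF s1] lst_same[OF _ s1] mk_same[OF _ s1])
    qed
  qed
  then show ?thesis by (rule runs_conseq) (auto simp: insert_prog_def)
qed

lemma runs_proc:
  assumes E: "Env m" and v: "m (reg rEnc) = v" "\<bar>v\<bar> \<le> H" and r: "r \<in> {1, 2}"
    and V: "j > 0 \<Longrightarrow> m (reg rV) = V j \<rho>"
    and l: "stores r S m" "marked r m" "int (card S) \<le> cap"
  shows "runs U (process d j R r) m (200 * (n + 1))
    (\<lambda>m'. same {rX, rI, rDot, rOk, rDg, rDup, rC r} {r, 3} m m' \<and> marked r m' \<and>
     stores r (if accepts j \<rho> R v \<and> int (card S) < cap then insert v S else S) m')"
proof -
  let ?K = "{rX, rI, rDot, rOk, rDg}"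
  have T: "runs U (Cond (Bin Mul (Rg rOk) (window_test j)) (insert_prog r) Skip) m1 130
    (\<lambda>m'. same {rX, rI, rDot, rOk, rDg, rDup, rC r} {r, 3} m m' \<and> marked r m' \<and>
     stores r (if accepts j \<rho> R v \<and> int (card S) < cap then insert v S else S) m')"
    if s1: "same ?K {} m m1" and d1: "decoded R v n m1" for m1
  proof -
    have E1: "Env m1" by (rule Env_same[OF E s1]) auto
    have V1: "j > 0 \<Longrightarrow> m1 (reg rV) = V j \<rho>" using V s1 by (simp add: same_def)
    have v1: "m1 (reg rEnc) = v" using v s1 by (simp add: same_def)
    have l1: "stores r S m1" "marked r m1"
      using lst_same[OF l(1) s1] mk_same[OF l(2) s1] r by auto
    have ev: "ev m1 (Bin Mul (Rg rOk) (window_test j)) \<noteq> 0 \<longleftrightarrow> accepts j \<rho> R v"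
      using V1 d1 E1 by (auto simp: accepts_def in_window_def window_test_def decoded_def Env_def)
    have "runs U (Cond (Bin Mul (Rg rOk) (window_test j)) (insert_prog r) Skip) m1
      (expr_cost (Bin Mul (Rg rOk) (window_test j)) + 1 + 100)
      (\<lambda>m'. same {rX, rI, rDot, rOk, rDg, rDup, rC r} {r, 3} m m' \<and> marked r m' \<and>
       stores r (if accepts j \<rho> R v \<and> int (card S) < cap then insert v S else S) m')"
    proof (rule runs_Cond)
      assume "ev m1 (Bin Mul (Rg rOk) (window_test j)) \<noteq> 0"
      then have a: "accepts j \<rho> R v" using ev by simp
      show "runs U (insert_prog r) m1 100
       (\<lambda>m'. same {rX, rI, rDot, rOk, rDg, rDup, rC r} {r, 3} m m' \<and> marked r m' \<and>
         stores r (if accepts j \<rho> R v \<and> int (card S) < cap then insert v S else S) m')"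
        by (rule runs_conseq[OF runs_insert_prog[OF E1 v1 v(2) r l1 l(3)]])
          (use a in \<open>auto intro: same_trans[OF s1]\<close>)
    next
      assume "ev m1 (Bin Mul (Rg rOk) (window_test j)) = 0"
      then have a: "\<not> accepts j \<rho> R v" using ev by simp
      have "runs U Skip m1 (pcost Skip)
       (\<lambda>m'. same {rX, rI, rDot, rOk, rDg, rDup, rC r} {r, 3} m m' \<and> marked r m' \<and>
         stores r (if accepts j \<rho> R v \<and> int (card S) < cap then insert v S else S) m')"
        by (rule runs_loopfree) (use a l1 in \<open>auto intro: same_mono[OF s1]\<close>)
      then show "runs U Skip m1 100
       (\<lambda>m'. same {rX, rI, rDot, rOk, rDg, rDup, rC r} {r, 3} m m' \<and> marked r m' \<and>
         stores r (if accepts j \<rho> R v \<and> int (card S) < cap then insert v S else S) m')"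
        by (rule runs_conseq) auto
    qed
    then show ?thesis by (rule runs_conseq) (auto simp: window_test_def)
  qed
  have "runs U (process d j R r) m (60 * (n + 1) + 130)
    (\<lambda>m'. same {rX, rI, rDot, rOk, rDg, rDup, rC r} {r, 3} m m' \<and> marked r m' \<and>
     stores r (if accepts j \<rho> R v \<and> int (card S) < cap then insert v S else S) m')"
    unfolding process_def
  proof (rule runs_Seq'[OF runs_proc_decode[OF E v, of R]])
    fix m1 assume "same ?K {} m m1 \<and> decoded R v n m1"
    then show "runs U (Cond (Bin Mul (Rg rOk) (window_test j)) (insert_prog r) Skip) m1 130
     (\<lambda>m'. same {rX, rI, rDot, rOk, rDg, rDup, rC r} {r, 3} m m' \<and> marked r m' \<and>
     stores r (if accepts j \<rho> R v \<and> int (card S) < cap then insert v S else S) m')"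
      by (intro T) simp_all
  qed
  then show ?thesis
  proof (rule runs_conseq)
    show "60 * (n + 1) + 130 \<le> 200 * (n + 1)" by simp
  qed
qed

end

section \<open>Listing a box and joining a list with itself\<close>

definition brute_init :: prog where
  "brute_init = Seq (St rX (Rg rZ)) (Seq (St rI (Lit 0)) (Seq (St rEnc (Lit 0)) (St rPw (Lit 1))))"

definition brute_body :: "nat \<Rightarrow> nat \<Rightarrow> prog" where
  "brute_body d R = Seq (St rEnc (Bin Add (Rg rEnc) (Bin Mul
       (Bin Sub (Bin Mod (Rg rX) (Lit (2 * int R + 1))) (Lit (int R))) (Rg rPw))))
     (Seq (St rX (Bin Div (Rg rX) (Lit (2 * int R + 1))))
     (Seq (St rPw (Bin Mul (Rg rPw) (Lit (base d)))) (St rI (Bin Add (Rg rI) (Lit 1)))))"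

text \<open>A counter runs through the n-digit numerals in base 2 R + 1, and each value is recoded
  digit by digit as a word in base 4 d + 1.\<close>

definition enumerate_box :: "nat \<Rightarrow> nat \<Rightarrow> nat \<Rightarrow> nat \<Rightarrow> prog" where
  "enumerate_box d j R r = Seq (store_power rZM (2 * int R + 1)) (Seq (Seq (St (rC r) (Lit 0)) (St rZ (Lit 0)))
     (Loop (Bin Less (Rg rZ) (Rg rZM))
       (Seq (Seq brute_init (Loop (Bin Less (Rg rI) (Rg rN)) (brute_body d R)))
         (Seq (process d j R r) (St rZ (Bin Add (Rg rZ) (Lit 1)))))))"

text \<open>All ordered pairs from list s are added, and the accepted sums go to list r. The levels
  alternate between the two lists, so array 3 serves the list under construction only.\<close>

definition combine :: "nat \<Rightarrow> nat \<Rightarrow> nat \<Rightarrow> nat \<Rightarrow> nat \<Rightarrow> prog" where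
  "combine d j R r s = Seq (Seq (St (rC r) (Lit 0)) (St rA (Lit 0)))
     (Loop (Bin Less (Rg rA) (Rg (rC s)))
       (Seq (St rB (Lit 0))
         (Seq (Loop (Bin Less (Rg rB) (Rg (rC s)))
           (Seq (St rEnc (Bin Add (Load (arr_addr s (Rg rA))) (Load (arr_addr s (Rg rB)))))
             (Seq (process d j R r) (St rB (Bin Add (Rg rB) (Lit 1))))))
           (St rA (Bin Add (Rg rA) (Lit 1))))))"

lemma runs_Seq_loopfree:
  assumes "loopfree p" "bnd U m \<Longrightarrow> sok U p m" "bnd U m \<Longrightarrow> runs U q (srun p m) T Q"
  shows "runs U (Seq p q) m (pcost p + T) Q"
  by (intro runs_Seq runs_loopfree assms)

lemma balanced_digit: "\<bar>w mod (2 * int R + 1) - int R\<bar> \<le> int R"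
proof -
  define q where "q = w mod (2 * int R + 1)"
  have "0 \<le> q" "q < 2 * int R + 1" unfolding q_def by (rule pos_mod_sign pos_mod_bound; simp)+
  then show ?thesis unfolding q_def[symmetric] by linarith
qed

context instance_data begin

text \<open>What holds for a list on every input: \<open>X\<close> is the set of words offered so
  far, \<open>S\<close> contains accepted ones only, and all of them unless the capacity has been
  reached. Nothing is said about which words a full list keeps.\<close>

definition trunc :: "(int \<Rightarrow> bool) \<Rightarrow> int set \<Rightarrow> int set \<Rightarrow> bool" where
  "trunc A X S \<longleftrightarrow> finite S \<and> S \<subseteq> {v \<in> X. A v} \<and> int (card S) \<le> cap \<and>
     (int (card S) < cap \<longrightarrow> S = {v \<in> X. A v})"

lemma trunc_empty: "trunc A {} {}"
  using cap_bounds by (simp add: trunc_def)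

text \<open>Either the list still has room, and then it was complete before and stays so, or it is
  full and remains full.\<close>

lemma trunc_insert:
  assumes "trunc A X S"
  shows "trunc A (insert v X) (if A v \<and> int (card S) < cap then insert v S else S)"
proof (cases "A v \<and> int (card S) < cap")
  case True
  then have "S = {v \<in> X. A v}" using assms by (simp add: trunc_def)
  moreover have "card (insert v S) \<le> Suc (card S)" using assms by (simp add: trunc_def card_insert_if)
  moreover have "finite S" using assms by (simp add: trunc_def)
  ultimately show ?thesis using True by (auto simp: trunc_def)
next
  case False
  show ?thesis
  proof (cases "A v")
    case True
    then show ?thesis using False assms by (auto simp: trunc_def)
  next
    case False
    then have "{w \<in> insert v X. A w} = {w \<in> X. A w}" by auto
    then show ?thesis using False assms by (simp add: trunc_def)
  qed
qed

definition box_words :: "nat \<Rightarrow> int set" where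
  "box_words R = {enc d n c |c. \<forall>i<n. \<bar>c i\<bar> \<le> int R}"

lemma boxe_image: "box_words R = (\<lambda>z. enc d n (\<lambda>i. z div (2 * int R + 1) ^ i mod (2 * int R + 1) - int R)) ` {0..<(2 * int R + 1) ^ n}"
  (is "_ = ?W ` _")
proof (intro equalityI subsetI)
  fix v assume "v \<in> box_words R"
  then obtain c where c: "v = enc d n c" "\<And>i. i < n \<Longrightarrow> \<bar>c i\<bar> \<le> int R" by (auto simp: box_words_def)
  define z where "z = (\<Sum>i<n. (c i + int R) * (2 * int R + 1) ^ i)"
  have b: "0 \<le> c i + int R \<and> c i + int R < 2 * int R + 1" if "i < n" for i
    using c(2)[OF that] by linarith
  have dig: "z div (2 * int R + 1) ^ i mod (2 * int R + 1) = c i + int R" if "i < n" for i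
    unfolding z_def by (rule digit_sum[OF b that])
  have z: "0 \<le> z" "z < (2 * int R + 1) ^ n"
  proof -
    show "0 \<le> z" unfolding z_def using b by (intro sum_nonneg) auto
    have "z \<le> (\<Sum>i<n. (2 * int R) * (2 * int R + 1) ^ i)"
      unfolding z_def using b by (intro sum_mono mult_right_mono) auto
    also have "\<dots> < (2 * int R + 1) ^ n" by (induction n) (auto simp: algebra_simps)
    finally show "z < (2 * int R + 1) ^ n" .
  qed
  have "?W z = v" unfolding c(1) enc_def by (intro sum.cong) (use dig in auto)
  then show "v \<in> ?W ` {0..<(2 * int R + 1) ^ n}" using z by force
next
  fix v assume "v \<in> ?W ` {0..<(2 * int R + 1) ^ n}"
  then obtain z where "v = ?W z" by blast
  moreover have "\<bar>z div (2 * int R + 1) ^ i mod (2 * int R + 1) - int R\<bar> \<le> int R" for i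
    by (rule balanced_digit)
  ultimately show "v \<in> box_words R" unfolding box_words_def by blast
qed

lemma boxe_bound: "R \<le> d \<Longrightarrow> v \<in> box_words R \<Longrightarrow> \<bar>v\<bar> \<le> H"
  unfolding box_words_def by (force intro!: abs_enc_le)

lemma brute_encode:
  assumes N: "m (reg rN) = int n" and z: "m (reg rZ) = z" "0 \<le> z" "z < (2 * int R + 1) ^ n" and R: "R \<le> d"
  shows "runs U (Seq brute_init (Loop (Bin Less (Rg rI) (Rg rN)) (brute_body d R))) m (60 * (n + 1))
    (\<lambda>m'. same {rX, rI, rEnc, rPw} {} m m' \<and>
       m' (reg rEnc) = enc d n (\<lambda>i. z div (2 * int R + 1) ^ i mod (2 * int R + 1) - int R))"
proof -
  let ?b = "2 * int R + 1"
  let ?c = "\<lambda>i. z div ?b ^ i mod ?b - int R"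
  define I where "I k m' \<longleftrightarrow> same {rX, rI, rEnc, rPw} {} m m' \<and> m' (reg rX) = z div ?b ^ k \<and>
    m' (reg rI) = int k \<and> m' (reg rEnc) = enc d k ?c \<and> m' (reg rPw) = base d ^ k" for k m'
  have cb: "\<bar>?c i\<bar> \<le> int R" for i by (rule balanced_digit)
  have bU: "?b ^ n \<le> U"
  proof -
    have "?b ^ n \<le> base d ^ n" using R by (intro power_mono) (auto simp: base_def)
    then show ?thesis using U1 by simp
  qed
  have pU: "base d ^ k \<le> U" if "k \<le> n" for k
    using power_increasing[OF that, of "base d"] U1 by simp
  have L: "runs U (Loop (Bin Less (Rg rI) (Rg rN)) (brute_body d R)) m'
      (n * (expr_cost (Bin Less (Rg rI) (Rg rN)) + 1 + pcost (brute_body d R)) +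
        (expr_cost (Bin Less (Rg rI) (Rg rN)) + 1)) (I n)" if "I 0 m'" for m'
  proof (rule runs_Loop[where I = I])
    fix k m' assume k: "k < n" and I: "I k m'"
    have r: "m' (reg rX) = z div ?b ^ k" "m' (reg rI) = int k" "m' (reg rEnc) = enc d k ?c"
       "m' (reg rPw) = base d ^ k" "same {rX, rI, rEnc, rPw} {} m m'" "m' (reg rN) = int n"
      using I N by (auto simp: I_def same_def)
    have e: "enc d k ?c + ?c k * base d ^ k = enc d (Suc k) ?c" by (simp add: enc_def)
    have eU: "\<bar>enc d (Suc k) ?c\<bar> \<le> U"
    proof -
      have "\<bar>enc d (Suc k) ?c\<bar> \<le> offset d (Suc k)"
        by (rule abs_enc_le) (use cb R in \<open>smt (verit) of_nat_mono\<close>)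
      then show ?thesis using offset_eq[of d "Suc k"] pU[of "Suc k"] k offset_nonneg[of d "Suc k"] by linarith
    qed
    have dv: "z div ?b ^ k div ?b = z div ?b ^ Suc k"
      by (metis add.commute add_pos_nonneg mult_2 of_nat_0_le_iff power_Suc2 zdiv_zmult2_eq zero_less_one
          zero_le_mult_iff less_imp_le add_nonneg_nonneg)
    have dvU: "\<bar>z div ?b ^ Suc k\<bar> \<le> U" using abs_div_le[of z "?b ^ Suc k"] z bU by linarith
    have pp: "base d ^ k * base d = base d ^ Suc k" by simp
    have ppU: "base d ^ Suc k \<le> U" by (rule pU[OF Suc_leI[OF k]])
    show "ev m' (Bin Less (Rg rI) (Rg rN)) \<noteq> 0 \<and> runs U (brute_body d R) m' (pcost (brute_body d R)) (I (Suc k))"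
    proof (intro conjI runs_loopfree)
      show "ev m' (Bin Less (Rg rI) (Rg rN)) \<noteq> 0" using r k by simp
      show "loopfree (brute_body d R)" by (simp add: brute_body_def)
      show "sok U (brute_body d R) m'"
        using nU k by (simp add: brute_body_def r e eU dv dvU pp ppU del: power_Suc)
      show "I (Suc k) (srun (brute_body d R) m')"
        unfolding I_def
        by (simp add: brute_body_def r e dv pp same_upd_reg del: power_Suc)
    qed
  qed (use that N in \<open>auto simp: I_def same_def\<close>)
  have "runs U (Seq brute_init (Loop (Bin Less (Rg rI) (Rg rN)) (brute_body d R))) m (pcost brute_init +
      (n * (expr_cost (Bin Less (Rg rI) (Rg rN)) + 1 + pcost (brute_body d R)) +
        (expr_cost (Bin Less (Rg rI) (Rg rN)) + 1))) (I n)"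
    using z bU U_pos
    by (intro runs_Seq runs_loopfree L) (auto simp: I_def brute_init_def enc_def intro!: same_upd_reg)
  then show ?thesis by (rule runs_conseq) (auto simp: I_def brute_body_def brute_init_def)
qed

lemma runs_brute:
  assumes E: "Env m" and R: "R \<le> d" "R \<le> 36" and r: "r \<in> {1, 2}"
    and V: "j > 0 \<Longrightarrow> m (reg rV) = V j \<rho>"
  shows "runs U (enumerate_box d j R r) m (1000 * (n + 1) * 73 ^ n)
    (\<lambda>m'. same (UNIV - {0,1,2,15,16}) {1,2,3} m m' \<and> (\<exists>S. trunc (accepts j \<rho> R) (box_words R) S \<and> stores r S m'))"
proof -
  let ?b = "2 * int R + 1" let ?K = "{rX, rI, rDot, rOk, rDg, rDup, rC r, rZ, rEnc, rPw}"
  define W where "W z = enc d n (\<lambda>i. z div ?b ^ i mod ?b - int R)" for z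
  define B where "B = (2 * R + 1) ^ n"
  have B: "?b ^ n = int B" by (simp add: B_def add.commute)
  have B73: "B \<le> 73 ^ n" unfolding B_def using R by (intro power_mono) auto
  have bU: "?b ^ n \<le> U"
  proof -
    have "?b ^ n \<le> base d ^ n" using R by (intro power_mono) (auto simp: base_def)
    then show ?thesis using U1 by simp
  qed
  \<comment> \<open>\<open>m1\<close> is the memory right after (2 R + 1)^n has been stored in
    \<open>rZM\<close>; framing against it keeps the limit of the loop available.\<close>
  define I where "I m1 z m' \<longleftrightarrow> same ?K {r, 3} m1 m' \<and> m' (reg rZ) = int z \<and> marked r m' \<and>
    (\<exists>S. trunc (accepts j \<rho> R) (W ` {0..<int z}) S \<and> stores r S m')" for m1 z m'
  have body: "runs U (Seq (Seq brute_init (Loop (Bin Less (Rg rI) (Rg rN)) (brute_body d R)))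
         (Seq (process d j R r) (St rZ (Bin Add (Rg rZ) (Lit 1))))) m2 (300 * (n + 1)) (I m1 (Suc z))"
    if m1: "same {rZM, rI} {} m m1" and I: "I m1 z m2" and z: "z < B" for m1 m2 z
  proof -
    have z': "int z < ?b ^ n" using z B by simp
    from I obtain S where s2: "same ?K {r, 3} m1 m2" and zz: "m2 (reg rZ) = int z" and k2: "marked r m2"
      and S: "trunc (accepts j \<rho> R) (W ` {0..<int z}) S" "stores r S m2" by (auto simp: I_def)
    have E1: "Env m1" by (rule Env_same[OF E m1]) auto
    have E2: "Env m2" by (rule Env_same[OF E1 s2]) (use r in auto)
    have V2: "j > 0 \<Longrightarrow> m2 (reg rV) = V j \<rho>" using V m1 s2 r by (auto simp: same_def)
    have "runs U (Seq (Seq brute_init (Loop (Bin Less (Rg rI) (Rg rN)) (brute_body d R)))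
         (Seq (process d j R r) (St rZ (Bin Add (Rg rZ) (Lit 1))))) m2 (60 * (n + 1) + (200 * (n + 1) + pcost (St rZ (Bin Add (Rg rZ) (Lit 1))))) (I m1 (Suc z))"
    proof (rule runs_Seq'[OF brute_encode[of m2 "int z" R, OF _ zz _ z' R(1)]])
      show "m2 (reg rN) = int n" using E2 by (simp add: Env_def)
      show "0 \<le> int z" by simp
      fix m3 assume "same {rX, rI, rEnc, rPw} {} m2 m3 \<and> m3 (reg rEnc) = enc d n (\<lambda>i. int z div ?b ^ i mod ?b - int R)"
      then have s3: "same {rX, rI, rEnc, rPw} {} m2 m3" and e3: "m3 (reg rEnc) = W (int z)" by (auto simp: W_def)
      have Wb: "\<bar>W (int z)\<bar> \<le> H" by (rule boxe_bound[OF R(1)]) (use z' in \<open>auto simp: boxe_image W_def\<close>)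
      have E3: "Env m3" by (rule Env_same[OF E2 s3]) auto
      have V3: "j > 0 \<Longrightarrow> m3 (reg rV) = V j \<rho>" using V2 s3 by (auto simp: same_def)
      have l3: "stores r S m3" "marked r m3" using lst_same[OF S(2) s3] mk_same[OF k2 s3] r by auto
      have c3: "int (card S) \<le> cap" using S(1) by (simp add: trunc_def)
      show "runs U (Seq (process d j R r) (St rZ (Bin Add (Rg rZ) (Lit 1)))) m3
         (200 * (n + 1) + pcost (St rZ (Bin Add (Rg rZ) (Lit 1)))) (I m1 (Suc z))"
      proof (rule runs_Seq'[OF runs_proc[OF E3 e3 Wb r V3 l3 c3]])
        let ?S = "if accepts j \<rho> R (W (int z)) \<and> int (card S) < cap then insert (W (int z)) S else S"
        fix m4 assume m4: "same {rX, rI, rDot, rOk, rDg, rDup, rC r} {r, 3} m3 m4 \<and> marked r m4 \<and> stores r ?S m4"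
        have z4: "m4 (reg rZ) = int z" using m4 s3 zz r by (auto simp: same_def)
        have im: "{0..<int (Suc z)} = insert (int z) {0..<int z}" by auto
        have s24: "same ?K {r, 3} m2 m4"
          by (rule same_trans[OF s3 conjunct1[OF m4]]) auto
        have s14: "same ?K {r, 3} m1 m4" by (rule same_trans[OF s2 s24]) auto
        have s45: "same {rZ} {} m4 (m4(reg rZ := int z + 1))" by (intro same_upd_reg) auto
        have "trunc (accepts j \<rho> R) (W ` {0..<int (Suc z)}) ?S"
          unfolding im image_insert by (rule trunc_insert[OF S(1)])
        moreover have "stores r ?S (m4(reg rZ := int z + 1))" "marked r (m4(reg rZ := int z + 1))"
          using lst_same[OF _ s45] mk_same[OF _ s45] m4 r by auto
        ultimately have I': "I m1 (Suc z) (m4(reg rZ := int z + 1))"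
          unfolding I_def using same_upd_reg[OF s14, of rZ "int z + 1"] by auto
        show "runs U (St rZ (Bin Add (Rg rZ) (Lit 1))) m4 (pcost (St rZ (Bin Add (Rg rZ) (Lit 1)))) (I m1 (Suc z))"
          by (rule runs_loopfree) (use I' z4 z' bU in auto)
      qed
    qed
    then show ?thesis by (rule runs_conseq) auto
  qed
  have loop: "runs U (Loop (Bin Less (Rg rZ) (Rg rZM))
       (Seq (Seq brute_init (Loop (Bin Less (Rg rI) (Rg rN)) (brute_body d R)))
         (Seq (process d j R r) (St rZ (Bin Add (Rg rZ) (Lit 1)))))) m2
      (B * (expr_cost (Bin Less (Rg rZ) (Rg rZM)) + 1 + 300 * (n + 1)) + (expr_cost (Bin Less (Rg rZ) (Rg rZM)) + 1)) (I m1 B)"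
    if m1: "same {rZM, rI} {} m m1" "m1 (reg rZM) = ?b ^ n" and I: "I m1 0 m2" for m1 m2
  proof (rule runs_Loop[where I = "I m1"])
    fix z m' assume z: "z < B" and I: "I m1 z m'"
    have "m' (reg rZM) = int B" "m' (reg rZ) = int z" using I m1(2) B r by (auto simp: I_def same_def)
    then show "ev m' (Bin Less (Rg rZ) (Rg rZM)) \<noteq> 0 \<and> runs U (Seq (Seq brute_init (Loop (Bin Less (Rg rI) (Rg rN)) (brute_body d R)))
         (Seq (process d j R r) (St rZ (Bin Add (Rg rZ) (Lit 1))))) m' (300 * (n + 1)) (I m1 (Suc z))"
      using z body[OF m1(1) I z] by simp
  next
    fix m' assume I: "I m1 B m'"
    have "m' (reg rZM) = int B" "m' (reg rZ) = int B" using I m1(2) B r by (auto simp: I_def same_def)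
    then show "ev m' (Bin Less (Rg rZ) (Rg rZM)) = 0" by simp
  qed (rule I)
  have N: "m (reg rN) = int n" using E by (simp add: Env_def)
  have "runs U (enumerate_box d j R r) m (40 * (n + 1) + (pcost (Seq (St (rC r) (Lit 0)) (St rZ (Lit 0))) + (B * (expr_cost (Bin Less (Rg rZ) (Rg rZM)) + 1 + 300 * (n + 1)) + (expr_cost (Bin Less (Rg rZ) (Rg rZM)) + 1))))
     (\<lambda>m'. \<exists>m1. same {rZM, rI} {} m m1 \<and> I m1 B m')"
    unfolding enumerate_box_def
  proof (rule runs_Seq'[OF runs_powp[of m rZM ?b, OF N]])
    fix m1 assume m1: "same {rZM, rI} {} m m1 \<and> m1 (reg rZM) = ?b ^ n"
    define m2 where "m2 = m1(reg (rC r) := 0, reg rZ := 0)"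
    have "I m1 0 m2" unfolding I_def m2_def using trunc_empty
      by (auto simp: marked_def stores_def intro!: same_upd_reg)
    then have "runs U (Loop (Bin Less (Rg rZ) (Rg rZM))
       (Seq (Seq brute_init (Loop (Bin Less (Rg rI) (Rg rN)) (brute_body d R)))
         (Seq (process d j R r) (St rZ (Bin Add (Rg rZ) (Lit 1)))))) m2
      (B * (expr_cost (Bin Less (Rg rZ) (Rg rZM)) + 1 + 300 * (n + 1)) + (expr_cost (Bin Less (Rg rZ) (Rg rZM)) + 1)) 
       (\<lambda>m'. \<exists>m1. same {rZM, rI} {} m m1 \<and> I m1 B m')"
      using m1 by (intro runs_conseq[OF loop[of m1 m2] order_refl]) auto
    then show "runs U (Seq (Seq (St (rC r) (Lit 0)) (St rZ (Lit 0))) (Loop (Bin Less (Rg rZ) (Rg rZM))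
       (Seq (Seq brute_init (Loop (Bin Less (Rg rI) (Rg rN)) (brute_body d R)))
         (Seq (process d j R r) (St rZ (Bin Add (Rg rZ) (Lit 1))))))) m1
      (pcost (Seq (St (rC r) (Lit 0)) (St rZ (Lit 0))) + (B * (expr_cost (Bin Less (Rg rZ) (Rg rZM)) + 1 + 300 * (n + 1)) + (expr_cost (Bin Less (Rg rZ) (Rg rZM)) + 1)))
       (\<lambda>m'. \<exists>m1. same {rZM, rI} {} m m1 \<and> I m1 B m')"
      using U_pos by (intro runs_Seq runs_loopfree) (auto simp: m2_def)
  qed (use bU in auto)
  then show ?thesis
  proof (rule runs_conseq)
    define P :: nat where "P = 73 ^ n"
    have P: "B \<le> P" "1 \<le> P" using B73 by (auto simp: P_def)
    have nP: "n * B \<le> n * P" "n * 1 \<le> n * P" using P by (intro mult_le_mono2; simp)+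
    have "40 * (n + 1) + (pcost (Seq (St (rC r) (Lit 0)) (St rZ (Lit 0))) + (B * (expr_cost (Bin Less (Rg rZ) (Rg rZM)) + 1 + 300 * (n + 1)) + (expr_cost (Bin Less (Rg rZ) (Rg rZM)) + 1)))
      = 52 + 40 * n + 306 * B + 300 * (n * B)" by (simp add: algebra_simps)
    moreover have "1000 * (n + 1) * P = 1000 * P + 1000 * (n * P)" by (simp add: algebra_simps)
    ultimately show "40 * (n + 1) + (pcost (Seq (St (rC r) (Lit 0)) (St rZ (Lit 0))) + (B * (expr_cost (Bin Less (Rg rZ) (Rg rZM)) + 1 + 300 * (n + 1)) + (expr_cost (Bin Less (Rg rZ) (Rg rZM)) + 1)))
      \<le> 1000 * (n + 1) * 73 ^ n"
      unfolding P_def[symmetric] using P nP by linarith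
  next
    fix m' assume "\<exists>m1. same {rZM, rI} {} m m1 \<and> I m1 B m'"
    then obtain m1 S where 1: "same {rZM, rI} {} m m1" "same ?K {r, 3} m1 m'"
      "trunc (accepts j \<rho> R) (W ` {0..<int B}) S" "stores r S m'" by (auto simp: I_def)
    have "same (UNIV - {0,1,2,15,16}) {1,2,3} m m'" using r by (intro same_trans[OF 1(1,2)]) auto
    then show "same (UNIV - {0,1,2,15,16}) {1,2,3} m m' \<and> (\<exists>S. trunc (accepts j \<rho> R) (box_words R) S \<and> stores r S m')"
      using 1 unfolding boxe_image W_def B by blast
  qed
qed

lemma runs_combine:
  assumes E: "Env m" and r: "r \<in> {1, 2}" "s \<in> {1, 2}" "r \<noteq> s"
    and V: "j > 0 \<Longrightarrow> m (reg rV) = V j \<rho>"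
    and l: "stores s S' m" "int (card S') \<le> cap"
    and S'd: "\<And>v. v \<in> S' \<Longrightarrow> \<bar>v\<bar> \<le> H \<and> (\<forall>i<n. \<bar>digit d n v i\<bar> \<le> int d)"
  shows "runs U (combine d j R r s) m (2000 * (n + 1) * nat cap ^ 2)
    (\<lambda>m'. same (UNIV - {0,1,2,15,16}) {1,2,3} m m' \<and>
       (\<exists>S. trunc (accepts j \<rho> R) {u + v |u v. u \<in> S' \<and> v \<in> S'} S \<and> stores r S m'))"
proof -
  let ?K = "{rX, rI, rDot, rOk, rDg, rDup, rC r, rEnc, rB}"
  let ?KA = "insert rA ?K"
  define f where "f i = m (arr s i)" for i
  define c where "c = nat (m (reg (rC s)))"
  have c: "m (reg (rC s)) = int c" and inj: "inj_on f {0..<int c}" and S': "S' = f ` {0..<int c}"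
    using l(1) unfolding stores_def c_def f_def by auto
  have "int (card S') = int c" using S' inj by (simp add: card_image)
  then have c_cap: "int c \<le> cap" using l(2) by simp
  then have cU: "int c \<le> U" using cap_bounds by simp
  have fb: "\<bar>f i + f k\<bar> \<le> H" if "0 \<le> i" "i < int c" "0 \<le> k" "k < int c" for i k
    using that S'd[of "f i"] S'd[of "f k"] S' by (intro abs_add_le_offset) auto
  have HU: "H \<le> U" using offset_eq[of d n] offset_nonneg[of d n] U1 by linarith
  \<comment> \<open>The sums of the pairs that come lexicographically before (a, b).\<close>
  define X where "X a b = {f i + f k |i k. 0 \<le> i \<and> 0 \<le> k \<and> i < int c \<and> k < int c \<and> (i < int a \<or> i = int a \<and> k < int b)}" for a b
  define st where "st K a b m' \<longleftrightarrow> same K {r, 3} m m' \<and> m' (reg rA) = int a \<and> marked r m' \<and>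
    (\<exists>S. trunc (accepts j \<rho> R) (X a b) S \<and> stores r S m')" for K a b m'
  have stD: "m' (reg (rC s)) = int c" "m' (arr s i) = f i" "m' (reg rA) = int a" "Env m'"
     "j > 0 \<Longrightarrow> m' (reg rV) = V j \<rho>"
    if "st ?KA a b m'" for a b m' i
  proof -
    have sm: "same ?KA {r, 3} m m'" using that by (simp add: st_def)
    then show "m' (reg (rC s)) = int c" "m' (arr s i) = f i" "j > 0 \<Longrightarrow> m' (reg rV) = V j \<rho>"
      using r c V by (auto simp: same_def f_def)
    show "Env m'" by (rule Env_same[OF E sm]) (use r in auto)
    show "m' (reg rA) = int a" using that by (simp add: st_def)
  qed
  let ?inner = "Seq (St rEnc (Bin Add (Load (arr_addr s (Rg rA))) (Load (arr_addr s (Rg rB)))))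
             (Seq (process d j R r) (St rB (Bin Add (Rg rB) (Lit 1))))"
  define IB where "IB a b m' \<longleftrightarrow> st ?KA a b m' \<and> m' (reg rB) = int b" for a b m'
  have inner: "runs U ?inner m1 (250 * (n + 1)) (IB a (Suc b))" if IB: "IB a b m1" and ab: "a < c" "b < c" for a b m1
  proof -
    have st1: "st ?KA a b m1" and b1: "m1 (reg rB) = int b" using IB by (auto simp: IB_def)
    note D = stD[OF st1]
    obtain S where S: "trunc (accepts j \<rho> R) (X a b) S" "stores r S m1" and k1: "marked r m1" and s1: "same ?KA {r, 3} m m1"
      using st1 by (auto simp: st_def)
    define v where "v = f (int a) + f (int b)"
    have vH: "\<bar>v\<bar> \<le> H" unfolding v_def using ab by (intro fb) auto
    define m2 where "m2 = m1(reg rEnc := v)"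
    have s12: "same {rEnc} {} m1 m2" unfolding m2_def by (intro same_upd_reg) auto
    have E2: "Env m2" by (rule Env_same[OF D(4) s12]) auto
    have e2: "m2 (reg rEnc) = v" by (simp add: m2_def)
    have V2: "j > 0 \<Longrightarrow> m2 (reg rV) = V j \<rho>" using D(5) s12 by (auto simp: same_def)
    have l2: "stores r S m2" "marked r m2" using lst_same[OF S(2) s12] mk_same[OF k1 s12] r by auto
    have c2: "int (card S) \<le> cap" using S(1) by (simp add: trunc_def)
    let ?S = "if accepts j \<rho> R v \<and> int (card S) < cap then insert v S else S"
    have P: "runs U (Seq (process d j R r) (St rB (Bin Add (Rg rB) (Lit 1)))) m2
      (200 * (n + 1) + pcost (St rB (Bin Add (Rg rB) (Lit 1)))) (IB a (Suc b))"
    proof (rule runs_Seq'[OF runs_proc[OF E2 e2 vH r(1) V2 l2 c2]])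
      fix m4 assume m4: "same {rX, rI, rDot, rOk, rDg, rDup, rC r} {r, 3} m2 m4 \<and> marked r m4 \<and> stores r ?S m4"
      have s14: "same ?KA {r, 3} m1 m4" by (rule same_trans[OF s12 conjunct1[OF m4]]) auto
      have s4: "same ?KA {r, 3} m m4" by (rule same_trans[OF s1 s14]) auto
      have b4: "m4 (reg rB) = int b" "m4 (reg rA) = int a" using m4 b1 D(3) s12 r by (auto simp: same_def)
      have s45: "same {rB} {} m4 (m4(reg rB := int b + 1))" by (intro same_upd_reg) auto
      have XS: "X a (Suc b) = insert v (X a b)"
      proof (intro equalityI subsetI)
        fix w assume "w \<in> X a (Suc b)"
        then obtain i k where ik: "w = f i + f k" "0 \<le> i" "0 \<le> k" "i < int c" "k < int c"
          "i < int a \<or> i = int a \<and> k < int (Suc b)" unfolding X_def by blast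
        then have "i < int a \<or> i = int a \<and> k < int b \<or> i = int a \<and> k = int b" by auto
        with ik show "w \<in> insert v (X a b)" unfolding v_def X_def by blast
      next
        fix w assume "w \<in> insert v (X a b)"
        then show "w \<in> X a (Suc b)"
        proof
          assume "w = v"
          then show ?thesis unfolding X_def v_def using ab by (intro CollectI exI[of _ "int a"] exI[of _ "int b"]) auto
        next
          assume "w \<in> X a b" then show ?thesis unfolding X_def by force
        qed
      qed
      have "trunc (accepts j \<rho> R) (X a (Suc b)) ?S" unfolding XS by (rule trunc_insert[OF S(1)])
      moreover have "stores r ?S (m4(reg rB := int b + 1))" "marked r (m4(reg rB := int b + 1))"
        using lst_same[OF _ s45] mk_same[OF _ s45] m4 r by auto
      ultimately have I': "IB a (Suc b) (m4(reg rB := int b + 1))"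
        unfolding IB_def st_def using same_upd_reg[OF s4, of rB "int b + 1"] b4 by auto
      show "runs U (St rB (Bin Add (Rg rB) (Lit 1))) m4 (pcost (St rB (Bin Add (Rg rB) (Lit 1)))) (IB a (Suc b))"
        by (rule runs_loopfree) (use I' b4 ab cU in auto)
    qed
    have "runs U ?inner m1 (pcost (St rEnc (Bin Add (Load (arr_addr s (Rg rA))) (Load (arr_addr s (Rg rB))))) +
       (200 * (n + 1) + pcost (St rB (Bin Add (Rg rB) (Lit 1))))) (IB a (Suc b))"
      by (rule runs_Seq_loopfree) (use vH HU P in \<open>auto simp: D b1 v_def[symmetric] m2_def[symmetric]\<close>)
    then show ?thesis by (rule runs_conseq) auto
  qed
  have loopB: "runs U (Loop (Bin Less (Rg rB) (Rg (rC s))) ?inner) m1 (c * (expr_cost (Bin Less (Rg rB) (Rg (rC s))) + 1 + 250 * (n + 1)) +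
      (expr_cost (Bin Less (Rg rB) (Rg (rC s))) + 1)) (IB a c)" if "IB a 0 m1" "a < c" for a m1
  proof (rule runs_Loop[where I = "IB a"])
    fix b m' assume b: "b < c" and I: "IB a b m'"
    have "m' (reg rB) = int b" "m' (reg (rC s)) = int c" using I stD[of a b m'] by (auto simp: IB_def)
    then show "ev m' (Bin Less (Rg rB) (Rg (rC s))) \<noteq> 0 \<and> runs U ?inner m' (250 * (n + 1)) (IB a (Suc b))"
      using inner[OF I that(2) b] b by simp
  next
    fix m' assume I: "IB a c m'"
    have "m' (reg rB) = int c" "m' (reg (rC s)) = int c" using I stD[of a c m'] by (auto simp: IB_def)
    then show "ev m' (Bin Less (Rg rB) (Rg (rC s))) = 0" by simp
  qed (rule that(1))
  define IA where "IA a m' \<longleftrightarrow> st ?KA a 0 m'" for a m'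
  let ?TB = "c * (expr_cost (Bin Less (Rg rB) (Rg (rC s))) + 1 + 250 * (n + 1)) +
      (expr_cost (Bin Less (Rg rB) (Rg (rC s))) + 1)"
  let ?bodyA = "Seq (St rB (Lit 0)) (Seq (Loop (Bin Less (Rg rB) (Rg (rC s))) ?inner) (St rA (Bin Add (Rg rA) (Lit 1))))"
  let ?TA = "pcost (St rB (Lit 0)) + (?TB + pcost (St rA (Bin Add (Rg rA) (Lit 1))))"
  have bodyA: "runs U ?bodyA m1 ?TA (IA (Suc a))" if IA: "IA a m1" and a: "a < c" for a m1
  proof -
    obtain S where S: "trunc (accepts j \<rho> R) (X a 0) S" "stores r S m1" and k1: "marked r m1" and s1: "same ?KA {r, 3} m m1"
      and a1: "m1 (reg rA) = int a"
      using IA by (auto simp: st_def IA_def)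
    define m2 where "m2 = m1(reg rB := 0)"
    have s12: "same {rB} {} m1 m2" unfolding m2_def by (intro same_upd_reg) auto
    have "stores r S m2" "marked r m2" using lst_same[OF S(2) s12] mk_same[OF k1 s12] r by auto
    then have I2: "IB a 0 m2" unfolding IB_def st_def using S(1) s1 a1
      by (auto simp: m2_def intro!: same_upd_reg)
    have "runs U (Seq (Loop (Bin Less (Rg rB) (Rg (rC s))) ?inner) (St rA (Bin Add (Rg rA) (Lit 1)))) m2
       (?TB + pcost (St rA (Bin Add (Rg rA) (Lit 1)))) (IA (Suc a))"
    proof (rule runs_Seq'[OF loopB[OF I2 a]])
      fix m3 assume "IB a c m3"
      then obtain S3 where S3: "trunc (accepts j \<rho> R) (X a c) S3" "stores r S3 m3" and k3: "marked r m3"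
        and s3: "same ?KA {r, 3} m m3" and a3: "m3 (reg rA) = int a"
        by (auto simp: st_def IB_def)
      have s34: "same {rA} {} m3 (m3(reg rA := int a + 1))" by (intro same_upd_reg) auto
      \<comment> \<open>The end of row a is the start of row a + 1, so the inner loop hands over to
        the outer one without any change of the set.\<close>
      have XX: "X a c = X (Suc a) 0" unfolding X_def
        by (intro Collect_cong ex_cong1 conj_cong refl) auto
      have "stores r S3 (m3(reg rA := int a + 1))" "marked r (m3(reg rA := int a + 1))"
        using lst_same[OF S3(2) s34] mk_same[OF k3 s34] r by auto
      then have "IA (Suc a) (m3(reg rA := int a + 1))"
        unfolding IA_def st_def using S3(1)[unfolded XX] same_upd_reg[OF s3, of rA "int a + 1"] by auto
      then show "runs U (St rA (Bin Add (Rg rA) (Lit 1))) m3 (pcost (St rA (Bin Add (Rg rA) (Lit 1)))) (IA (Suc a))"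
        using a3 a cU by (intro runs_loopfree) auto
    qed
    then show ?thesis using U_pos by (intro runs_Seq_loopfree) (auto simp: m2_def)
  qed
  have loopA: "runs U (Loop (Bin Less (Rg rA) (Rg (rC s))) ?bodyA) m1 (c * (expr_cost (Bin Less (Rg rA) (Rg (rC s))) + 1 + ?TA) +
      (expr_cost (Bin Less (Rg rA) (Rg (rC s))) + 1)) (IA c)" if "IA 0 m1" for m1
  proof (rule runs_Loop[where I = IA])
    fix a m' assume a: "a < c" and I: "IA a m'"
    have "m' (reg rA) = int a" "m' (reg (rC s)) = int c" using I stD[of a 0 m'] by (auto simp: IA_def)
    then show "ev m' (Bin Less (Rg rA) (Rg (rC s))) \<noteq> 0 \<and> runs U ?bodyA m' ?TA (IA (Suc a))"
      using bodyA[OF I a] a by simp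
  next
    fix m' assume I: "IA c m'"
    have "m' (reg rA) = int c" "m' (reg (rC s)) = int c" using I stD[of c 0 m'] by (auto simp: IA_def)
    then show "ev m' (Bin Less (Rg rA) (Rg (rC s))) = 0" by simp
  qed (rule that)
  have X0: "X 0 0 = {}" unfolding X_def by auto
  have Xc: "X c 0 = {u + v |u v. u \<in> S' \<and> v \<in> S'}"
  proof (intro equalityI subsetI)
    fix w assume "w \<in> X c 0"
    then obtain i k where "w = f i + f k" "0 \<le> i" "0 \<le> k" "i < int c" "k < int c" unfolding X_def by blast
    then show "w \<in> {u + v |u v. u \<in> S' \<and> v \<in> S'}" unfolding S'
      by (intro CollectI exI[of _ "f i"] exI[of _ "f k"]) auto
  next
    fix w assume "w \<in> {u + v |u v. u \<in> S' \<and> v \<in> S'}"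
    then obtain i k where "w = f i + f k" "0 \<le> i" "0 \<le> k" "i < int c" "k < int c" unfolding S' by auto
    then show "w \<in> X c 0" unfolding X_def by (intro CollectI exI[of _ i] exI[of _ k]) auto
  qed
  define m1 where "m1 = m(reg (rC r) := 0, reg rA := 0)"
  have srun1: "srun (Seq (St (rC r) (Lit 0)) (St rA (Lit 0))) m = m1" by (simp add: m1_def)
  have IA0: "IA 0 m1" unfolding IA_def st_def m1_def X0 using trunc_empty
    by (auto simp: marked_def stores_def intro!: same_upd_reg)
  have "runs U (combine d j R r s) m (pcost (Seq (St (rC r) (Lit 0)) (St rA (Lit 0))) +
      (c * (expr_cost (Bin Less (Rg rA) (Rg (rC s))) + 1 + ?TA) + (expr_cost (Bin Less (Rg rA) (Rg (rC s))) + 1))) (IA c)"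
    unfolding combine_def
    by (rule runs_Seq_loopfree, simp, use U_pos in simp, unfold srun1, rule loopA[OF IA0])
  then show ?thesis
  proof (rule runs_conseq)
    define k where "k = nat cap"
    have k: "c \<le> k" "1 \<le> k" using c_cap cap_bounds by (auto simp: k_def)
    have "c * c \<le> k * k" "c * 1 \<le> k * k" "1 * 1 \<le> k * k" using k by (intro mult_le_mono; simp)+
    moreover from this have "n * (c * c) \<le> n * (k * k)" by (intro mult_le_mono2)
    moreover have "pcost (Seq (St (rC r) (Lit 0)) (St rA (Lit 0))) +
      (c * (expr_cost (Bin Less (Rg rA) (Rg (rC s))) + 1 + ?TA) + (expr_cost (Bin Less (Rg rA) (Rg (rC s))) + 1))
      = 12 + 21 * c + 256 * (c * c) + 250 * (n * (c * c))" by (simp add: algebra_simps)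
    moreover have "2000 * (n + 1) * (k * k) = 2000 * (k * k) + 2000 * (n * (k * k))" by (simp add: algebra_simps)
    ultimately show "pcost (Seq (St (rC r) (Lit 0)) (St rA (Lit 0))) +
      (c * (expr_cost (Bin Less (Rg rA) (Rg (rC s))) + 1 + ?TA) + (expr_cost (Bin Less (Rg rA) (Rg (rC s))) + 1))
      \<le> 2000 * (n + 1) * nat cap ^ 2"
      unfolding k_def[symmetric] power2_eq_square by linarith
  next
    fix m' assume "IA c m'"
    then obtain S where S: "trunc (accepts j \<rho> R) (X c 0) S" "stores r S m'" and sm: "same ?KA {r, 3} m m'"
      by (auto simp: IA_def st_def)
    have "same (UNIV - {0,1,2,15,16}) {1,2,3} m m'" using r by (intro same_mono[OF sm]) auto
    then show "same (UNIV - {0,1,2,15,16}) {1,2,3} m m' \<and>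
       (\<exists>S. trunc (accepts j \<rho> R) {u + v |u v. u \<in> S' \<and> v \<in> S'} S \<and> stores r S m')"
      using S unfolding Xc by blast
  qed
qed

end

section \<open>The recursion over the levels and the search over the radii\<close>

definition set_window :: "nat \<Rightarrow> nat \<Rightarrow> prog" where
  "set_window j \<rho> = Seq (store_power rP 5) (Seq (store_power rQ (2 * int \<rho>))
     (St rV (Bin Mul (Lit (2 ^ j)) (Bin Div (Bin Mul (Load (Lit 1)) (Rg rP)) (Rg rQ)))))"

text \<open>The deepest level comes first, since each level is joined from the next one. If c has
  entries at most R and e has entries at most 2 R' - R, then (c + e) / 2 and (c - e) / 2 have
  entries at most R'; this is the parameter with which the window of the level of R' is set.\<close>

fun build_level :: "nat \<Rightarrow> nat \<Rightarrow> nat \<Rightarrow> nat list \<Rightarrow> prog" where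
  "build_level d j \<rho> [] = Skip"
| "build_level d j \<rho> [R] = Seq (set_window j \<rho>) (enumerate_box d j R (1 + j mod 2))"
| "build_level d j \<rho> (R # R' # rs) = Seq (build_level d (Suc j) (2 * R' - R) (R' # rs))
     (Seq (set_window j \<rho>) (combine d j R (1 + j mod 2) (1 + Suc j mod 2)))"

text \<open>The static conditions for a run: words of radius at most d can be added without carry,
  radius 36 can be listed in time 73^n, and the bounds on \<open>j\<close> and \<open>\<rho>\<close>
  are those under which \<open>U5\<close> and \<open>U6\<close> control the windows.\<close>

fun valid_radii :: "nat \<Rightarrow> nat \<Rightarrow> nat \<Rightarrow> nat list \<Rightarrow> bool" where
  "valid_radii d j \<rho> [] \<longleftrightarrow> False"
| "valid_radii d j \<rho> [R] \<longleftrightarrow> R \<le> d \<and> R \<le> 36 \<and> j \<le> d \<and> 1 \<le> \<rho> \<and> \<rho> \<le> d + 1"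
| "valid_radii d j \<rho> (R # R' # rs) \<longleftrightarrow> R \<le> d \<and> j \<le> d \<and> 1 \<le> \<rho> \<and> \<rho> \<le> d + 1 \<and>
     valid_radii d (Suc j) (2 * R' - R) (R' # rs)"

function radii :: "nat \<Rightarrow> nat list" where
  "radii D = (if D \<le> 36 then [D] else D # radii ((3 * D + 3) div 4))"
  by auto
termination by (relation "Wellfounded.measure id") auto

declare radii.simps [simp del]

lemma radii_Cons: "\<exists>rs. radii D = D # rs"
  by (subst radii.simps) auto

text \<open>The radius drops by at least 1 from level to level, which pays for the increase of
  \<open>j\<close> and keeps \<open>j + D\<close> below \<open>d\<close>.\<close>

lemma valid_radii_radii: "j + D \<le> d \<Longrightarrow> 1 \<le> \<rho> \<Longrightarrow> \<rho> \<le> d + 1 \<Longrightarrow> valid_radii d j \<rho> (radii D)"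
proof (induction D arbitrary: j \<rho> rule: less_induct)
  case (less D)
  show ?case
  proof (cases "D \<le> 36")
    case True
    then show ?thesis using less.prems by (simp add: radii.simps)
  next
    case False
    define R where "R = (3 * D + 3) div 4"
    have R: "R < D" "D < 2 * R" "2 * R - D \<le> D" using False by (auto simp: R_def)
    obtain rs where rs: "radii R = R # rs" using radii_Cons by blast
    have "valid_radii d (Suc j) (2 * R - D) (radii R)"
      using R less.prems by (intro less.IH) auto
    then show ?thesis using False less.prems by (subst radii.simps) (simp add: R_def[symmetric] rs)
  qed
qed

definition try_radius :: "nat \<Rightarrow> nat \<Rightarrow> prog" where
  "try_radius d D = Seq (build_level d 0 1 (radii D))
     (Cond (Bin Less (Lit 0) (Rg (rC 1))) (Seq (St rFound (Lit 1)) (St rSol (Load (arr_addr 1 (Lit 0))))) Skip)"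

fun try_all :: "nat \<Rightarrow> nat \<Rightarrow> prog" where
  "try_all d 0 = Skip"
| "try_all d (Suc D) = Seq (try_all d D) (try_radius d D)"

definition set_offset :: "nat \<Rightarrow> prog" where
  "set_offset d = Seq (Seq (St rN (Load (Lit 0))) (Seq (St rH (Lit 0)) (St rI (Lit 0))))
     (Loop (Bin Less (Rg rI) (Rg rN)) (Seq (St rH (Bin Add (Bin Mul (Rg rH) (Lit (base d))) (Lit (2 * int d))))
       (St rI (Bin Add (Rg rI) (Lit 1)))))"

definition write_body :: "nat \<Rightarrow> prog" where
  "write_body d = Seq (Store (Bin Add (Rg rI) (Lit 1)) (Bin Sub (Bin Mod (Rg rX) (Lit (base d))) (Lit (2 * int d))))
     (Seq (St rX (Bin Div (Rg rX) (Lit (base d)))) (St rI (Bin Add (Rg rI) (Lit 1))))"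

definition write_solution :: "nat \<Rightarrow> prog" where
  "write_solution d = Seq (Seq (St rX (Bin Add (Rg rSol) (Rg rH))) (St rI (Lit 0)))
     (Seq (Loop (Bin Less (Rg rI) (Rg rN)) (write_body d)) (Store (Lit 0) (Lit 1)))"

definition solver :: "nat \<Rightarrow> prog" where
  "solver d = Seq (set_offset d) (Seq (store_power rP 43) (Seq (store_power rQ 5)
     (Seq (Seq (St rCap (Bin Div (Rg rP) (Rg rQ))) (St rFound (Lit 0)))
     (Seq (try_all d (Suc d)) (Cond (Rg rFound) (write_solution d) (Store (Lit 0) (Lit 0)))))))"

section \<open>Specification of the complete run\<close>

context instance_data begin

lemma runs_set_window:
  assumes E: "Env m" and j: "j \<le> d" and \<rho>: "1 \<le> \<rho>" "\<rho> \<le> d + 1"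
  shows "runs U (set_window j \<rho>) m (100 * (n + 1))
    (\<lambda>m'. same {rP, rQ, rI, rV} {} m m' \<and> m' (reg rV) = V j \<rho>)"
proof -
  have q: "(2 * int \<rho>) ^ n \<le> U"
    by (rule order_trans[OF power_mono U6]) (use \<rho> in auto)
  have p: "5 ^ n \<le> U" using power_mono[of "5 :: int" 43 n] U4 by simp
  have vU: "\<bar>V j \<rho>\<bar> \<le> U"
  proof -
    have "0 \<le> M * 5 ^ n" using M_pos by simp
    then have "\<bar>(M * 5 ^ n) div (2 * int \<rho>) ^ n\<bar> \<le> M * 5 ^ n" using abs_div_le[of "M * 5 ^ n"] by fastforce
    then have "\<bar>V j \<rho>\<bar> \<le> 2 ^ j * (M * 5 ^ n)" by (simp add: V_def abs_mult)
    also have "\<dots> \<le> 2 ^ d * (M * 5 ^ n)" using j M_pos by (intro mult_right_mono power_increasing) auto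
    finally show ?thesis using U5 by simp
  qed
  have "runs U (set_window j \<rho>) m (40 * (n + 1) + (40 * (n + 1) +
      pcost (St rV (Bin Mul (Lit (2 ^ j)) (Bin Div (Bin Mul (Load (Lit 1)) (Rg rP)) (Rg rQ))))))
    (\<lambda>m'. same {rP, rQ, rI, rV} {} m m' \<and> m' (reg rV) = V j \<rho>)"
    unfolding set_window_def
  proof (rule runs_Seq'[OF runs_powp[of m rP 5]])
    fix m1 assume m1: "same {rP, rI} {} m m1 \<and> m1 (reg rP) = 5 ^ n"
    have E1: "Env m1" by (rule Env_same[OF E conjunct1[OF m1]]) auto
    show "runs U (Seq (store_power rQ (2 * int \<rho>)) (St rV (Bin Mul (Lit (2 ^ j)) (Bin Div (Bin Mul (Load (Lit 1)) (Rg rP)) (Rg rQ))))) m1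
      (40 * (n + 1) + pcost (St rV (Bin Mul (Lit (2 ^ j)) (Bin Div (Bin Mul (Load (Lit 1)) (Rg rP)) (Rg rQ)))))
      (\<lambda>m'. same {rP, rQ, rI, rV} {} m m' \<and> m' (reg rV) = V j \<rho>)"
    proof (rule runs_Seq'[OF runs_powp[of m1 rQ "2 * int \<rho>"]])
      fix m2 assume m2: "same {rQ, rI} {} m1 m2 \<and> m2 (reg rQ) = (2 * int \<rho>) ^ n"
      have E2: "Env m2" by (rule Env_same[OF E1 conjunct1[OF m2]]) auto
      have P2: "m2 (reg rP) = 5 ^ n" using m1 m2 by (auto simp: same_def)
      have s: "same {rP, rQ, rI, rV} {} m m2" by (rule same_trans[OF conjunct1[OF m1] conjunct1[OF m2]]) auto
      have M2: "m2 1 = M" using E2 by (simp add: Env_def)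
      show "runs U (St rV (Bin Mul (Lit (2 ^ j)) (Bin Div (Bin Mul (Load (Lit 1)) (Rg rP)) (Rg rQ)))) m2
        (pcost (St rV (Bin Mul (Lit (2 ^ j)) (Bin Div (Bin Mul (Load (Lit 1)) (Rg rP)) (Rg rQ)))))
        (\<lambda>m'. same {rP, rQ, rI, rV} {} m m' \<and> m' (reg rV) = V j \<rho>)"
        by (rule runs_loopfree) (use vU same_upd_reg[OF s, of rV] in \<open>simp_all add: V_def P2 m2 M2\<close>)
    qed (use E1 q \<rho> in \<open>auto simp: Env_def\<close>)
  qed (use E p in \<open>auto simp: Env_def\<close>)
  then show ?thesis by (rule runs_conseq) auto
qed

text \<open>A relation and not a function, because the contents of a full list depend on the order
  of enumeration. It holds for the outcome on every input; randomness enters only when completeness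
  is at stake.\<close>

fun Res :: "nat \<Rightarrow> nat \<Rightarrow> nat list \<Rightarrow> int set \<Rightarrow> bool" where
  "Res j \<rho> [] S \<longleftrightarrow> False"
| "Res j \<rho> [R] S \<longleftrightarrow> trunc (accepts j \<rho> R) (box_words R) S"
| "Res j \<rho> (R # R' # rs) S \<longleftrightarrow> (\<exists>S'. Res (Suc j) (2 * R' - R) (R' # rs) S' \<and>
     trunc (accepts j \<rho> R) {u + v |u v. u \<in> S' \<and> v \<in> S'} S)"

text \<open>Soundness of the lists, truncated or not. The digit bound also provides the absence of
  carries that the next join relies on.\<close>

lemma Res_D:
  assumes "Res j \<rho> rs S" "valid_radii d j \<rho> rs"
  shows "int (card S) \<le> cap \<and> finite S \<and> (\<forall>v\<in>S. \<bar>v\<bar> \<le> H \<and> (\<forall>i<n. \<bar>digit d n v i\<bar> \<le> int (hd rs)) \<and> hd rs \<le> d \<and> accepts j \<rho> (hd rs) v)"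
  using assms
proof (induction j \<rho> rs S rule: Res.induct)
  case (2 j \<rho> R S)
  then show ?case using boxe_bound by (auto simp: trunc_def accepts_def)
next
  case (3 j \<rho> R R' rs S)
  then obtain S' where S': "Res (Suc j) (2 * R' - R) (R' # rs) S'"
    "trunc (accepts j \<rho> R) {u + v |u v. u \<in> S' \<and> v \<in> S'} S" by auto
  have "\<And>v. v \<in> S' \<Longrightarrow> \<bar>v\<bar> \<le> H \<and> (\<forall>i<n. \<bar>digit d n v i\<bar> \<le> int d)"
    using 3(1)[OF S'(1)] 3(3) by fastforce
  then have "\<And>u v. u \<in> S' \<Longrightarrow> v \<in> S' \<Longrightarrow> \<bar>u + v\<bar> \<le> H"
    by (intro abs_add_le_offset) auto
  then show ?case using S'(2) 3(3) by (fastforce simp: trunc_def accepts_def)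
qed simp

definition level_time :: nat where "level_time = 3000 * (n + 1) * (73 ^ n + nat cap ^ 2)"

lemma runs_gen:
  assumes "Env m" "valid_radii d j \<rho> rs"
  shows "runs U (build_level d j \<rho> rs) m (length rs * level_time)
    (\<lambda>m'. same (UNIV - {0,1,2,15,16}) {1,2,3} m m' \<and> (\<exists>S. Res j \<rho> rs S \<and> stores (1 + j mod 2) S m'))"
  using assms
proof (induction rs arbitrary: j \<rho> m)
  case (Cons R rs)
  note E = Cons.prems(1)
  let ?K = "UNIV - {0,1,2,15,16} :: nat set"
  have v: "R \<le> d" "j \<le> d" "1 \<le> \<rho>" "\<rho> \<le> d + 1"
    using Cons.prems(2) by (cases rs; simp)+
  have r: "1 + j mod 2 \<in> {1, 2}" "1 + Suc j mod 2 \<in> {1, 2}" "1 + j mod 2 \<noteq> 1 + Suc j mod 2"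
    by auto presburger+
  have t1: "100 * (n + 1) + 1000 * (n + 1) * 73 ^ n \<le> level_time"
    and t2: "100 * (n + 1) + 2000 * (n + 1) * nat cap ^ 2 \<le> level_time"
  proof -
    define P Q :: nat where "P = 73 ^ n" and "Q = nat cap ^ 2"
    have P: "(n + 1) * 1 \<le> (n + 1) * P" by (intro mult_le_mono2) (simp add: P_def)
    have "level_time = 3000 * ((n + 1) * P) + 3000 * ((n + 1) * Q)" by (simp add: level_time_def P_def Q_def algebra_simps)
    moreover have "1000 * (n + 1) * P = 1000 * ((n + 1) * P)" "2000 * (n + 1) * Q = 2000 * ((n + 1) * Q)"
      by (simp_all add: algebra_simps)
    ultimately show "100 * (n + 1) + 1000 * (n + 1) * 73 ^ n \<le> level_time"
      "100 * (n + 1) + 2000 * (n + 1) * nat cap ^ 2 \<le> level_time"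
      unfolding P_def[symmetric] Q_def[symmetric] using P by linarith+
  qed
  show ?case
  proof (cases rs)
    case Nil
    have R36: "R \<le> 36" using Cons.prems(2) Nil by simp
    have "runs U (build_level d j \<rho> [R]) m (100 * (n + 1) + 1000 * (n + 1) * 73 ^ n)
      (\<lambda>m'. same ?K {1,2,3} m m' \<and> (\<exists>S. Res j \<rho> [R] S \<and> stores (1 + j mod 2) S m'))"
      unfolding build_level.simps
    proof (rule runs_Seq'[OF runs_set_window[OF E v(2-4)]])
      fix m1 assume m1: "same {rP, rQ, rI, rV} {} m m1 \<and> m1 (reg rV) = V j \<rho>"
      have E1: "Env m1" by (rule Env_same[OF E conjunct1[OF m1]]) auto
      show "runs U (enumerate_box d j R (1 + j mod 2)) m1 (1000 * (n + 1) * 73 ^ n)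
        (\<lambda>m'. same ?K {1,2,3} m m' \<and> (\<exists>S. Res j \<rho> [R] S \<and> stores (1 + j mod 2) S m'))"
        by (rule runs_conseq[OF runs_brute[OF E1 v(1) R36 r(1), of j \<rho>]])
          (use m1 in \<open>auto intro: same_trans[OF conjunct1[OF m1]]\<close>)
    qed
    then show ?thesis unfolding Nil by (rule runs_conseq) (use t1 in auto)
  next
    case (Cons R' rs')
    have valid: "valid_radii d (Suc j) (2 * R' - R) (R' # rs')" using Cons.prems(2) Cons by simp
    have "runs U (build_level d j \<rho> (R # R' # rs')) m (length (R' # rs') * level_time + (100 * (n + 1) + 2000 * (n + 1) * nat cap ^ 2))
      (\<lambda>m'. same ?K {1,2,3} m m' \<and> (\<exists>S. Res j \<rho> (R # R' # rs') S \<and> stores (1 + j mod 2) S m'))"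
      unfolding build_level.simps
    proof (rule runs_Seq'[OF Cons.IH[OF E valid[folded Cons], unfolded Cons]])
      show "runs U (Seq (set_window j \<rho>) (combine d j R (1 + j mod 2) (1 + Suc j mod 2))) m1
        (100 * (n + 1) + 2000 * (n + 1) * nat cap ^ 2)
        (\<lambda>m'. same ?K {1,2,3} m m' \<and> (\<exists>S. Res j \<rho> (R # R' # rs') S \<and> stores (1 + j mod 2) S m'))"
        if "same ?K {1,2,3} m m1 \<and> (\<exists>S. Res (Suc j) (2 * R' - R) (R' # rs') S \<and> stores (1 + Suc j mod 2) S m1)" for m1
      proof -
        from that obtain S' where s1: "same ?K {1,2,3} m m1" and
          S': "Res (Suc j) (2 * R' - R) (R' # rs') S'" "stores (1 + Suc j mod 2) S' m1" by blast
        have E1: "Env m1" by (rule Env_same[OF E s1]) auto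
        have S'd: "int (card S') \<le> cap" "\<And>v. v \<in> S' \<Longrightarrow> \<bar>v\<bar> \<le> H \<and> (\<forall>i<n. \<bar>digit d n v i\<bar> \<le> int d)"
          using Res_D[OF S'(1) valid] by fastforce+
        show ?thesis
        proof (rule runs_Seq'[OF runs_set_window[OF E1 v(2-4)]])
          fix m2 assume m2: "same {rP, rQ, rI, rV} {} m1 m2 \<and> m2 (reg rV) = V j \<rho>"
          have E2: "Env m2" by (rule Env_same[OF E1 conjunct1[OF m2]]) auto
          have s2: "same ?K {1,2,3} m m2" by (rule same_trans[OF s1 conjunct1[OF m2]]) auto
          have l2: "stores (1 + Suc j mod 2) S' m2"
            by (rule lst_same[OF S'(2) conjunct1[OF m2]]) (use r in auto)
          show "runs U (combine d j R (1 + j mod 2) (1 + Suc j mod 2)) m2 (2000 * (n + 1) * nat cap ^ 2)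
            (\<lambda>m'. same ?K {1,2,3} m m' \<and> (\<exists>S. Res j \<rho> (R # R' # rs') S \<and> stores (1 + j mod 2) S m'))"
          proof (rule runs_conseq[OF runs_combine[OF E2 r _ l2 S'd, of j \<rho>] order_refl])
            fix m' assume "same ?K {1,2,3} m2 m' \<and> (\<exists>S. trunc (accepts j \<rho> R) {u + v |u v. u \<in> S' \<and> v \<in> S'} S \<and> stores (1 + j mod 2) S m')"
            then show "same ?K {1,2,3} m m' \<and> (\<exists>S. Res j \<rho> (R # R' # rs') S \<and> stores (1 + j mod 2) S m')"
              using S'(1) same_trans[OF s2, of ?K "{1,2,3}" m' ?K "{1,2,3}"] by auto
          qed (use m2 in auto)
        qed
      qed
    qed
    then show ?thesis unfolding Cons by (rule runs_conseq) (use t2 in auto)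
  qed
qed simp

text \<open>The depth is bounded in terms of d alone, so all levels together cost only a constant
  factor.\<close>

lemma length_radii:
  assumes "valid_radii d' j \<rho> rs"
  shows "j + length rs \<le> d' + 1"
  using assms by (induction d' j \<rho> rs rule: valid_radii.induct) auto

text \<open>\<open>Sf D\<close> is the top list for radius D. A later success overwrites the word
  found earlier; any of them is a solution.\<close>

definition found_inv :: "nat \<Rightarrow> (int \<Rightarrow> int) \<Rightarrow> bool" where
  "found_inv k m \<longleftrightarrow> Env m \<and> (\<exists>Sf. (\<forall>D<k. Res 0 1 (radii D) (Sf D)) \<and>
     (m (reg rFound) = 0 \<and> (\<forall>D<k. Sf D = {}) \<or> m (reg rFound) = 1 \<and> (\<exists>D<k. m (reg rSol) \<in> Sf D)))"

lemma runs_try_all: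
  assumes "found_inv 0 m" "k \<le> Suc d"
  shows "runs U (try_all d k) m (1 + k * ((d + 1) * level_time + 20)) (found_inv k)"
  using assms(2)
proof (induction k)
  case 0
  have "runs U Skip m (pcost Skip) (found_inv 0)" by (rule runs_loopfree) (use assms in auto)
  then show ?case by simp
next
  case (Suc k)
  have "runs U (try_all d (Suc k)) m (1 + k * ((d + 1) * level_time + 20) + ((d + 1) * level_time + 20)) (found_inv (Suc k))"
    unfolding try_all.simps
  proof (rule runs_Seq')
    show "runs U (try_all d k) m (1 + k * ((d + 1) * level_time + 20)) (found_inv k)" using Suc by simp
    fix m1 assume "found_inv k m1"
    then obtain Sf where E1: "Env m1" and Sf: "\<And>D. D < k \<Longrightarrow> Res 0 1 (radii D) (Sf D)"
      "m1 (reg rFound) = 0 \<and> (\<forall>D<k. Sf D = {}) \<or> m1 (reg rFound) = 1 \<and> (\<exists>D<k. m1 (reg rSol) \<in> Sf D)"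
      by (auto simp: found_inv_def)
    have val: "valid_radii d 0 1 (radii k)" using Suc.prems by (intro valid_radii_radii) auto
    have l: "length (radii k) \<le> d + 1" using length_radii[OF val] by simp
    let ?c = "Cond (Bin Less (Lit 0) (Rg (rC 1))) (Seq (St rFound (Lit 1)) (St rSol (Load (arr_addr 1 (Lit 0))))) Skip"
    have "runs U (try_radius d k) m1 (length (radii k) * level_time + pcost ?c) (found_inv (Suc k))"
      unfolding try_radius_def
    proof (rule runs_Seq'[OF runs_gen[OF E1 val]])
      fix m2 assume "same (UNIV - {0,1,2,15,16}) {1,2,3} m1 m2 \<and> (\<exists>S. Res 0 1 (radii k) S \<and> stores (1 + 0 mod 2) S m2)"
      then obtain S where s2: "same (UNIV - {0,1,2,15,16}) {1,2,3} m1 m2" and S: "Res 0 1 (radii k) S" "stores 1 S m2" by auto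
      have E2: "Env m2" by (rule Env_same[OF E1 s2]) auto
      have f2: "m2 (reg rFound) = m1 (reg rFound)" "m2 (reg rSol) = m1 (reg rSol)" using s2 by (auto simp: same_def)
      have S0: "S = {} \<longleftrightarrow> \<not> 0 < m2 (reg (rC 1))" and mem: "0 < m2 (reg (rC 1)) \<Longrightarrow> m2 (arr 1 0) \<in> S"
        using S(2) by (auto simp: stores_def)
      define Sf' where "Sf' = Sf(k := S)"
      have R': "Res 0 1 (radii D) (Sf' D)" if "D < Suc k" for D
        using that Sf(1) S(1) by (auto simp: Sf'_def less_Suc_eq)
      show "runs U ?c m2 (pcost ?c) (found_inv (Suc k))"
      proof (rule runs_loopfree)
        assume "bnd U m2"
        then show "sok U ?c m2" using U_pos by (auto simp: bnd_def)
      next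
        define m3 where "m3 = srun ?c m2"
        have s3: "same {15, 16} {} m2 m3" unfolding m3_def by (auto intro!: same_upd_reg)
        have E3: "Env m3" by (rule Env_same[OF E2 s3]) auto
        show "found_inv (Suc k) (srun ?c m2)"
          unfolding m3_def[symmetric] found_inv_def
        proof (intro conjI exI[of _ Sf'] allI impI E3 R')
          show "m3 (reg rFound) = 0 \<and> (\<forall>D<Suc k. Sf' D = {}) \<or> m3 (reg rFound) = 1 \<and> (\<exists>D<Suc k. m3 (reg rSol) \<in> Sf' D)"
          proof (cases "0 < m2 (reg (rC 1))")
            case True
            then have "m3 (reg rFound) = 1" "m3 (reg rSol) \<in> Sf' k"
              using mem by (simp_all add: m3_def Sf'_def arr_reg)
            then show ?thesis by blast
          next
            case False
            then have "S = {}" and m3: "m3 = m2" using S0 by (simp_all add: m3_def)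
            then show ?thesis using Sf(2) unfolding m3 f2 Sf'_def
              by (auto simp: less_Suc_eq intro: exI[of _ "_ :: nat"])
          qed
        qed
      qed simp
    qed
    then show "runs U (try_radius d k) m1 ((d + 1) * level_time + 20) (found_inv (Suc k))"
      by (rule runs_conseq) (use l mult_le_mono1[OF l, of level_time] in auto)
  qed
  then show ?case by (rule runs_conseq) auto
qed

lemma offset_Suc: "offset d (Suc k) = offset d k * base d + 2 * int d"
proof -
  have "2 * offset d (Suc k) + 1 = (2 * offset d k + 1) * base d"
    unfolding offset_eq by simp
  then show ?thesis unfolding base_def by (simp add: algebra_simps)
qed

lemma runs_set_offset:
  assumes m: "m 0 = int n" "m 1 = M" "m 2 = \<tau>" "\<And>i. i < n \<Longrightarrow> m (3 + int i) = x ! i"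
  shows "runs U (set_offset d) m (60 * (n + 1)) (\<lambda>m'. m' (reg rN) = int n \<and> m' (reg rH) = H \<and>
     m' 1 = M \<and> m' 2 = \<tau> \<and> (\<forall>i<n. m' (3 + int i) = x ! i))"
proof -
  define I where "I k m' \<longleftrightarrow> (m' (reg rN) = int n \<and> m' (reg rH) = offset d k \<and> m' (reg rI) = int k) \<and>
     m' 1 = M \<and> m' 2 = \<tau> \<and> (\<forall>i<n. m' (3 + int i) = x ! i)" for k m'
  let ?b = "Seq (St rH (Bin Add (Bin Mul (Rg rH) (Lit (base d))) (Lit (2 * int d)))) (St rI (Bin Add (Rg rI) (Lit 1)))"
  let ?g = "Bin Less (Rg rI) (Rg rN)"
  have L: "runs U (Loop ?g ?b) m' (n * (expr_cost ?g + 1 + pcost ?b) + (expr_cost ?g + 1)) (I n)" if "I 0 m'" for m'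
  proof (rule runs_Loop[where I = I])
    fix k m' assume k: "k < n" and I: "I k m'"
    have "base d ^ Suc k \<le> base d ^ n" using k by (intro power_increasing) auto
    then have oU: "\<bar>offset d (Suc k)\<bar> \<le> U" using offset_eq[of d "Suc k"] offset_nonneg[of d "Suc k"] U1 by linarith
    have r: "m' (reg rN) = int n" "m' (reg rH) = offset d k" "m' (reg (Suc 0)) = offset d k" "m' (reg rI) = int k"
      using I by (auto simp: I_def)
    show "ev m' ?g \<noteq> 0 \<and> runs U ?b m' (pcost ?b) (I (Suc k))"
    proof (intro conjI runs_loopfree)
      show "ev m' ?g \<noteq> 0" using r k by simp
      show "sok U ?b m'" using oU nU k by (simp add: r offset_Suc)
      show "I (Suc k) (srun ?b m')" using I k unfolding I_def by (simp add: r offset_Suc)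
    qed simp
  qed (use that in \<open>auto simp: I_def\<close>)
  let ?i = "Seq (St rN (Load (Lit 0))) (Seq (St rH (Lit 0)) (St rI (Lit 0)))"
  have I0: "I 0 (srun ?i m)" using m by (auto simp: I_def offset_def)
  have "runs U (set_offset d) m (pcost ?i + (n * (expr_cost ?g + 1 + pcost ?b) + (expr_cost ?g + 1))) (I n)"
    unfolding set_offset_def
    by (rule runs_Seq_loopfree[OF _ _ L[OF I0]]) (use m nU in auto)
  then show ?thesis by (rule runs_conseq) (auto simp: I_def)
qed

lemma reg_pos: "reg k \<noteq> int i + 1" "int i + 1 \<noteq> reg k" "reg k \<noteq> 1 + int i" "1 + int i \<noteq> reg k"
  using reg_neg[of k] by linarith+

text \<open>The output overwrites the input from cell 1 on, and finally cell 0. The loop works from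
  registers, which lie on negative addresses and are out of its reach.\<close>

lemma runs_write_solution:
  assumes E: "m (reg rN) = int n" "m (reg rH) = H" and v: "m (reg rSol) = v" "\<bar>v\<bar> \<le> H"
  shows "runs U (write_solution d) m (60 * (n + 1))
    (\<lambda>m'. output_answer n m' = Some (map (digit d n v) [0..<n]))"
proof -
  define I where "I k m' \<longleftrightarrow> m' (reg rN) = int n \<and> m' (reg rI) = int k \<and> m' (reg rX) = (v + H) div base d ^ k \<and>
     (\<forall>i<k. m' (1 + int i) = digit d n v i)" for k m'
  let ?g = "Bin Less (Rg rI) (Rg rN)"
  have vU: "0 \<le> v + H" "v + H < U" using v(2) offset_eq[of d n] U1 by auto
  have L: "runs U (Loop ?g (write_body d)) m' (n * (expr_cost ?g + 1 + pcost (write_body d)) + (expr_cost ?g + 1)) (I n)" if "I 0 m'" for m'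
  proof (rule runs_Loop[where I = I])
    fix k m' assume k: "k < n" and I: "I k m'"
    have g: "(v + H) div base d ^ k mod base d - 2 * int d = digit d n v k" by (simp add: digit_def)
    have dgU: "\<bar>digit d n v k\<bar> \<le> U" using dg_bound[of d n v k] hU by simp
    have dv: "(v + H) div base d ^ k div base d = (v + H) div base d ^ Suc k"
      by (metis base_pos(1) less_le power_Suc2 zdiv_zmult2_eq)
    have dvU: "\<bar>(v + H) div base d ^ Suc k\<bar> \<le> U"
      using abs_div_le[of "v + H" "base d ^ Suc k"] vU by linarith
    have r: "m' (reg rN) = int n" "m' (reg rI) = int k" "m' (reg rX) = (v + H) div base d ^ k"
      "\<And>i. i < k \<Longrightarrow> m' (1 + int i) = digit d n v i"
      using I by (auto simp: I_def)
    show "ev m' ?g \<noteq> 0 \<and> runs U (write_body d) m' (pcost (write_body d)) (I (Suc k))"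
    proof (intro conjI runs_loopfree)
      show "ev m' ?g \<noteq> 0" using r k by simp
      show "loopfree (write_body d)" by (simp add: write_body_def)
      show "sok U (write_body d) m'"
        using nU k by (simp add: write_body_def r g dgU dv dvU reg_pos del: power_Suc)
      show "I (Suc k) (srun (write_body d) m')"
        unfolding I_def by (auto simp: write_body_def r g dv reg_pos less_Suc_eq simp del: power_Suc)
    qed
  qed (use that in \<open>auto simp: I_def\<close>)
  let ?i = "Seq (St rX (Bin Add (Rg rSol) (Rg rH))) (St rI (Lit 0))"
  have I0: "I 0 (srun ?i m)" using E v by (auto simp: I_def)
  have fin: "output_answer n (m'(0 := 1)) = Some (map (digit d n v) [0..<n])" if "I n m'" for m'
    using that by (auto simp: output_answer_def I_def)
  have "runs U (write_solution d) m (pcost ?i + (n * (expr_cost ?g + 1 + pcost (write_body d)) + (expr_cost ?g + 1) + pcost (Store (Lit 0) (Lit 1))))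
    (\<lambda>m'. output_answer n m' = Some (map (digit d n v) [0..<n]))"
    unfolding write_solution_def
  proof (rule runs_Seq_loopfree[OF _ _ runs_Seq'[OF L[OF I0]]])
    fix m' assume "I n m'"
    then show "runs U (Store (Lit 0) (Lit 1)) m' (pcost (Store (Lit 0) (Lit 1))) (\<lambda>m'. output_answer n m' = Some (map (digit d n v) [0..<n]))"
      using fin U_pos by (intro runs_loopfree) auto
  qed (use E v vU U_pos in auto)
  then show ?thesis by (rule runs_conseq) (auto simp: write_body_def)
qed

text \<open>The interface between program and mathematics: it is guaranteed on every instance and
  mentions neither memory nor time.\<close>

definition answer_spec :: "int list option \<Rightarrow> bool" where
  "answer_spec ans \<longleftrightarrow> (\<exists>Sf. (\<forall>D\<le>d. Res 0 1 (radii D) (Sf D)) \<and>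
     (ans = None \<and> (\<forall>D\<le>d. Sf D = {}) \<or> (\<exists>D\<le>d. \<exists>v\<in>Sf D. ans = Some (map (digit d n v) [0..<n]))))"

lemma bnd_input: "bnd U (input_memory M \<tau> x)"
proof -
  have "1 * M \<le> ((int n + 1) * (2 * int d + 1)) * M"
    using M_pos by (intro mult_right_mono) (auto intro: order_trans[OF _ mult_mono[of 1 _ 1]])
  then have MU: "M \<le> U" using U2 by simp
  show ?thesis unfolding bnd_def
  proof
    fix a
    consider "a = 0" | "a = 1" | "a = 2" | "3 \<le> a \<and> a < 3 + int n" | "a < 0 \<or> a \<ge> 3 + int n" by linarith
    then show "\<bar>input_memory M \<tau> x a\<bar> \<le> U"
    proof cases
      case 4
      then have "nat (a - 3) < n" by auto
      from x_range[OF this] show ?thesis using 4 MU len by (simp add: input_memory_def)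
    qed (use nU MU M_pos U3 U_pos len in \<open>auto simp: input_memory_def\<close>)
  qed
qed

lemma runs_solver:
  "runs U (solver d) (input_memory M \<tau> x) (400 * (n + 1) + (d + 1) * ((d + 1) * level_time + 20))
     (\<lambda>m'. answer_spec (output_answer n m'))"
proof -
  let ?Q = "\<lambda>m'. answer_spec (output_answer n m')"
  let ?i = "Seq (St rCap (Bin Div (Rg rP) (Rg rQ))) (St rFound (Lit 0))"
  let ?c = "Cond (Rg rFound) (write_solution d) (Store (Lit 0) (Lit 0))"
  define T where "T = 1 + Suc d * ((d + 1) * level_time + 20)"
  have C: "runs U ?c m1 (expr_cost (Rg rFound) + 1 + 60 * (n + 1)) ?Q" if fi: "found_inv (Suc d) m1" for m1
  proof -
    from fi obtain Sf where E: "Env m1" and Sf: "\<And>D. D \<le> d \<Longrightarrow> Res 0 1 (radii D) (Sf D)"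
      "m1 (reg rFound) = 0 \<and> (\<forall>D\<le>d. Sf D = {}) \<or> m1 (reg rFound) = 1 \<and> (\<exists>D\<le>d. m1 (reg rSol) \<in> Sf D)"
      unfolding found_inv_def less_Suc_eq_le by blast
    show ?thesis
    proof (rule runs_Cond)
      assume "ev m1 (Rg rFound) \<noteq> 0"
      then obtain D where D: "D \<le> d" "m1 (reg rSol) \<in> Sf D" using Sf(2) by auto
      have "valid_radii d 0 1 (radii D)" using D by (intro valid_radii_radii) auto
      from Res_D[OF Sf(1)[OF D(1)] this] D have "\<bar>m1 (reg rSol)\<bar> \<le> H" by blast
      from runs_write_solution[of m1 "m1 (reg rSol)", OF _ _ refl this] E
      have "runs U (write_solution d) m1 (60 * (n + 1)) (\<lambda>m'. output_answer n m' = Some (map (digit d n (m1 (reg rSol))) [0..<n]))"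
        by (simp add: Env_def)
      then show "runs U (write_solution d) m1 (60 * (n + 1)) ?Q"
        by (rule runs_conseq) (use Sf(1) D in \<open>auto simp: answer_spec_def intro!: exI[of _ Sf]\<close>)
    next
      assume "ev m1 (Rg rFound) = 0"
      then have e: "\<forall>D\<le>d. Sf D = {}" using Sf(2) by auto
      have "runs U (Store (Lit 0) (Lit 0)) m1 (pcost (Store (Lit 0) (Lit 0))) ?Q"
        using U_pos Sf(1) e by (intro runs_loopfree) (auto simp: output_answer_def answer_spec_def intro!: exI[of _ Sf])
      then show "runs U (Store (Lit 0) (Lit 0)) m1 (60 * (n + 1)) ?Q" by (rule runs_conseq) auto
    qed
  qed
  have "runs U (solver d) (input_memory M \<tau> x) (60 * (n + 1) + (40 * (n + 1) + (40 * (n + 1) + (pcost ?i + (T + (expr_cost (Rg rFound) + 1 + 60 * (n + 1))))))) ?Q"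
    unfolding solver_def
  proof (rule runs_Seq'[OF runs_set_offset])
    fix m1 assume m1: "m1 (reg rN) = int n \<and> m1 (reg rH) = H \<and>
     m1 1 = M \<and> m1 2 = \<tau> \<and> (\<forall>i<n. m1 (3 + int i) = x ! i)"
    show "runs U (Seq (store_power rP 43) (Seq (store_power rQ 5) (Seq ?i (Seq (try_all d (Suc d)) ?c)))) m1
      (40 * (n + 1) + (40 * (n + 1) + (pcost ?i + (T + (expr_cost (Rg rFound) + 1 + 60 * (n + 1)))))) ?Q"
    proof (rule runs_Seq'[OF runs_powp[of m1 rP 43]])
      fix m2 assume m2: "same {rP, rI} {} m1 m2 \<and> m2 (reg rP) = 43 ^ n"
      have p5: "5 ^ n \<le> U" using power_mono[of "5 :: int" 43 n] U4 by simp
      show "runs U (Seq (store_power rQ 5) (Seq ?i (Seq (try_all d (Suc d)) ?c))) m2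
        (40 * (n + 1) + (pcost ?i + (T + (expr_cost (Rg rFound) + 1 + 60 * (n + 1))))) ?Q"
      proof (rule runs_Seq'[OF runs_powp[of m2 rQ 5]])
        fix m3 assume m3: "same {rQ, rI} {} m2 m3 \<and> m3 (reg rQ) = 5 ^ n"
        have s3: "same {rP, rQ, rI} {} m1 m3" by (rule same_trans[OF conjunct1[OF m2] conjunct1[OF m3]]) auto
        have P3: "m3 (reg rP) = 43 ^ n" using m2 m3 by (auto simp: same_def)
        define m4 where "m4 = srun ?i m3"
        have s4: "same {rCap, rFound} {} m3 m4" unfolding m4_def by (auto intro!: same_upd_reg)
        have s14: "same {rP, rQ, rI, rCap, rFound} {} m1 m4" by (rule same_trans[OF s3 s4]) auto
        have "Env m4" unfolding Env_def using s14 m1 P3 m3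
          by (auto simp: same_def m4_def cap_def)
        then have f0: "found_inv 0 m4" by (auto simp: found_inv_def m4_def)
        have "runs U (Seq (try_all d (Suc d)) ?c) m4 (T + (expr_cost (Rg rFound) + 1 + 60 * (n + 1))) ?Q"
          unfolding T_def by (rule runs_Seq'[OF runs_try_all[OF f0 order_refl] C])
        then show "runs U (Seq ?i (Seq (try_all d (Suc d)) ?c)) m3 (pcost ?i + (T + (expr_cost (Rg rFound) + 1 + 60 * (n + 1)))) ?Q"
          unfolding m4_def using P3 m3 cap_bounds by (intro runs_Seq_loopfree) (auto simp: cap_def)
      qed (use m1 m2 p5 in \<open>auto simp: same_def\<close>)
    qed (use m1 U4 in auto)
  qed (auto simp: input_memory_def len)
  then show ?thesis by (rule runs_conseq) (auto simp: T_def)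
qed

end

subsection \<open>Covering the parity classes\<close>

definition dot :: "(nat \<Rightarrow> int) \<Rightarrow> int list \<Rightarrow> int" where
  "dot c x = (\<Sum>i<length x. c i * x ! i)"

definition win :: "int \<Rightarrow> int \<Rightarrow> int \<Rightarrow> bool" where
  "win M W y \<longleftrightarrow> (y + W) mod M \<le> 2 * W"

lemma win_mod: "win M W (y mod M) = win M W y"
  by (simp add: win_def mod_add_left_eq)

lemma win_iff:
  assumes "0 < M" "0 \<le> W"
  shows "win M W y \<longleftrightarrow> (\<exists>w. \<bar>w\<bar> \<le> W \<and> M dvd y - w)"
proof
  assume "win M W y"
  then have "(y + W) mod M - W \<le> W" "0 \<le> (y + W) mod M"
    using assms by (simp_all add: win_def)
  then have "\<bar>(y + W) mod M - W\<bar> \<le> W" by linarith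
  moreover have "M dvd y - ((y + W) mod M - W)"
    by (metis add.commute add_diff_eq diff_diff_eq2 dvd_minus_mod)
  ultimately show "\<exists>w. \<bar>w\<bar> \<le> W \<and> M dvd y - w" by blast
next
  assume "\<exists>w. \<bar>w\<bar> \<le> W \<and> M dvd y - w"
  then obtain w where w: "\<bar>w\<bar> \<le> W" "M dvd y - w" by blast
  then have "(y + W) mod M = (w + W) mod M" by (simp add: mod_eq_dvd_iff)
  also have "\<dots> \<le> w + W" using w by (intro zmod_le_nonneg_dividend) simp
  finally show "win M W y" using w by (simp add: win_def)
qed

lemma input_vectorsD:
  assumes "x \<in> input_vectors n M"
  shows "length x = n" "\<And>i. i < n \<Longrightarrow> 0 \<le> x ! i \<and> x ! i < M"
proof -
  show "length x = n" using assms by (simp add: input_vectors_def)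
  then show "0 \<le> x ! i \<and> x ! i < M" if "i < n" for i
    using that assms nth_mem[of i x] unfolding input_vectors_def by fastforce
qed

lemma input_vectorsI: "length x = n \<Longrightarrow> (\<And>i. i < n \<Longrightarrow> 0 \<le> x ! i \<and> x ! i < M) \<Longrightarrow> x \<in> input_vectors n M"
  unfolding input_vectors_def by (force simp: in_set_conv_nth)

lemma card_input_vectors: "0 \<le> M \<Longrightarrow> real (card (input_vectors n M)) = real_of_int M ^ n"
proof -
  assume M: "0 \<le> M"
  have "input_vectors n M = {xs. set xs \<subseteq> {0..M-1} \<and> length xs = n}" by (auto simp: input_vectors_def)
  then have "card (input_vectors n M) = nat M ^ n" using card_lists_length_eq[of "{0..M-1}" n] by simp
  then show ?thesis using M by simp
qed

text \<open>Replacing one entry of a uniform vector by a fresh uniform value leaves it uniform. This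
  takes the place of conditioning on all other coordinates.\<close>

lemma sum_resample:
  fixes f :: "int list \<Rightarrow> real"
  assumes i: "i < n"
  shows "(\<Sum>x\<in>input_vectors n M. f x) * real_of_int M =
     (\<Sum>x\<in>input_vectors n M. \<Sum>t\<in>{0..<M}. f (x[i := t]))"
proof (cases "0 \<le> M")
  case True
  let ?I = "input_vectors n M"
  have upd: "x[i := t] \<in> ?I" if "x \<in> ?I" "t \<in> {0..<M}" for x t
    using that input_vectorsD[OF that(1)] i by (intro input_vectorsI) (auto simp: nth_list_update)
  have "(\<Sum>x\<in>?I. \<Sum>t\<in>{0..<M}. f (x[i := t])) = (\<Sum>(x, t)\<in>?I \<times> {0..<M}. f (x[i := t]))"
    by (simp add: sum.cartesian_product)
  also have "\<dots> = (\<Sum>(x, t)\<in>?I \<times> {0..<M}. f x)"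
  \<comment> \<open>Exchanging the fresh value with the entry at \<open>i\<close> is an involution
    on the pairs.\<close>
  proof (rule sum.reindex_bij_witness[where i = "\<lambda>(x, t). (x[i := t], x ! i)" and j = "\<lambda>(x, t). (x[i := t], x ! i)"])
    fix p assume p: "p \<in> ?I \<times> {0..<M}"
    then obtain x t where p: "p = (x, t)" "x \<in> ?I" "t \<in> {0..<M}" by auto
    note D = input_vectorsD[OF p(2)]
    show "(case case p of (x, t) \<Rightarrow> (x[i := t], x ! i) of (x, t) \<Rightarrow> (x[i := t], x ! i)) = p"
      using D i p by simp
    then show "(case case p of (x, t) \<Rightarrow> (x[i := t], x ! i) of (x, t) \<Rightarrow> (x[i := t], x ! i)) = p" .
    show "(case p of (x, t) \<Rightarrow> (x[i := t], x ! i)) \<in> ?I \<times> {0..<M}"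
      using D[of] i p upd by auto
    then show "(case p of (x, t) \<Rightarrow> (x[i := t], x ! i)) \<in> ?I \<times> {0..<M}" .
    show "(case case p of (x, t) \<Rightarrow> (x[i := t], x ! i) of (x, t) \<Rightarrow> f x) = (case p of (x, t) \<Rightarrow> f (x[i := t]))"
      using p by simp
  qed
  also have "\<dots> = (\<Sum>x\<in>?I. \<Sum>t\<in>{0..<M}. f x)" by (simp only: sum.cartesian_product)
  also have "\<dots> = (\<Sum>x\<in>?I. f x) * real_of_int M" using True
    by (simp add: sum_distrib_left[symmetric] mult.commute)
  finally show ?thesis by simp
next
  case False
  have "x \<notin> input_vectors n M" for x
    using False i input_vectorsD(2)[of x n M i] by auto
  then have "input_vectors n M = {}" by blast
  then show ?thesis by simp
qed

lemma dot_update: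
  assumes "i < length x"
  shows "dot c (x[i := t]) = c i * t + (dot c x - c i * x ! i)"
proof -
  have *: "dot c y = c i * y ! i + (\<Sum>k\<in>{..<length x} - {i}. c k * y ! k)" if "length y = length x" for y
    unfolding dot_def that using assms by (subst sum.remove[of _ i]) auto
  have "(\<Sum>k\<in>{..<length x} - {i}. c k * x[i := t] ! k) = (\<Sum>k\<in>{..<length x} - {i}. c k * x ! k)"
    by (intro sum.cong) auto
  then show ?thesis using *[of x] *[of "x[i := t]"] assms by simp
qed

section \<open>How often a scalar product falls into a window\<close>

lemma sum_mod_shift:
  fixes f :: "int \<Rightarrow> real"
  assumes "0 < M"
  shows "(\<Sum>t\<in>{0..<M}. f ((t + s) mod M)) = (\<Sum>u\<in>{0..<M}. f u)"
  by (rule sum.reindex_bij_witness[where i = "\<lambda>u. (u - s) mod M" and j = "\<lambda>t. (t + s) mod M"])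
    (use assms in \<open>auto simp: mod_simps\<close>)

lemma card_of_bool: "finite A \<Longrightarrow> real (card {x \<in> A. P x}) = (\<Sum>x\<in>A. of_bool (P x))"
  by (simp add: of_bool_def sum.inter_filter[symmetric])

lemma sum_win:
  assumes "0 < M" "0 \<le> W" "2 * W + 1 \<le> M"
  shows "(\<Sum>t\<in>{0..<M}. of_bool (win M W (t + s))) = real_of_int (2 * W + 1)"
proof -
  have "(\<Sum>t\<in>{0..<M}. of_bool (win M W (t + s)) :: real) = (\<Sum>t\<in>{0..<M}. of_bool ((t + (s + W)) mod M \<le> 2 * W))"
    by (simp add: win_def add.assoc)
  also have "\<dots> = (\<Sum>u\<in>{0..<M}. of_bool (u \<le> 2 * W))"
    by (rule sum_mod_shift[OF assms(1), of "\<lambda>u. of_bool (u \<le> 2 * W)"])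
  also have "\<dots> = real (card {u \<in> {0..<M}. u \<le> 2 * W})" by (rule card_of_bool[symmetric]) simp
  also have "{u \<in> {0..<M}. u \<le> 2 * W} = {0..2 * W}" using assms by auto
  finally show ?thesis using assms by simp
qed

text \<open>Two solutions differ by a multiple of M / gcd(m, M), so each of the gcd(m, M) intervals
  of that length in {0..<M} contains at most one.\<close>

lemma card_congruence:
  fixes m :: int
  assumes "0 < M" "m \<noteq> 0"
  shows "int (card {t \<in> {0..<M}. M dvd m * t - u}) \<le> gcd m M"
proof -
  define g where "g = gcd m M"
  have g: "0 < g" using assms by (simp add: g_def)
  obtain m' where m1: "m = g * m'" unfolding g_def by (rule dvdE[OF gcd_dvd1[of m M]])
  obtain M' where m2: "M = g * M'" unfolding g_def by (rule dvdE[OF gcd_dvd2[of m M]])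
  note m' = m1 m2
  have "coprime m' M'"
  proof (rule gcd_coprime[of m M])
    show "gcd m M \<noteq> 0" using g by (simp add: g_def)
    show "m = m' * gcd m M" "M = M' * gcd m M"
      unfolding g_def[symmetric] by (subst m1 m2, rule mult.commute)+
  qed
  then have cop: "coprime M' m'" by (simp add: coprime_commute)
  have M': "0 < M'" using m' g assms by (simp add: zero_less_mult_iff)
  have inj: "inj_on (\<lambda>t. t div M') {t \<in> {0..<M}. M dvd m * t - u}"
  proof (rule inj_onI)
    fix s t assume s: "s \<in> {t \<in> {0..<M}. M dvd m * t - u}" and t: "t \<in> {t \<in> {0..<M}. M dvd m * t - u}"
      and eq: "s div M' = t div M'"
    have "M dvd m * s - u" "M dvd m * t - u" using s t by auto
    then have "M dvd (m * s - u) - (m * t - u)" by (rule dvd_diff)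
    then have "g * M' dvd g * (m' * (s - t))" using m' by (simp add: algebra_simps)
    then have "M' dvd m' * (s - t)" using g by simp
    then have "M' dvd s - t" using cop by (simp add: coprime_dvd_mult_right_iff)
    then have "s mod M' = t mod M'" by (simp add: mod_eq_dvd_iff)
    with eq show "s = t" by (metis div_mult_mod_eq)
  qed
  have "(\<lambda>t. t div M') ` {t \<in> {0..<M}. M dvd m * t - u} \<subseteq> {0..<g}"
    using M' m' by (auto simp: pos_imp_zdiv_nonneg_iff mult.commute intro!: zdiv_less_if)
  then have "card {t \<in> {0..<M}. M dvd m * t - u} \<le> card {0..<g}"
    by (intro card_inj_on_le[OF inj]) auto
  then show ?thesis unfolding g_def[symmetric] using g by (simp add: le_nat_iff)
qed

lemma card_dvd_interval:
  fixes g :: int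
  assumes "0 < g" "0 \<le> W"
  shows "g * int (card {w \<in> {- W..W}. g dvd s - w}) \<le> 2 * W + g"
proof -
  have inj: "inj_on (\<lambda>w. (w + W) div g) {w \<in> {- W..W}. g dvd s - w}"
  proof (rule inj_onI)
    fix v w assume v: "v \<in> {w \<in> {- W..W}. g dvd s - w}" and w: "w \<in> {w \<in> {- W..W}. g dvd s - w}"
      and eq: "(v + W) div g = (w + W) div g"
    have "g dvd s - w" "g dvd s - v" using v w by auto
    then have "g dvd (s - w) - (s - v)" by (rule dvd_diff)
    then have "(v + W) mod g = (w + W) mod g" by (simp add: mod_eq_dvd_iff)
    with eq have "v + W = w + W" by (metis div_mult_mod_eq)
    then show "v = w" by simp
  qed
  have "(\<lambda>w. (w + W) div g) ` {w \<in> {- W..W}. g dvd s - w} \<subseteq> {0..(2 * W) div g}"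
    using assms by (auto simp: pos_imp_zdiv_nonneg_iff intro!: zdiv_mono1)
  then have "card {w \<in> {- W..W}. g dvd s - w} \<le> card {0..(2 * W) div g}"
    by (intro card_inj_on_le[OF inj]) auto
  then have "int (card {w \<in> {- W..W}. g dvd s - w}) \<le> (2 * W) div g + 1"
    using assms by (simp add: pos_imp_zdiv_nonneg_iff le_nat_iff)
  then have "g * int (card {w \<in> {- W..W}. g dvd s - w}) \<le> g * ((2 * W) div g + 1)"
    using assms by (intro mult_left_mono) auto
  also have "\<dots> \<le> 2 * W + g"
    using pos_mod_sign[OF assms(1), of "2 * W"] minus_mod_eq_mult_div[of "2 * W" g]
    by (simp only: distrib_left)
  finally show ?thesis .
qed

text \<open>A common factor g of m and M multiplies the number of solutions for each target by up to
  g, but only targets congruent to s modulo g are attainable. The two effects compensate up to an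
  additive g, which is at most |m|; no assumption on the divisors of M is made.\<close>

lemma sum_win_le:
  fixes m :: int
  assumes "0 < M" "0 \<le> W" "m \<noteq> 0"
  shows "(\<Sum>t\<in>{0..<M}. of_bool (win M W (m * t + s))) \<le> real_of_int (2 * W + \<bar>m\<bar>)"
proof -
  define g where "g = gcd m M"
  have g: "0 < g" "g \<le> \<bar>m\<bar>" using assms by (auto simp: g_def intro!: zdvd_imp_le)
  let ?S = "{w \<in> {- W..W}. g dvd s - w}"
  have sub: "{t \<in> {0..<M}. win M W (m * t + s)} \<subseteq> (\<Union>w\<in>?S. {t \<in> {0..<M}. M dvd m * t - (w - s)})"
  proof
    fix t assume "t \<in> {t \<in> {0..<M}. win M W (m * t + s)}"
    then obtain w where t: "t \<in> {0..<M}" and w: "\<bar>w\<bar> \<le> W" "M dvd m * t + s - w"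
      using win_iff[OF assms(1,2)] by auto
    have "g dvd m * t + s - w" "g dvd m * t" using w(2) by (auto simp: g_def intro: dvd_trans)
    then have "g dvd (m * t + s - w) - m * t" by (rule dvd_diff)
    then have "w \<in> ?S" using w(1) by (auto simp: abs_le_iff)
    moreover have "M dvd m * t - (w - s)" using w(2) by (simp add: algebra_simps)
    ultimately show "t \<in> (\<Union>w\<in>?S. {t \<in> {0..<M}. M dvd m * t - (w - s)})" using t by blast
  qed
  have "int (card {t \<in> {0..<M}. win M W (m * t + s)}) \<le> int (card (\<Union>w\<in>?S. {t \<in> {0..<M}. M dvd m * t - (w - s)}))"
  proof (intro of_nat_mono card_mono[OF _ sub])
    show "finite (\<Union>w\<in>?S. {t \<in> {0..<M}. M dvd m * t - (w - s)})"
      by (rule finite_subset[of _ "{0..<M}"]) auto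
  qed
  also have "\<dots> \<le> int (\<Sum>w\<in>?S. card {t \<in> {0..<M}. M dvd m * t - (w - s)})"
    by (intro of_nat_mono card_UN_le finite_subset[of ?S "{- W..W}"]) auto
  also have "\<dots> \<le> (\<Sum>w\<in>?S. g)" unfolding of_nat_sum
    by (intro sum_mono) (use card_congruence[OF assms(1,3)] g_def in auto)
  also have "\<dots> = g * int (card ?S)" by simp
  also have "\<dots> \<le> 2 * W + g" by (rule card_dvd_interval[OF g(1) assms(2)])
  also have "\<dots> \<le> 2 * W + \<bar>m\<bar>" using g by simp
  finally have "real (card {t \<in> {0..<M}. win M W (m * t + s)}) \<le> real_of_int (2 * W + \<bar>m\<bar>)"
    by (metis of_int_le_iff of_int_of_nat_eq)
  then show ?thesis by (subst (asm) card_of_bool) auto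
qed

text \<open>Resampling one coordinate with nonzero coefficient suffices. The multiplier
  \<open>k\<close> is 1 for differences of covering vectors and 2^j for the vectors of level
  j.\<close>

lemma sum_win_dot:
  assumes "0 < M" "0 \<le> W" "i < n" "k * c i \<noteq> 0"
  shows "(\<Sum>x\<in>input_vectors n M. of_bool (win M W (k * dot c x + s))) * real_of_int M
    \<le> real_of_int M ^ n * real_of_int (2 * W + \<bar>k * c i\<bar>)"
proof -
  have "(\<Sum>x\<in>input_vectors n M. of_bool (win M W (k * dot c x + s))) * real_of_int M =
    (\<Sum>x\<in>input_vectors n M. \<Sum>t\<in>{0..<M}. of_bool (win M W (k * dot c (x[i := t]) + s)))"
    by (rule sum_resample[OF assms(3)])
  also have "\<dots> \<le> (\<Sum>x\<in>input_vectors n M. real_of_int (2 * W + \<bar>k * c i\<bar>))"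
  proof (rule sum_mono)
    fix x assume x: "x \<in> input_vectors n M"
    have "k * dot c (x[i := t]) + s = (k * c i) * t + (k * (dot c x - c i * x ! i) + s)" for t
      using input_vectorsD(1)[OF x] assms(3) by (subst dot_update) (auto simp: algebra_simps)
    then show "(\<Sum>t\<in>{0..<M}. of_bool (win M W (k * dot c (x[i := t]) + s))) \<le> real_of_int (2 * W + \<bar>k * c i\<bar>)"
      by (simp only: sum_win_le[OF assms(1,2,4)])
  qed
  also have "\<dots> = real_of_int M ^ n * real_of_int (2 * W + \<bar>k * c i\<bar>)"
    using card_input_vectors[of M n] assms(1) by simp
  finally show ?thesis .
qed

text \<open>Over the integers, the other coordinates determine the value at \<open>i\<close>, so a
  fraction of at most 1 / M is left.\<close>

lemma card_dot_eq:
  assumes "0 < M" "i < n" "c i \<noteq> 0"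
  shows "real (card {x \<in> input_vectors n M. dot c x = s}) * real_of_int M \<le> real_of_int M ^ n"
proof -
  have "(\<Sum>x\<in>input_vectors n M. of_bool (dot c x = s)) * real_of_int M =
    (\<Sum>x\<in>input_vectors n M. \<Sum>t\<in>{0..<M}. of_bool (dot c (x[i := t]) = s))"
    by (rule sum_resample[OF assms(2)])
  also have "\<dots> \<le> (\<Sum>x\<in>input_vectors n M. 1)"
  proof (rule sum_mono)
    fix x assume x: "x \<in> input_vectors n M"
    have eq: "dot c (x[i := t]) = c i * t + (dot c x - c i * x ! i)" for t
      using dot_update[of i x c t] input_vectorsD(1)[OF x] assms(2) by simp
    have "card {t \<in> {0..<M}. dot c (x[i := t]) = s} \<le> Suc 0"
      unfolding eq using assms(3)
      by (subst card_le_Suc0_iff_eq) (auto intro: finite_subset[of _ "{0..<M}"])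
    then have "real (card {t \<in> {0..<M}. dot c (x[i := t]) = s}) \<le> 1" by linarith
    then show "(\<Sum>t\<in>{0..<M}. of_bool (dot c (x[i := t]) = s)) \<le> (1::real)"
      by (subst card_of_bool[symmetric]) auto
  qed
  finally show ?thesis using card_input_vectors[of M n] assms(1)
    by (simp add: card_of_bool finite_input_vectors)
qed

text \<open>Both forms have the coefficient \<open>1\<close> at \<open>i\<close>, so their difference does not depend on \<open>x ! i\<close>, and
  resampling \<open>x ! i\<close> makes the first form uniform given the difference.\<close>

lemma sum_win_pair:
  assumes M: "0 < M" "0 \<le> W" "2 * W + 1 \<le> M" and i: "i < n" "e i = 1" "e' i = 1"
    and l: "l < n" "e l \<noteq> e' l"
  shows "(\<Sum>x\<in>input_vectors n M. of_bool (win M W (dot e x)) * of_bool (win M W (dot e' x))) * real_of_int M * real_of_int M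
    \<le> real_of_int M ^ n * real_of_int (2 * W + 1) * real_of_int (2 * W + \<bar>e' l - e l\<bar>)"
proof -
  let ?I = "input_vectors n M" and ?w = "\<lambda>y. of_bool (win M W y) :: real"
  define f where "f k = e' k - e k" for k
  have df: "dot e' x = dot e x + dot f x" for x
    unfolding dot_def f_def by (simp add: sum.distrib[symmetric] algebra_simps)
  have "(\<Sum>x\<in>?I. ?w (dot e x) * ?w (dot e' x)) * real_of_int M =
    (\<Sum>x\<in>?I. \<Sum>t\<in>{0..<M}. ?w (dot e (x[i := t])) * ?w (dot e' (x[i := t])))"
    by (rule sum_resample[OF i(1)])
  also have "\<dots> = (\<Sum>x\<in>?I. \<Sum>u\<in>{0..<M}. ?w u * ?w (u + dot f x))"
  proof (rule sum.cong[OF refl])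
    fix x assume x: "x \<in> ?I"
    define s where "s = dot e x - x ! i"
    have 1: "dot e (x[i := t]) = t + s" "dot f (x[i := t]) = dot f x" for t
      using dot_update[of i x e t] dot_update[of i x f t] input_vectorsD(1)[OF x] i
      by (simp_all add: s_def f_def)
    have "(\<Sum>t\<in>{0..<M}. ?w (dot e (x[i := t])) * ?w (dot e' (x[i := t]))) =
      (\<Sum>t\<in>{0..<M}. ?w ((t + s) mod M) * ?w ((t + s) mod M + dot f x))"
    proof (rule sum.cong[OF refl])
      fix t
      have "win M W ((t + s) mod M + dot f x) = win M W (t + s + dot f x)"
        by (metis mod_add_left_eq win_mod)
      then show "?w (dot e (x[i := t])) * ?w (dot e' (x[i := t])) =
        ?w ((t + s) mod M) * ?w ((t + s) mod M + dot f x)"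
        unfolding df 1 by (simp add: win_mod)
    qed
    also have "\<dots> = (\<Sum>u\<in>{0..<M}. ?w u * ?w (u + dot f x))"
      by (rule sum_mod_shift[OF M(1), of "\<lambda>u. ?w u * ?w (u + dot f x)"])
    finally show "(\<Sum>t\<in>{0..<M}. ?w (dot e (x[i := t])) * ?w (dot e' (x[i := t]))) =
      (\<Sum>u\<in>{0..<M}. ?w u * ?w (u + dot f x))" .
  qed
  also have "\<dots> = (\<Sum>u\<in>{0..<M}. ?w u * (\<Sum>x\<in>?I. ?w (1 * dot f x + u)))"
    by (subst sum.swap) (simp add: sum_distrib_left add.commute)
  finally have "(\<Sum>x\<in>?I. ?w (dot e x) * ?w (dot e' x)) * real_of_int M * real_of_int M =
    (\<Sum>u\<in>{0..<M}. ?w u * ((\<Sum>x\<in>?I. ?w (1 * dot f x + u)) * real_of_int M))"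
    by (simp add: sum_distrib_right mult.assoc)
  also have "\<dots> \<le> (\<Sum>u\<in>{0..<M}. ?w u * (real_of_int M ^ n * real_of_int (2 * W + \<bar>1 * f l\<bar>)))"
    by (intro sum_mono mult_left_mono sum_win_dot[OF M(1,2) l(1)]) (use l in \<open>auto simp: f_def\<close>)
  also have "\<dots> = real_of_int (2 * W + 1) * (real_of_int M ^ n * real_of_int (2 * W + \<bar>1 * f l\<bar>))"
    using sum_win[OF M, of 0] by (simp add: sum_distrib_right[symmetric])
  finally show ?thesis by (simp add: f_def mult.commute mult.left_commute)
qed

text \<open>Chebyshev's inequality for the number X of vectors in \<open>E\<close> that hit the
  window. The mean is \<mu> = K L / M with K = |E| and L = 2 W + 1; the diagonal pairs contribute
  \<mu> to the second moment, and the remaining pairs exceed \<mu>^2 only by a term with 2 \<rho>,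
  which stems from common factors with M. Fixing the coefficient 1 at \<open>i\<close> makes every
  single vector exactly uniform.\<close>

lemma cover_one:
  fixes E :: "(nat \<Rightarrow> int) set"
  assumes M: "0 < M" "0 \<le> W" "2 * W + 1 \<le> M" and i: "i < n" and E: "finite E" "E \<noteq> {}"
    and e: "\<And>e. e \<in> E \<Longrightarrow> e i = 1 \<and> (\<forall>l<n. \<bar>e l\<bar> \<le> \<rho>)"
    and d: "\<And>e e'. e \<in> E \<Longrightarrow> e' \<in> E \<Longrightarrow> e \<noteq> e' \<Longrightarrow> \<exists>l<n. e l \<noteq> e' l"
  shows "real (card {x \<in> input_vectors n M. \<forall>e\<in>E. \<not> win M W (dot e x)})
    \<le> real_of_int M ^ n * (real_of_int M / (real (card E) * real_of_int (2 * W + 1)) +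
        2 * real_of_int \<rho> / real_of_int (2 * W + 1))"
proof -
  let ?I = "input_vectors n M" and ?w = "\<lambda>e x. of_bool (win M W (dot e x)) :: real"
  define L where "L = real_of_int (2 * W + 1)"
  define m where "m = real_of_int M"
  define K where "K = real (card E)"
  have pos: "0 < L" "0 < m" "0 < K" using M E by (auto simp: L_def m_def K_def card_gt_0_iff)
  obtain e0 where e0: "e0 \<in> E" using E by blast
  have \<rho>: "0 \<le> \<rho>" using e[OF e0] i by force
  define X where "X x = (\<Sum>e\<in>E. ?w e x)" for x
  have one: "(\<Sum>x\<in>?I. ?w e x) = m ^ n * (L / m)" if "e \<in> E" for e
  proof -
    have "(\<Sum>x\<in>?I. ?w e x) * m = (\<Sum>x\<in>?I. \<Sum>t\<in>{0..<M}. ?w e (x[i := t]))"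
      unfolding m_def by (rule sum_resample[OF i])
    also have "\<dots> = (\<Sum>x\<in>?I. L)"
    proof (rule sum.cong[OF refl])
      fix x assume x: "x \<in> ?I"
      have "dot e (x[i := t]) = t + (dot e x - x ! i)" for t
        using dot_update[of i x e t] input_vectorsD(1)[OF x] i e[OF that] by simp
      then show "(\<Sum>t\<in>{0..<M}. ?w e (x[i := t])) = L" unfolding L_def using sum_win[OF M] by simp
    qed
    finally show ?thesis using card_input_vectors[of M n] M(1) pos by (simp add: m_def field_simps)
  qed
  have EX: "(\<Sum>x\<in>?I. X x) = m ^ n * (K * L / m)"
    unfolding X_def by (subst sum.swap) (simp add: one K_def)
  have pair: "(\<Sum>x\<in>?I. ?w e x * ?w e' x) \<le> m ^ n * (L * (L + 2 * real_of_int \<rho>) / m\<^sup>2)" if ee: "e \<in> E" "e' \<in> E" "e \<noteq> e'" for e e'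
  proof -
    obtain l where l: "l < n" "e l \<noteq> e' l" using d[OF ee] by blast
    have "\<bar>e' l - e l\<bar> \<le> 2 * \<rho>" using e[OF ee(1)] e[OF ee(2)] l by (smt (verit))
    then have le: "real_of_int (2 * W + \<bar>e' l - e l\<bar>) \<le> L + 2 * real_of_int \<rho>" unfolding L_def by linarith
    have "(\<Sum>x\<in>?I. ?w e x * ?w e' x) * m * m \<le> m ^ n * L * real_of_int (2 * W + \<bar>e' l - e l\<bar>)"
      unfolding L_def m_def by (rule sum_win_pair[OF M i, of e e', OF _ _ l]) (use e ee in auto)
    also have "\<dots> \<le> m ^ n * L * (L + 2 * real_of_int \<rho>)" using pos le by (intro mult_left_mono) auto
    finally show ?thesis using pos by (simp add: field_simps power2_eq_square)
  qed
  have "(\<Sum>x\<in>?I. (X x)\<^sup>2) = (\<Sum>e\<in>E. \<Sum>e'\<in>E. \<Sum>x\<in>?I. ?w e x * ?w e' x)"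
    unfolding X_def power2_eq_square sum_product
    by (subst sum.swap, rule sum.cong[OF refl], subst sum.swap, rule refl)
  \<comment> \<open>The off-diagonal bound is nonnegative and is simply added on the diagonal as
    well, so both sums can be evaluated in closed form.\<close>
  also have "\<dots> \<le> (\<Sum>e\<in>E. \<Sum>e'\<in>E. (if e = e' then m ^ n * (L / m) else 0) + m ^ n * (L * (L + 2 * real_of_int \<rho>) / m\<^sup>2))"
  proof (intro sum_mono)
    fix e e' assume ee: "e \<in> E" "e' \<in> E"
    have nn: "0 \<le> m ^ n * (L * (L + 2 * real_of_int \<rho>) / m\<^sup>2)" using pos \<rho> by simp
    show "(\<Sum>x\<in>?I. ?w e x * ?w e' x) \<le> (if e = e' then m ^ n * (L / m) else 0) + m ^ n * (L * (L + 2 * real_of_int \<rho>) / m\<^sup>2)"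
    proof (cases "e = e'")
      case True
      have "(\<Sum>x\<in>?I. ?w e x * ?w e x) = (\<Sum>x\<in>?I. ?w e x)" by (intro sum.cong) auto
      then show ?thesis using one[OF ee(1)] nn True by simp
    qed (use pair[OF ee] in simp)
  qed
  also have "\<dots> = K * (m ^ n * (L / m)) + K * (K * (m ^ n * (L * (L + 2 * real_of_int \<rho>) / m\<^sup>2)))"
    by (simp add: sum.distrib E K_def distrib_left)
  finally have EX2: "(\<Sum>x\<in>?I. (X x)\<^sup>2) \<le> m ^ n * (K * L / m + K\<^sup>2 * L * (L + 2 * real_of_int \<rho>) / m\<^sup>2)"
    by (simp add: algebra_simps power2_eq_square)
  define \<mu> where "\<mu> = K * L / m"
  have \<mu>: "0 < \<mu>" using pos by (simp add: \<mu>_def)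
  \<comment> \<open>At a bad \<open>x\<close> no vector hits, so X = 0, and \<open>x\<close>
    contributes exactly \<mu>^2 to the total squared deviation.\<close>
  have "real (card {x \<in> ?I. \<forall>e\<in>E. \<not> win M W (dot e x)}) * \<mu>\<^sup>2 = (\<Sum>x\<in>{x \<in> ?I. \<forall>e\<in>E. \<not> win M W (dot e x)}. (X x - \<mu>)\<^sup>2)"
  proof -
    have "X x = 0" if "x \<in> {x \<in> ?I. \<forall>e\<in>E. \<not> win M W (dot e x)}" for x
      unfolding X_def using that by (intro sum.neutral) auto
    then show ?thesis by simp
  qed
  also have "\<dots> \<le> (\<Sum>x\<in>?I. (X x - \<mu>)\<^sup>2)" by (rule sum_mono2) (auto simp: finite_input_vectors)
  also have "\<dots> = (\<Sum>x\<in>?I. (X x)\<^sup>2) - 2 * \<mu> * (\<Sum>x\<in>?I. X x) + m ^ n * \<mu>\<^sup>2"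
  proof -
    have "(\<Sum>x\<in>?I. (X x - \<mu>)\<^sup>2) = (\<Sum>x\<in>?I. (X x)\<^sup>2 - 2 * \<mu> * X x + \<mu>\<^sup>2)"
      by (intro sum.cong) (simp_all add: power2_diff)
    then show ?thesis using card_input_vectors[of M n] M(1)
      by (simp add: sum.distrib sum_subtractf sum_distrib_left m_def)
  qed
  also have "\<dots> \<le> m ^ n * (\<mu> + K\<^sup>2 * L * (L + 2 * real_of_int \<rho>) / m\<^sup>2) - 2 * \<mu> * (m ^ n * \<mu>) + m ^ n * \<mu>\<^sup>2"
    using EX2 unfolding EX \<mu>_def by simp
  also have "\<dots> = m ^ n * (\<mu> + 2 * real_of_int \<rho> * K\<^sup>2 * L / m\<^sup>2)"
    unfolding \<mu>_def using pos by (simp add: field_simps power2_eq_square)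
  finally have "real (card {x \<in> ?I. \<forall>e\<in>E. \<not> win M W (dot e x)}) \<le> m ^ n * (\<mu> + 2 * real_of_int \<rho> * K\<^sup>2 * L / m\<^sup>2) / \<mu>\<^sup>2"
    using \<mu> by (simp add: pos_le_divide_eq)
  also have "\<dots> = m ^ n * (m / (K * L) + 2 * real_of_int \<rho> / L)"
    unfolding \<mu>_def using pos by (simp add: field_simps power2_eq_square)
  finally show ?thesis unfolding m_def L_def K_def .
qed

text \<open>Only the parities of \<open>c\<close> matter, so these are finitely many requirements.
  Equal parity makes (c + e) / 2 and (c - e) / 2 integral.\<close>

definition covers :: "int \<Rightarrow> int \<Rightarrow> int \<Rightarrow> int list \<Rightarrow> bool" where
  "covers M \<rho> W x \<longleftrightarrow> (\<forall>c. \<exists>e. (\<forall>i<length x. \<bar>e i\<bar> \<le> \<rho> \<and> even (c i - e i)) \<and> win M W (dot e x))"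

lemma card_parity:
  assumes "0 \<le> \<rho>"
  shows "nat \<rho> \<le> card {e. \<bar>e\<bar> \<le> \<rho> \<and> odd e = b}"
proof -
  define \<beta> :: int where "\<beta> = of_bool b"
  \<comment> \<open>Every second integer, beginning with the least one of the wanted parity that is
    at least -\<rho>.\<close>
  define f where "f k = 2 * k + \<beta> - 2 * ((\<rho> + \<beta>) div 2)" for k
  have "f ` {0..<\<rho>} \<subseteq> {e. \<bar>e\<bar> \<le> \<rho> \<and> odd e = b}"
  proof
    fix e assume "e \<in> f ` {0..<\<rho>}"
    then obtain k where k: "0 \<le> k" "k < \<rho>" "e = f k" by auto
    have "\<bar>f k\<bar> \<le> \<rho>" "odd (f k) = b" unfolding f_def \<beta>_def using k by (cases b; simp; presburger)+
    then show "e \<in> {e. \<bar>e\<bar> \<le> \<rho> \<and> odd e = b}" using k by simp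
  qed
  moreover have "{e. \<bar>e\<bar> \<le> \<rho> \<and> odd e = b} \<subseteq> {- \<rho>..\<rho>}" by auto
  then have "finite {e. \<bar>e\<bar> \<le> \<rho> \<and> odd e = b}" by (rule finite_subset) simp
  ultimately have "card (f ` {0..<\<rho>}) \<le> card {e. \<bar>e\<bar> \<le> \<rho> \<and> odd e = b}" by (intro card_mono)
  moreover have "card (f ` {0..<\<rho>}) = nat \<rho>" by (subst card_image) (auto simp: inj_on_def f_def)
  ultimately show ?thesis by simp
qed

text \<open>A union bound over the parity classes, each given by its set P of odd positions. In a
  nonzero class the least odd position is fixed to the coefficient 1, which is the common coordinate
  for the second moment; this costs one of the n factors \<rho>.\<close>

lemma covers_prob:
  assumes M: "0 < M" "0 \<le> W" "2 * W + 1 \<le> M" and \<rho>: "1 \<le> \<rho>"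
  shows "real (card {x \<in> input_vectors n M. \<not> covers M \<rho> W x})
    \<le> 2 ^ n * (real_of_int M ^ n * (real_of_int M / (real_of_int \<rho> ^ (n - 1) * real_of_int (2 * W + 1)) +
        2 * real_of_int \<rho> / real_of_int (2 * W + 1)))"
proof -
  let ?I = "input_vectors n M"
  define B where "B = real_of_int M ^ n * (real_of_int M / (real_of_int \<rho> ^ (n - 1) * real_of_int (2 * W + 1)) +
        2 * real_of_int \<rho> / real_of_int (2 * W + 1))"
  define E where "E P = (\<Pi>\<^sub>E l\<in>{..<n}. if l = Min P then {1} else {e. \<bar>e\<bar> \<le> \<rho> \<and> odd e = (l \<in> P)})" for P
  define bad where "bad P = {x \<in> ?I. \<forall>e\<in>E P. \<not> win M W (dot e x)}" for P
  have fin: "finite {e. \<bar>e\<bar> \<le> \<rho> \<and> odd e = b}" for b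
    by (rule finite_subset[of _ "{- \<rho>..\<rho>}"]) auto
  have bound: "real (card (bad P)) \<le> B" if P: "P \<subseteq> {..<n}" "P \<noteq> {}" for P
  proof -
    have fP: "finite P" using P(1) finite_subset by blast
    then have i: "Min P \<in> P" using P by simp
    then have i: "Min P < n" "Min P \<in> P" using P by auto
    have fE: "finite (E P)" unfolding E_def using fin by (intro finite_PiE) auto
    have "nat \<rho> ^ (n - 1) \<le> card (E P)"
    proof -
      have "nat \<rho> ^ (n - 1) = (\<Prod>l\<in>{..<n} - {Min P}. nat \<rho>)" using i by simp
      also have "\<dots> \<le> (\<Prod>l\<in>{..<n} - {Min P}. card (if l = Min P then {1} else {e. \<bar>e\<bar> \<le> \<rho> \<and> odd e = (l \<in> P)}))"
        using card_parity[of \<rho>] \<rho> by (intro prod_mono) auto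
      also have "\<dots> = (\<Prod>l\<in>{..<n}. card (if l = Min P then {1} else {e. \<bar>e\<bar> \<le> \<rho> \<and> odd e = (l \<in> P)}))"
        using i by (subst prod.remove[of _ "Min P"]) auto
      also have "\<dots> = card (E P)" unfolding E_def by (subst card_PiE) auto
      finally show ?thesis .
    qed
    then have K: "real_of_int \<rho> ^ (n - 1) \<le> real (card (E P))"
    proof -
      have "real_of_int \<rho> = real (nat \<rho>)" using \<rho> by simp
      then have "real_of_int \<rho> ^ (n - 1) = real (nat \<rho> ^ (n - 1))" by (simp only: of_nat_power)
      also have "\<dots> \<le> real (card (E P))" using \<open>nat \<rho> ^ (n - 1) \<le> card (E P)\<close> by (rule of_nat_mono)
      finally show ?thesis .
    qed
    have Kpos: "0 < real_of_int \<rho> ^ (n - 1)" using \<rho> by simp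
    have ne: "E P \<noteq> {}" using K Kpos by force
    have "real (card (bad P)) \<le> real_of_int M ^ n * (real_of_int M / (real (card (E P)) * real_of_int (2 * W + 1)) +
        2 * real_of_int \<rho> / real_of_int (2 * W + 1))"
      unfolding bad_def
    proof (rule cover_one[OF M i(1) fE ne])
      fix e assume e: "e \<in> E P"
      then have e': "\<And>l. l < n \<Longrightarrow> e l \<in> (if l = Min P then {1} else {e. \<bar>e\<bar> \<le> \<rho> \<and> odd e = (l \<in> P)})"
        using PiE_mem[OF e[unfolded E_def]] by simp
      show "e (Min P) = 1 \<and> (\<forall>l<n. \<bar>e l\<bar> \<le> \<rho>)"
      proof (intro conjI allI impI)
        show "e (Min P) = 1" using e'[OF i(1)] by simp
        fix l assume "l < n" then show "\<bar>e l\<bar> \<le> \<rho>" using e'[of l] \<rho> by (auto split: if_splits)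
      qed
    next
      fix e e' assume ee: "e \<in> E P" "e' \<in> E P" "e \<noteq> e'"
      show "\<exists>l<n. e l \<noteq> e' l"
      proof (rule ccontr)
        assume "\<not> (\<exists>l<n. e l \<noteq> e' l)"
        then have "e = e'" using ee(1,2) unfolding E_def by (intro PiE_ext) auto
        then show False using ee(3) by simp
      qed
    qed
    also have "\<dots> \<le> B"
    proof -
      have L: "0 < real_of_int (2 * W + 1)" using M by simp
      have "real_of_int M / (real (card (E P)) * real_of_int (2 * W + 1)) \<le>
        real_of_int M / (real_of_int \<rho> ^ (n - 1) * real_of_int (2 * W + 1))"
        using K Kpos L M by (intro divide_left_mono mult_right_mono mult_pos_pos) auto
      then show ?thesis unfolding B_def using M by (intro mult_left_mono add_right_mono) auto
    qed
    finally show ?thesis .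
  qed
  have B0: "0 \<le> B" unfolding B_def using M \<rho> by (intro mult_nonneg_nonneg add_nonneg_nonneg) auto
  have sub: "{x \<in> ?I. \<not> covers M \<rho> W x} \<subseteq> (\<Union>P\<in>Pow {..<n} - {{}}. bad P)"
  proof
    fix x assume x: "x \<in> {x \<in> ?I. \<not> covers M \<rho> W x}"
    then have len: "length x = n" by (auto dest: input_vectorsD)
    from x len obtain c where c: "\<And>e. (\<And>i. i < n \<Longrightarrow> \<bar>e i\<bar> \<le> \<rho> \<and> even (c i - e i)) \<Longrightarrow> \<not> win M W (dot e x)"
      unfolding covers_def by blast
    define P where "P = {i. i < n \<and> odd (c i)}"
    have fP: "finite P" by (simp add: P_def)
    \<comment> \<open>The even class is served by the zero vector, whose scalar product 0 lies in
      every window.\<close>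
    have "P \<noteq> {}"
    proof
      assume "P = {}"
      then have "\<And>i. i < n \<Longrightarrow> even (c i)" by (auto simp: P_def)
      then have "\<not> win M W (dot (\<lambda>_. 0) x)" using \<rho> by (intro c) auto
      moreover have "W mod M = W" using M by simp
      ultimately show False using M by (simp add: win_def dot_def)
    qed
    moreover have "x \<in> bad P"
    proof -
      have "\<not> win M W (dot e x)" if "e \<in> E P" for e
      proof (rule c)
        fix l assume l: "l < n"
        then have "e l \<in> (if l = Min P then {1} else {e. \<bar>e\<bar> \<le> \<rho> \<and> odd e = (l \<in> P)})"
          using PiE_mem[OF that[unfolded E_def]] by simp
        moreover have "Min P \<in> P" using \<open>P \<noteq> {}\<close> fP by simp
        ultimately show "\<bar>e l\<bar> \<le> \<rho> \<and> even (c l - e l)"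
          using \<rho> l by (auto simp: P_def split: if_splits)
      qed
      then show ?thesis using x unfolding bad_def by auto
    qed
    ultimately show "x \<in> (\<Union>P\<in>Pow {..<n} - {{}}. bad P)" by (auto simp: P_def)
  qed
  have finb: "finite (bad P)" for P unfolding bad_def by (simp add: finite_input_vectors)
  have "real (card {x \<in> ?I. \<not> covers M \<rho> W x}) \<le> real (card (\<Union>P\<in>Pow {..<n} - {{}}. bad P))"
    using finb by (intro of_nat_mono card_mono[OF _ sub]) auto
  also have "\<dots> \<le> real (\<Sum>P\<in>Pow {..<n} - {{}}. card (bad P))" by (intro of_nat_mono card_UN_le) auto
  also have "\<dots> \<le> (\<Sum>P\<in>Pow {..<n} - {{}}. B)" unfolding of_nat_sum by (intro sum_mono bound) auto
  also have "\<dots> \<le> (\<Sum>P\<in>Pow {..<n}. B)" using B0 by (intro sum_mono2) auto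
  also have "\<dots> = 2 ^ n * B" by (simp add: card_Pow)
  finally show ?thesis unfolding B_def .
qed

subsection \<open>Existence of solutions\<close>

definition vecs :: "int set \<Rightarrow> nat \<Rightarrow> int list set" where
  "vecs A n = {x. set x \<subseteq> A \<and> length x = n}"

lemma input_vectors_vecs: "input_vectors n M = vecs {0..<M} n"
  by (auto simp: input_vectors_def vecs_def)

lemma finite_vecs: "finite A \<Longrightarrow> finite (vecs A n)"
  unfolding vecs_def by (rule finite_lists_length_eq)

lemma card_vecs: "finite A \<Longrightarrow> card (vecs A n) = card A ^ n"
  unfolding vecs_def by (rule card_lists_length_eq)

lemma vecs_0 [simp]: "vecs A 0 = {[]}" by (auto simp: vecs_def)

lemma sum_vecs_append:
  "(\<Sum>x\<in>vecs A (a + b). f x) = (\<Sum>u\<in>vecs A a. \<Sum>v\<in>vecs A b. f (u @ v))"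
  unfolding sum.cartesian_product
  by (rule sum.reindex_bij_witness[where i = "\<lambda>(u, v). u @ v" and j = "\<lambda>x. (take a x, drop a x)"])
    (auto simp: vecs_def dest: in_set_takeD in_set_dropD)

lemma sum_vecs_Suc:
  "(\<Sum>x\<in>vecs A (Suc n). f x) = (\<Sum>a\<in>A. \<Sum>x\<in>vecs A n. f (a # x))"
  unfolding sum.cartesian_product
  by (rule sum.reindex_bij_witness[where i = "\<lambda>(u, v). u # v" and j = "\<lambda>x. (hd x, tl x)"])
    (auto simp: vecs_def length_Suc_conv)

lemma dot_Cons: "dot v (a # x) = v 0 * a + dot (\<lambda>i. v (Suc i)) x"
  by (simp add: dot_def sum.lessThan_Suc_shift del: sum.lessThan_Suc)

lemma dot_nth_append:
  "length u = length x \<Longrightarrow> dot ((!) (u @ v)) (x @ y) = dot ((!) u) x + dot ((!) v) y"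
proof (induction u x rule: list_induct2)
  case (Cons c u a x)
  then show ?case by (simp add: dot_Cons)
qed (simp add: dot_def)

text \<open>The probability of an event under uniform input, written as a quotient of cardinalities
  so that all estimates are finite sums.\<close>

definition ratio :: "int \<Rightarrow> nat \<Rightarrow> (int list \<Rightarrow> bool) \<Rightarrow> real" where
  "ratio M n Q = real (card {x \<in> input_vectors n M. Q x}) / real_of_int M ^ n"

lemma ratio_sum: "0 < M \<Longrightarrow> ratio M n Q = (\<Sum>x\<in>vecs {0..<M} n. of_bool (Q x)) / real_of_int M ^ n"
  unfolding ratio_def by (subst card_of_bool) (auto simp: input_vectors_vecs finite_vecs)

lemma ratio_le_iff: "0 < M \<Longrightarrow> ratio M n Q \<le> \<epsilon> \<longleftrightarrow> (\<Sum>x\<in>vecs {0..<M} n. of_bool (Q x)) \<le> \<epsilon> * real_of_int M ^ n"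
  by (simp add: ratio_sum pos_divide_le_eq)

lemma card_vecs_M: "0 < M \<Longrightarrow> real (card (vecs {0..<M} n)) = real_of_int M ^ n"
  by (simp add: card_vecs)

text \<open>The blocks are independent: once the first block is exposed and is not exceptional, the
  failure bound for the second block applies with the first one held fixed.\<close>

lemma ratio_append:
  assumes M: "0 < M" and A: "ratio M a A \<le> \<alpha>" and \<beta>: "0 \<le> \<beta>"
    and B: "\<And>u. u \<in> input_vectors a M \<Longrightarrow> \<not> A u \<Longrightarrow> ratio M b (\<lambda>v. Q (u @ v)) \<le> \<beta>"
  shows "ratio M (a + b) Q \<le> \<alpha> + \<beta>"
proof -
  let ?V = "vecs {0..<M}" and ?m = "real_of_int M"
  have "(\<Sum>x\<in>?V (a + b). of_bool (Q x)) = (\<Sum>u\<in>?V a. \<Sum>v\<in>?V b. of_bool (Q (u @ v)))"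
    by (rule sum_vecs_append)
  also have "\<dots> \<le> (\<Sum>u\<in>?V a. (of_bool (A u) + \<beta>) * ?m ^ b)"
  proof (rule sum_mono)
    fix u assume u: "u \<in> ?V a"
    show "(\<Sum>v\<in>?V b. of_bool (Q (u @ v))) \<le> (of_bool (A u) + \<beta>) * ?m ^ b"
    proof (cases "A u")
      case True
      have "(\<Sum>v\<in>?V b. of_bool (Q (u @ v))) \<le> (\<Sum>v\<in>?V b. 1 :: real)" by (rule sum_mono) auto
      also have "\<dots> = ?m ^ b" using card_vecs_M[OF M] by simp
      also have "\<dots> \<le> (of_bool (A u) + \<beta>) * ?m ^ b" using True \<beta> M by simp
      finally show ?thesis .
    next
      case False
      then show ?thesis using B[of u] u M by (simp add: ratio_le_iff input_vectors_vecs)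
    qed
  qed
  also have "\<dots> = ((\<Sum>u\<in>?V a. of_bool (A u)) + \<beta> * ?m ^ a) * ?m ^ b"
    using card_vecs_M[OF M, of a] by (simp add: sum_distrib_right[symmetric] sum.distrib)
  also have "\<dots> \<le> (\<alpha> * ?m ^ a + \<beta> * ?m ^ a) * ?m ^ b"
    using A M by (intro mult_right_mono add_right_mono) (auto simp: ratio_le_iff)
  also have "\<dots> = (\<alpha> + \<beta>) * ?m ^ (a + b)" by (simp add: power_add algebra_simps)
  finally show ?thesis using M by (simp add: ratio_le_iff)
qed

lemma ratio_zero: "(\<And>x. x \<in> input_vectors n M \<Longrightarrow> \<not> Q x) \<Longrightarrow> ratio M n Q \<le> 0"
  unfolding ratio_def by (subst card_0_eq[THEN iffD2]) (auto simp: finite_input_vectors)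

lemma ratio_Markov:
  assumes M: "0 < M" and nn: "\<And>x. x \<in> vecs {0..<M} n \<Longrightarrow> 0 \<le> f x"
    and big: "\<And>x. x \<in> vecs {0..<M} n \<Longrightarrow> Q x \<Longrightarrow> \<delta> \<le> f x" and \<delta>: "0 < \<delta>"
    and le: "(\<Sum>x\<in>vecs {0..<M} n. f x) \<le> F * real_of_int M ^ n"
  shows "ratio M n Q \<le> F / \<delta>"
proof -
  have "\<delta> * (\<Sum>x\<in>vecs {0..<M} n. of_bool (Q x)) = (\<Sum>x\<in>vecs {0..<M} n. \<delta> * of_bool (Q x))"
    by (simp add: sum_distrib_left)
  also have "\<dots> \<le> (\<Sum>x\<in>vecs {0..<M} n. f x)" by (intro sum_mono) (use nn big in auto)
  finally have "\<delta> * (\<Sum>x\<in>vecs {0..<M} n. of_bool (Q x)) \<le> F * real_of_int M ^ n" using le by simp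
  then have "(\<Sum>x\<in>vecs {0..<M} n. of_bool (Q x)) \<le> F / \<delta> * real_of_int M ^ n"
    using \<delta> by (simp add: field_simps)
  then show ?thesis using M by (simp only: ratio_le_iff)
qed

text \<open>An exponential moment for the number of entries that are at least M / 4. Such an entry
  weighs (3/4)^4 and any other 1. At most half of all values are below M / 4, so the mean weight is
  at most (1 + 81/256) / 2 = 337/512. A small sum leaves fewer than q / 4 large entries and hence a
  product of at least (3/4)^q; Markov's inequality gives base 337/384.\<close>

lemma ratio_heavy:
  assumes M: "4 \<le> M"
  shows "ratio M q (\<lambda>us. 16 * sum_list us < int q * M) \<le> (9/10) ^ q"
proof -
  define z :: "int \<Rightarrow> real" where "z y = (if M \<le> 4 * y then (3/4) ^ 4 else 1)" for y
  define Z where "Z us = prod_list (map z us)" for us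
  have z1: "(\<Sum>y\<in>{0..<M}. z y) \<le> 337/512 * real_of_int M"
  proof -
    have "(\<Sum>y\<in>{0..<M}. z y) = (\<Sum>y\<in>{0..<M}. (3/4) ^ 4 + (1 - (3/4) ^ 4) * of_bool (4 * y < M))"
      by (intro sum.cong) (auto simp: z_def)
    also have "\<dots> = (3/4) ^ 4 * real_of_int M + (1 - (3/4) ^ 4) * real (card {y \<in> {0..<M}. 4 * y < M})"
      using M by (subst card_of_bool) (simp_all add: sum.distrib sum_distrib_left[symmetric] del: sum_of_bool_eq)
    also have "real (card {y \<in> {0..<M}. 4 * y < M}) \<le> real_of_int M / 2"
    proof -
      have "{y \<in> {0..<M}. 4 * y < M} \<subseteq> {0..<M div 2}" using M by auto
      then have "card {y \<in> {0..<M}. 4 * y < M} \<le> card {0..<M div 2}" by (intro card_mono) auto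
      then have "card {y \<in> {0..<M}. 4 * y < M} \<le> nat (M div 2)" by simp
      then have "int (card {y \<in> {0..<M}. 4 * y < M}) \<le> M div 2" using M by (simp add: le_nat_iff)
      then have "2 * int (card {y \<in> {0..<M}. 4 * y < M}) \<le> M" by linarith
      then show ?thesis by linarith
    qed
    finally show ?thesis by (simp add: field_simps power4_eq_xxxx)
  qed
  have ZS: "(\<Sum>us\<in>vecs {0..<M} n. Z us) \<le> (337/512 * real_of_int M) ^ n" for n
  proof (induction n)
    case (Suc n)
    have "(\<Sum>us\<in>vecs {0..<M} (Suc n). Z us) = (\<Sum>a\<in>{0..<M}. z a) * (\<Sum>us\<in>vecs {0..<M} n. Z us)"
      by (simp add: sum_vecs_Suc Z_def sum_product)
    also have "\<dots> \<le> (337/512 * real_of_int M) * (337/512 * real_of_int M) ^ n"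
      using M by (intro mult_mono z1 Suc) (auto simp: Z_def z_def intro!: sum_nonneg prod_list_nonneg)
    finally show ?case by simp
  qed (simp add: Z_def)
  have big: "(3/4) ^ q \<le> Z us" if us: "us \<in> vecs {0..<M} q" and small: "16 * sum_list us < int q * M" for us
  proof -
    define k where "k = length (filter (\<lambda>y. M \<le> 4 * y) us)"
    have zk: "Z us = (3/4) ^ (4 * k)" unfolding Z_def k_def
      by (induction us) (auto simp: z_def power_add)
    have "int k * M \<le> 4 * sum_list us" if "set us \<subseteq> {0..<M}" "k = length (filter (\<lambda>y. M \<le> 4 * y) us)" for us k
      using that by (induction us arbitrary: k) (auto simp: algebra_simps)
    then have "int k * M \<le> 4 * sum_list us" using us by (auto simp: k_def vecs_def)
    then have "(4 * int k) * M < int q * M" using small by linarith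
    then have "4 * k < q" using M by simp
    then show ?thesis unfolding zk by (intro power_decreasing) auto
  qed
  have "ratio M q (\<lambda>us. 16 * sum_list us < int q * M) \<le> (337/512) ^ q / (3/4) ^ q"
  proof (rule ratio_Markov[where f = Z])
    show "(\<Sum>us\<in>vecs {0..<M} q. Z us) \<le> (337/512) ^ q * real_of_int M ^ q"
      using ZS[of q] by (simp only: power_mult_distrib)
    show "0 \<le> Z us" for us by (auto simp: Z_def z_def intro!: prod_list_nonneg)
  qed (use M big in auto)
  also have "\<dots> = (337/384) ^ q" by (simp add: power_divide[symmetric])
  also have "\<dots> \<le> (9/10) ^ q" by (intro power_mono) auto
  finally show ?thesis .
qed

text \<open>The equation is one over the integers, so a congruence modulo M does not settle it.
  Coefficients -1, 0, 1 move the target towards {0..<M} step by step; steps are shorter than M, so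
  this interval cannot be jumped over from below.\<close>

lemma greedy:
  assumes "0 < M" "set us \<subseteq> {0..<M}" "\<bar>T\<bar> \<le> sum_list us"
  shows "\<exists>u. length u = length us \<and> set u \<subseteq> {-1..1} \<and> 0 \<le> T - dot ((!) u) us \<and> T - dot ((!) u) us < M"
  using assms(2,3)
proof (induction us arbitrary: T)
  case Nil
  then show ?case using assms(1) by (intro exI[of _ "[]"]) (simp add: dot_def)
next
  case (Cons a us)
  show ?case
  proof (cases "0 \<le> T \<and> T < M")
    case True
    have "dot ((!) (replicate k 0)) x = 0" if "length x = k" for k x
      unfolding dot_def using that by (intro sum.neutral) auto
    from this[of "a # us" "length (a # us)"] show ?thesis using True
      by (intro exI[of _ "replicate (length (a # us)) 0"]) (simp add: subset_iff)
  next
    case False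
    define s :: int where "s = (if T < 0 then -1 else 1)"
    have a: "0 \<le> a" "a < M" using Cons.prems by auto
    \<comment> \<open>Either the target approaches 0 by the full amount \<open>a\<close>, and the
      remaining entries suffice for the rest, or a negative target has become nonnegative and is
      below \<open>a\<close>; then all further coefficients are 0.\<close>
    have "\<bar>T - s * a\<bar> \<le> sum_list us \<or> T < 0 \<and> 0 \<le> T + a"
      using Cons.prems(2) False a by (auto simp: s_def)
    then show ?thesis
    proof
      assume "\<bar>T - s * a\<bar> \<le> sum_list us"
      then obtain u where u: "length u = length us" "set u \<subseteq> {-1..1}" "0 \<le> T - s * a - dot ((!) u) us"
        "T - s * a - dot ((!) u) us < M" using Cons.IH[of "T - s * a"] Cons.prems by auto
      then show ?thesis by (intro exI[of _ "s # u"]) (auto simp: dot_Cons s_def)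
    next
      assume T: "T < 0 \<and> 0 \<le> T + a"
      have "dot ((!) (replicate (length us) 0)) us = 0" unfolding dot_def by (intro sum.neutral) auto
      then show ?thesis using T a
        by (intro exI[of _ "(-1) # replicate (length us) 0"]) (auto simp: dot_Cons)
    qed
  qed
qed

section \<open>Growth of the set of reachable targets\<close>

definition grow :: "int \<Rightarrow> int set \<Rightarrow> int \<Rightarrow> int set" where
  "grow M S a = {r \<in> {0..<M}. r \<in> S \<or> r - a \<in> S \<or> r + a \<in> S}"

lemma finite_grow: "finite (grow M S a)"
  by (rule finite_subset[of _ "{0..<M}"]) (auto simp: grow_def)

text \<open>Each s in \<open>S\<close> is reached from \<open>r\<close> by a step of length a = |r -
  s|, which lies in {0..<M}, and a given length a serves at most two elements, r - a and r + a. No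
  reduction modulo M is involved.\<close>

lemma card_reach:
  fixes S :: "int set"
  assumes S: "S \<subseteq> {0..<M}" and r: "r \<in> {0..<M}"
  shows "card S \<le> 2 * card {a \<in> {0..<M}. r - a \<in> S \<or> r + a \<in> S}"
proof -
  let ?R = "{a \<in> {0..<M}. r - a \<in> S \<or> r + a \<in> S}"
  have un: "{s \<in> S. s \<le> r} \<union> {s \<in> S. r \<le> s} = S" by auto
  have "card S \<le> card {s \<in> S. s \<le> r} + card {s \<in> S. r \<le> s}"
    using card_Un_le[of "{s \<in> S. s \<le> r}" "{s \<in> S. r \<le> s}"] unfolding un .
  moreover have fR: "finite ?R" by (rule finite_subset[of _ "{0..<M}"]) auto
  have "card {s \<in> S. s \<le> r} \<le> card ?R"
  proof (rule card_inj_on_le[OF _ _ fR])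
    show "inj_on (\<lambda>s. r - s) {s \<in> S. s \<le> r}" by (simp add: inj_on_def)
    show "(\<lambda>s. r - s) ` {s \<in> S. s \<le> r} \<subseteq> ?R" using S r by force
  qed
  moreover have "card {s \<in> S. r \<le> s} \<le> card ?R"
  proof (rule card_inj_on_le[OF _ _ fR])
    show "inj_on (\<lambda>s. s - r) {s \<in> S. r \<le> s}" by (simp add: inj_on_def)
    show "(\<lambda>s. s - r) ` {s \<in> S. r \<le> s} \<subseteq> ?R" using S r by force
  qed
  ultimately show ?thesis by linarith
qed

text \<open>With s = |S|, a target outside \<open>S\<close> is gained with probability at least s /
  (2 M), so at least (M - s) s / (2 M) new targets are expected. The reciprocal of the size is
  convex, and since the size at most triples it can be bounded by a chord. The factor is 5/6 = 1 -
  1/2 * 1/3.\<close>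

lemma grow_mean:
  assumes M: "0 < M" and S: "S \<subseteq> {0..<M}" "S \<noteq> {}"
  shows "(\<Sum>a\<in>{0..<M}. real_of_int M / real (card (grow M S a)) - 1)
    \<le> real_of_int M * (5/6 * (real_of_int M / real (card S) - 1))"
proof -
  define m where "m = real_of_int M"
  define s where "s = real (card S)"
  define g where "g a = real (card (grow M S a))" for a
  have fS: "finite S" using S by (auto intro: finite_subset[of S "{0..<M}"])
  have sM: "card S \<le> nat M" using card_mono[OF _ S(1)] by simp
  have s: "0 < s" "s \<le> m" using fS S sM M by (auto simp: s_def m_def card_gt_0_iff)
  have ge: "s \<le> g a" for a
  proof -
    have "S \<subseteq> grow M S a" using S by (auto simp: grow_def)
    then show ?thesis unfolding s_def g_def by (intro of_nat_mono card_mono finite_grow)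
  qed
  have le: "g a \<le> 3 * s" for a
  proof -
    have "grow M S a \<subseteq> (S \<union> (\<lambda>s. s + a) ` S) \<union> (\<lambda>s. s - a) ` S" by (auto simp: grow_def image_iff) force+
    then have "card (grow M S a) \<le> card ((S \<union> (\<lambda>s. s + a) ` S) \<union> (\<lambda>s. s - a) ` S)" using fS by (intro card_mono) auto
    also have "\<dots> \<le> card S + card ((\<lambda>s. s + a) ` S) + card ((\<lambda>s. s - a) ` S)"
      by (meson add_mono card_Un_le le_trans order_refl)
    also have "\<dots> \<le> 3 * card S" using card_image_le[OF fS, of "\<lambda>s. s + a"] card_image_le[OF fS, of "\<lambda>s. s - a"] by simp
    finally show ?thesis by (simp add: g_def s_def)
  qed
  text \<open>The chord of \<open>1 / y\<close> over \<open>{s..3 * s}\<close>.\<close>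
  have chord: "m / g a \<le> m / s - m * (g a - s) / (3 * s\<^sup>2)" for a
  proof -
    have "(g a - s) * (3 * s - g a) \<ge> 0" using ge[of a] le[of a] by simp
    then have "1 / g a \<le> 1 / s - (g a - s) / (3 * s\<^sup>2)"
      using ge[of a] s by (simp add: field_simps power2_eq_square)
    then have "m * (1 / g a) \<le> m * (1 / s - (g a - s) / (3 * s\<^sup>2))" using s by (intro mult_left_mono) auto
    then show ?thesis by (simp add: algebra_simps)
  qed
  \<comment> \<open>Counted by targets: members of \<open>S\<close> are kept for all M values of
    \<open>a\<close>, and the others are reached for at least s / 2 of them.\<close>
  have sum_g: "m * s + (m - s) * (s / 2) \<le> (\<Sum>a\<in>{0..<M}. g a)"
  proof -
    have "(\<Sum>a\<in>{0..<M}. g a) = (\<Sum>a\<in>{0..<M}. \<Sum>r\<in>{0..<M}. of_bool (r \<in> S \<or> r - a \<in> S \<or> r + a \<in> S))"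
      unfolding g_def grow_def by (intro sum.cong refl card_of_bool) auto
    also have "\<dots> = (\<Sum>r\<in>{0..<M}. \<Sum>a\<in>{0..<M}. of_bool (r \<in> S \<or> r - a \<in> S \<or> r + a \<in> S))"
      by (rule sum.swap)
    also have "\<dots> \<ge> (\<Sum>r\<in>{0..<M}. s / 2 + (m - s / 2) * of_bool (r \<in> S))"
    proof (rule sum_mono)
      fix r assume r: "r \<in> {0..<M}"
      show "s / 2 + (m - s / 2) * of_bool (r \<in> S) \<le> (\<Sum>a\<in>{0..<M}. of_bool (r \<in> S \<or> r - a \<in> S \<or> r + a \<in> S))"
      proof (cases "r \<in> S")
        case True
        then show ?thesis using M by (simp add: m_def)
      next
        case False
        have "s \<le> 2 * real (card {a \<in> {0..<M}. r - a \<in> S \<or> r + a \<in> S})"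
          using card_reach[OF S(1) r] unfolding s_def by linarith
        also have "real (card {a \<in> {0..<M}. r - a \<in> S \<or> r + a \<in> S}) = (\<Sum>a\<in>{0..<M}. of_bool (r - a \<in> S \<or> r + a \<in> S))"
          by (rule card_of_bool) simp
        finally show ?thesis using False by simp
      qed
    qed
    also have "(\<Sum>r\<in>{0..<M}. s / 2 + (m - s / 2) * of_bool (r \<in> S)) = m * (s / 2) + (m - s / 2) * s"
    proof -
      have "(\<Sum>r\<in>{0..<M}. of_bool (r \<in> S)) = real (card {r \<in> {0..<M}. r \<in> S})" by (rule card_of_bool[symmetric]) simp
      also have "{r \<in> {0..<M}. r \<in> S} = S" using S by auto
      finally show ?thesis using M by (simp add: sum.distrib sum_distrib_left[symmetric] s_def m_def)
    qed
    finally show ?thesis by (simp add: field_simps)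
  qed
  have "(\<Sum>a\<in>{0..<M}. m / g a - 1) \<le> (\<Sum>a\<in>{0..<M}. m / s - m * (g a - s) / (3 * s\<^sup>2) - 1)"
    by (intro sum_mono diff_right_mono chord)
  also have "\<dots> = m * (m / s - 1) - m / (3 * s\<^sup>2) * ((\<Sum>a\<in>{0..<M}. g a) - m * s)"
  proof -
    have "(\<Sum>a\<in>{0..<M}. m / s - m * (g a - s) / (3 * s\<^sup>2) - 1) = (\<Sum>a\<in>{0..<M}. (m / s - 1) - m / (3 * s\<^sup>2) * (g a - s))"
      by (intro sum.cong) auto
    also have "\<dots> = m * (m / s - 1) - m / (3 * s\<^sup>2) * (\<Sum>a\<in>{0..<M}. g a - s)"
      using M unfolding sum_subtractf sum_distrib_left[symmetric] by (simp add: m_def right_diff_distrib)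
    also have "(\<Sum>a\<in>{0..<M}. g a - s) = (\<Sum>a\<in>{0..<M}. g a) - m * s"
      using M by (simp add: sum_subtractf m_def)
    finally show ?thesis .
  qed
  also have "\<dots> \<le> m * (m / s - 1) - m / (3 * s\<^sup>2) * ((m - s) * (s / 2))"
    using sum_g s by (intro diff_left_mono mult_left_mono) auto
  also have "\<dots> = m * (5/6 * (m / s - 1))" using s by (simp add: field_simps power2_eq_square)
  finally show ?thesis unfolding m_def g_def s_def .
qed

definition grows :: "int \<Rightarrow> int set \<Rightarrow> int list \<Rightarrow> int set" where
  "grows M S xs = foldl (grow M) S xs"

lemma grow_subset: "S \<subseteq> {0..<M} \<Longrightarrow> S \<subseteq> grow M S a" "grow M S a \<subseteq> {0..<M}"
  by (auto simp: grow_def)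

lemma grows_subset: "S \<subseteq> {0..<M} \<Longrightarrow> S \<subseteq> grows M S xs \<and> grows M S xs \<subseteq> {0..<M}"
proof (induction xs arbitrary: S)
  case (Cons a xs)
  then show ?case using Cons.IH[OF grow_subset(2)[of M S a]] grow_subset(1)[OF Cons.prems, of a]
    unfolding grows_def foldl_Cons by blast
qed (simp add: grows_def)

lemma grows_repr:
  assumes "y \<in> grows M S xs"
  shows "\<exists>s v. s \<in> S \<and> length v = length xs \<and> set v \<subseteq> {-1..1} \<and> y = s + dot ((!) v) xs"
  using assms
proof (induction xs arbitrary: S)
  case Nil
  then show ?case by (intro exI[of _ y] exI[of _ "[]"]) (simp add: grows_def dot_def)
next
  case (Cons a xs)
  then obtain s v where s: "s \<in> grow M S a" and v: "length v = length xs" "set v \<subseteq> {-1..1}" "y = s + dot ((!) v) xs"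
    unfolding grows_def foldl_Cons by blast
  from s consider "s \<in> S" | "s - a \<in> S" | "s + a \<in> S" by (auto simp: grow_def)
  then show ?case
  proof cases
    case 1 then show ?thesis using v by (intro exI[of _ s] exI[of _ "0 # v"]) (auto simp: dot_Cons)
  next
    case 2 then show ?thesis using v by (intro exI[of _ "s - a"] exI[of _ "1 # v"]) (auto simp: dot_Cons)
  next
    case 3 then show ?thesis using v by (intro exI[of _ "s + a"] exI[of _ "(-1) # v"]) (auto simp: dot_Cons)
  qed
qed

lemma grows_mean:
  assumes M: "0 < M" and S: "S \<subseteq> {0..<M}" "S \<noteq> {}"
  shows "(\<Sum>xs\<in>vecs {0..<M} q. real_of_int M / real (card (grows M S xs)) - 1)
    \<le> (5/6) ^ q * real_of_int M ^ q * (real_of_int M / real (card S) - 1)"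
  using S
proof (induction q arbitrary: S)
  case 0
  then show ?case by (simp add: grows_def)
next
  case (Suc q)
  have "(\<Sum>xs\<in>vecs {0..<M} (Suc q). real_of_int M / real (card (grows M S xs)) - 1)
    = (\<Sum>a\<in>{0..<M}. \<Sum>xs\<in>vecs {0..<M} q. real_of_int M / real (card (grows M (grow M S a) xs)) - 1)"
    by (simp add: sum_vecs_Suc grows_def)
  also have "\<dots> \<le> (\<Sum>a\<in>{0..<M}. (5/6) ^ q * real_of_int M ^ q * (real_of_int M / real (card (grow M S a)) - 1))"
    by (intro sum_mono Suc.IH) (use grow_subset Suc.prems in blast)+
  also have "\<dots> = (5/6) ^ q * real_of_int M ^ q * (\<Sum>a\<in>{0..<M}. real_of_int M / real (card (grow M S a)) - 1)"
    by (simp add: sum_distrib_left)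
  also have "\<dots> \<le> (5/6) ^ q * real_of_int M ^ q * (real_of_int M * (5/6 * (real_of_int M / real (card S) - 1)))"
    using M by (intro mult_left_mono grow_mean Suc.prems) auto
  finally show ?case by (simp add: algebra_simps)
qed

text \<open>Fewer than M / 2 targets means that M / |S| - 1 is at least 1, so Markov's inequality
  applies to its mean.\<close>

lemma ratio_grows:
  assumes M: "0 < M" and S: "S \<subseteq> {0..<M}" "S \<noteq> {}"
  shows "ratio M q (\<lambda>gs. 2 * int (card (grows M S gs)) < M) \<le> (5/6) ^ q * (real_of_int M / real (card S))"
proof -
  let ?f = "\<lambda>gs. real_of_int M / real (card (grows M S gs)) - 1"
  have c: "0 < card (grows M S gs)" "int (card (grows M S gs)) \<le> M" for gs
  proof -
    have f: "finite (grows M S gs)" using grows_subset[OF S(1), of gs] by (auto intro: finite_subset[of _ "{0..<M}"])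
    then show "0 < card (grows M S gs)" using grows_subset[OF S(1), of gs] S(2) by (auto simp: card_gt_0_iff)
    have "card (grows M S gs) \<le> card {0..<M}" using grows_subset[OF S(1), of gs] by (intro card_mono) auto
    then show "int (card (grows M S gs)) \<le> M" using M by simp
  qed
  have "ratio M q (\<lambda>gs. 2 * int (card (grows M S gs)) < M) \<le> ((5/6) ^ q * (real_of_int M / real (card S) - 1)) / 1"
  proof (rule ratio_Markov[OF M, where f = ?f])
    fix gs
    have "real (card (grows M S gs)) \<le> real_of_int M" using c(2)[of gs] by linarith
    then show "0 \<le> ?f gs" using c(1)[of gs] by (simp add: field_simps)
    assume "2 * int (card (grows M S gs)) < M"
    then have "2 * real (card (grows M S gs)) \<le> real_of_int M" by linarith
    then show "1 \<le> ?f gs" using c(1)[of gs] by (simp add: field_simps)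
  next
    show "(\<Sum>gs\<in>vecs {0..<M} q. ?f gs) \<le> (5/6) ^ q * (real_of_int M / real (card S) - 1) * real_of_int M ^ q"
      using grows_mean[OF M S, of q] by (simp add: algebra_simps)
  qed simp
  also have "\<dots> \<le> (5/6) ^ q * (real_of_int M / real (card S))" by (simp add: algebra_simps)
  finally show ?thesis .
qed

text \<open>At least M / 2 targets leave at least M / 4 useful step lengths for \<open>r\<close>, so
  each entry misses with probability at most 3/4. The point \<open>r\<close> is fixed before these
  entries are drawn.\<close>

lemma ratio_miss:
  assumes M: "0 < M" and S: "S \<subseteq> {0..<M}" "M \<le> 2 * int (card S)" and r: "r \<in> {0..<M}"
  shows "ratio M q (\<lambda>hs. \<forall>a\<in>set hs. r - a \<notin> S \<and> r + a \<notin> S) \<le> (3/4) ^ q"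
proof -
  let ?B = "{a \<in> {0..<M}. r - a \<notin> S \<and> r + a \<notin> S}"
  have "{x \<in> input_vectors q M. \<forall>a\<in>set x. r - a \<notin> S \<and> r + a \<notin> S} = vecs ?B q"
    by (auto simp: input_vectors_vecs vecs_def)
  moreover have "real (card ?B) \<le> 3/4 * real_of_int M"
  proof -
    let ?R = "{a \<in> {0..<M}. r - a \<in> S \<or> r + a \<in> S}"
    have eq: "?B = {0..<M} - ?R" by auto
    have "card ({0..<M} - ?R) = card {0..<M} - card ?R"
      by (rule card_Diff_subset) (auto intro: finite_subset[of _ "{0..<M}"])
    then have "card ?B = nat M - card ?R" unfolding eq by simp
    moreover have "M \<le> 4 * int (card ?R)" using card_reach[OF S(1) r] S(2) by linarith
    ultimately have "4 * int (card ?B) \<le> 3 * M" using M by linarith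
    then show ?thesis by linarith
  qed
  then have "real (card ?B) ^ q \<le> (3/4 * real_of_int M) ^ q" by (intro power_mono) auto
  moreover have "card (vecs ?B q) = card ?B ^ q"
    by (rule card_vecs) (auto intro: finite_subset[of _ "{0..<M}"])
  ultimately show ?thesis using M
    unfolding ratio_def by (simp only: pos_divide_le_eq zero_less_power of_int_0_less_iff power_mult_distrib of_nat_power)
qed

definition solvable :: "int set \<Rightarrow> int \<Rightarrow> int list \<Rightarrow> bool" where
  "solvable C \<tau> x \<longleftrightarrow> (\<exists>c. is_solution C x \<tau> c)"

lemma is_solution_dot: "is_solution C x \<tau> c \<longleftrightarrow> length c = length x \<and> set c \<subseteq> C \<and> dot ((!) c) x = \<tau>"
  by (simp add: is_solution_def dot_def)

section \<open>Distinct values of the first block\<close>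

lemma sum_symmetric: "(\<Sum>a\<in>{- D..D}. a) = (0::int)"
proof -
  have "(\<Sum>a\<in>{- D..D}. a) = (\<Sum>a\<in>{- D..D}. - a)"
    by (rule sum.reindex_bij_witness[where i = uminus and j = uminus]) auto
  then show ?thesis by (simp add: sum_negf)
qed

text \<open>For fixed \<open>x\<close> the coefficients are independent and symmetric, so mean
  values vanish and second moments add up. Typical values are thus of order sqrt(k) D M, which
  limits the quotients by M that can occur.\<close>

lemma sum_dot_square:
  fixes D :: int
  assumes D: "0 \<le> D" and x: "\<And>a. a \<in> set x \<Longrightarrow> \<bar>a\<bar> \<le> M"
  shows "(\<Sum>e\<in>vecs {- D..D} (length x). dot ((!) e) x) = 0 \<and>
    (\<Sum>e\<in>vecs {- D..D} (length x). (dot ((!) e) x)\<^sup>2) \<le> (2 * D + 1) ^ length x * int (length x) * (D\<^sup>2 * M\<^sup>2)"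
  using x
proof (induction x)
  case Nil
  then show ?case by (simp add: dot_def)
next
  case (Cons y x)
  define k where "k = length x"
  define S where "S = (\<Sum>e\<in>vecs {- D..D} k. (dot ((!) e) x)\<^sup>2)"
  define K where "K = (2 * D + 1) ^ k"
  have IH: "(\<Sum>e\<in>vecs {- D..D} k. dot ((!) e) x) = 0" "S \<le> K * int k * (D\<^sup>2 * M\<^sup>2)"
    using Cons unfolding k_def S_def K_def by auto
  have cK: "int (card (vecs {- D..D} k)) = K" using D by (simp add: card_vecs K_def)
  have eq: "dot ((!) (a # e)) (y # x) = a * y + dot ((!) e) x" for a e by (simp add: dot_Cons)
  have "(\<Sum>e\<in>vecs {- D..D} (Suc k). dot ((!) e) (y # x)) = (\<Sum>a\<in>{- D..D}. K * (a * y))"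
    unfolding sum_vecs_Suc eq sum.distrib IH using cK by (simp add: mult.commute)
  also have "\<dots> = K * y * (\<Sum>a\<in>{- D..D}. a)" by (simp add: sum_distrib_left mult.commute mult.left_commute)
  finally have 1: "(\<Sum>e\<in>vecs {- D..D} (Suc k). dot ((!) e) (y # x)) = 0" by (simp add: sum_symmetric)
  have "(\<Sum>e\<in>vecs {- D..D} (Suc k). (dot ((!) e) (y # x))\<^sup>2) =
    (\<Sum>a\<in>{- D..D}. \<Sum>e\<in>vecs {- D..D} k. (a * y)\<^sup>2 + 2 * (a * y) * dot ((!) e) x + (dot ((!) e) x)\<^sup>2)"
    unfolding sum_vecs_Suc eq by (intro sum.cong refl) (simp add: power2_sum)
  also have "\<dots> = (\<Sum>a\<in>{- D..D}. K * (a * y)\<^sup>2 + S)"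
  proof (rule sum.cong[OF refl])
    fix a
    have "(\<Sum>e\<in>vecs {- D..D} k. 2 * (a * y) * dot ((!) e) x) = 0"
      using IH(1) by (simp flip: sum_distrib_left)
    then show "(\<Sum>e\<in>vecs {- D..D} k. (a * y)\<^sup>2 + 2 * (a * y) * dot ((!) e) x + (dot ((!) e) x)\<^sup>2) = K * (a * y)\<^sup>2 + S"
      unfolding sum.distrib S_def using cK by simp
  qed
  also have "\<dots> \<le> (\<Sum>a\<in>{- D..D}. K * (D\<^sup>2 * M\<^sup>2) + K * int k * (D\<^sup>2 * M\<^sup>2))"
  proof (intro sum_mono add_mono mult_left_mono IH)
    fix a assume "a \<in> {- D..D}"
    then have "\<bar>a\<bar> \<le> D" "\<bar>y\<bar> \<le> M" using Cons.prems by auto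
    then show "(a * y)\<^sup>2 \<le> D\<^sup>2 * M\<^sup>2" unfolding power_mult_distrib
      by (intro mult_mono) (auto simp: abs_le_square_iff[symmetric])
  qed (use D in \<open>simp add: K_def\<close>)
  also have "\<dots> = (2 * D + 1) * (K * (D\<^sup>2 * M\<^sup>2) + K * int k * (D\<^sup>2 * M\<^sup>2))" using D by simp
  also have "\<dots> = (2 * D + 1) ^ Suc k * int (Suc k) * (D\<^sup>2 * M\<^sup>2)" by (simp add: K_def algebra_simps)
  finally show ?case using 1 by (simp add: k_def)
qed

definition collisions :: "int \<Rightarrow> int list \<Rightarrow> (int list \<times> int list) set" where
  "collisions D x = {(e, e') \<in> vecs {- D..D} (length x) \<times> vecs {- D..D} (length x).
     e \<noteq> e' \<and> dot ((!) e) x = dot ((!) e') x}"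

lemma finite_collisions: "finite (collisions D x)"
  unfolding collisions_def
  by (rule finite_subset[of _ "vecs {- D..D} (length x) \<times> vecs {- D..D} (length x)"]) (auto simp: finite_vecs)

text \<open>Each of the K^2 pairs collides with probability at most 1 / M, and Markov's inequality
  is applied at the threshold K / 4, where K = (2 D + 1)^k.\<close>

lemma ratio_collisions:
  assumes M: "0 < M" and D: "0 \<le> D"
  shows "ratio M k (\<lambda>x. (2 * D + 1) ^ k \<le> 4 * int (card (collisions D x))) \<le> 4 * real_of_int (2 * D + 1) ^ k / real_of_int M"
proof -
  let ?E = "vecs {- D..D} k" and ?V = "vecs {0..<M} k" and ?m = "real_of_int M"
  define K where "K = real_of_int (2 * D + 1) ^ k"
  have K: "0 < K" using D by (simp add: K_def)
  have cE: "real (card ?E) = K" using D by (simp add: card_vecs K_def)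
  have pair: "(\<Sum>x\<in>?V. of_bool (e \<noteq> e' \<and> dot ((!) e) x = dot ((!) e') x)) \<le> ?m ^ k / ?m"
    if e: "e \<in> ?E" "e' \<in> ?E" for e e'
  proof (cases "e = e'")
    case True
    then show ?thesis using M by simp
  next
    case False
    define c where "c i = e ! i - e' ! i" for i
    from False e obtain i where i: "i < k" "e ! i \<noteq> e' ! i" using nth_equalityI[of e e'] by (auto simp: vecs_def)
    have "real (card {x \<in> input_vectors k M. dot c x = 0}) * ?m \<le> ?m ^ k"
      by (rule card_dot_eq[OF M i(1)]) (use i in \<open>simp add: c_def\<close>)
    moreover have "dot c x = 0 \<longleftrightarrow> dot ((!) e) x = dot ((!) e') x" for x
      unfolding dot_def c_def by (simp add: sum_subtractf left_diff_distrib)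
    ultimately have "(\<Sum>x\<in>?V. of_bool (dot ((!) e) x = dot ((!) e') x)) * ?m \<le> ?m ^ k"
      unfolding input_vectors_vecs by (subst card_of_bool[symmetric]) (simp_all add: finite_vecs)
    then show ?thesis using M False by (simp add: pos_le_divide_eq)
  qed
  have "ratio M k (\<lambda>x. (2 * D + 1) ^ k \<le> 4 * int (card (collisions D x))) \<le> (K * K / ?m) / (K / 4)"
  proof (rule ratio_Markov[OF M, where f = "\<lambda>x. real (card (collisions D x))"])
    show "(2 * D + 1) ^ k \<le> 4 * int (card (collisions D x)) \<Longrightarrow> K / 4 \<le> real (card (collisions D x))" for x
      unfolding K_def using of_int_le_iff[of "(2 * D + 1) ^ k" "4 * int (card (collisions D x))", where 'a = real] by simp
    have "(\<Sum>x\<in>?V. real (card (collisions D x))) =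
      (\<Sum>x\<in>?V. \<Sum>p\<in>?E \<times> ?E. of_bool (fst p \<noteq> snd p \<and> dot ((!) (fst p)) x = dot ((!) (snd p)) x))"
    proof (rule sum.cong[OF refl])
      fix x assume "x \<in> ?V"
      then have "collisions D x = {p \<in> ?E \<times> ?E. fst p \<noteq> snd p \<and> dot ((!) (fst p)) x = dot ((!) (snd p)) x}"
        by (auto simp: collisions_def vecs_def)
      then show "real (card (collisions D x)) =
        (\<Sum>p\<in>?E \<times> ?E. of_bool (fst p \<noteq> snd p \<and> dot ((!) (fst p)) x = dot ((!) (snd p)) x))"
        by (simp only:) (rule card_of_bool, simp add: finite_vecs)
    qed
    also have "\<dots> = (\<Sum>p\<in>?E \<times> ?E. \<Sum>x\<in>?V. of_bool (fst p \<noteq> snd p \<and> dot ((!) (fst p)) x = dot ((!) (snd p)) x))"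
      by (rule sum.swap)
    also have "\<dots> \<le> (\<Sum>p\<in>?E \<times> ?E. ?m ^ k / ?m)" by (intro sum_mono pair) auto
    also have "\<dots> = K * K / ?m * ?m ^ k" by (simp add: card_cartesian_product cE)
    finally show "(\<Sum>x\<in>?V. real (card (collisions D x))) \<le> K * K / ?m * ?m ^ k" .
  qed (use K in auto)
  also have "\<dots> = 4 * K / ?m" using K by (simp add: field_simps)
  finally show ?thesis by (simp add: K_def)
qed

text \<open>Of the K coefficient vectors at most K / 2 have a value beyond b M and fewer than K / 4
  collide, so K / 4 distinct values remain. They have at most 2 b + 1 quotients by M; fixing the
  most frequent quotient j turns them into distinct residues without leaving the integers.\<close>

lemma spread_values:
  fixes D :: int
  assumes M: "0 < M" and D: "0 \<le> D" and x: "x \<in> vecs {0..<M} k"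
    and coll: "4 * int (card (collisions D x)) < (2 * D + 1) ^ k" and b: "1 \<le> b" "2 * int k * D\<^sup>2 \<le> b\<^sup>2"
  shows "\<exists>j S. \<bar>j\<bar> \<le> b \<and> S \<subseteq> {0..<M} \<and> (2 * D + 1) ^ k \<le> 4 * (2 * b + 1) * int (card S) \<and>
    (\<forall>s\<in>S. \<exists>e\<in>vecs {- D..D} k. dot ((!) e) x = j * M + s)"
proof -
  let ?E = "vecs {- D..D} k" and ?f = "\<lambda>e. dot ((!) e) x"
  define K where "K = (2 * D + 1) ^ k"
  have len: "length x = k" and xM: "\<And>a. a \<in> set x \<Longrightarrow> \<bar>a\<bar> \<le> M" using x by (auto simp: vecs_def subset_iff)
  have cE: "int (card ?E) = K" using D by (simp add: card_vecs K_def)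
  have fE: "finite ?E" by (simp add: finite_vecs)
  define Far where "Far = {e \<in> ?E. b * M < \<bar>?f e\<bar>}"
  define Col where "Col = {e \<in> ?E. \<exists>e'\<in>?E. e' \<noteq> e \<and> ?f e' = ?f e}"
  define G where "G = ?E - Far - Col"
  \<comment> \<open>Chebyshev by counting: a far vector contributes at least (b M)^2 to a total of
    at most K k D^2 M^2, and 2 k D^2 \<le> b^2.\<close>
  have far: "2 * int (card Far) \<le> K"
  proof -
    have "int (card Far) * (b * M)\<^sup>2 = (\<Sum>e\<in>Far. (b * M)\<^sup>2)" by simp
    also have "\<dots> \<le> (\<Sum>e\<in>Far. (?f e)\<^sup>2)"
    proof (rule sum_mono)
      fix e assume "e \<in> Far"
      then have "\<bar>b * M\<bar> \<le> \<bar>?f e\<bar>" using M b by (auto simp: Far_def)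
      then show "(b * M)\<^sup>2 \<le> (?f e)\<^sup>2" by (simp only: abs_le_square_iff)
    qed
    also have "\<dots> \<le> (\<Sum>e\<in>?E. (?f e)\<^sup>2)" by (rule sum_mono2) (auto simp: Far_def fE)
    also have "\<dots> \<le> K * int k * (D\<^sup>2 * M\<^sup>2)" using conjunct2[OF sum_dot_square[of D x M, OF D xM]]
      by (simp add: len K_def)
    finally have "2 * (int (card Far) * (b * M)\<^sup>2) \<le> K * (2 * int k * D\<^sup>2) * M\<^sup>2" by (simp add: algebra_simps)
    also have "\<dots> \<le> K * b\<^sup>2 * M\<^sup>2" using b D by (intro mult_right_mono mult_left_mono) (auto simp: K_def)
    finally have "(2 * int (card Far)) * (b\<^sup>2 * M\<^sup>2) \<le> K * (b\<^sup>2 * M\<^sup>2)" by (simp add: power_mult_distrib algebra_simps)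
    moreover have "0 < b\<^sup>2 * M\<^sup>2" using b M by simp
    ultimately show ?thesis by (simp only: mult_le_cancel_right_pos)
  qed
  have col: "card Col \<le> card (collisions D x)"
  proof -
    have "Col \<subseteq> fst ` collisions D x"
    proof
      fix e assume "e \<in> Col"
      then obtain e' where "e \<in> ?E" "e' \<in> ?E" "e' \<noteq> e" "?f e' = ?f e" by (auto simp: Col_def)
      then have "(e, e') \<in> collisions D x" by (auto simp: collisions_def len)
      then show "e \<in> fst ` collisions D x" by force
    qed
    then show ?thesis using surj_card_le[OF finite_collisions] by blast
  qed
  have "?E = G \<union> (Far \<union> Col)" by (auto simp: G_def Far_def Col_def)
  then have "card ?E \<le> card G + card (Far \<union> Col)" using card_Un_le[of G "Far \<union> Col"] by simp
  also have "\<dots> \<le> card G + (card Far + card Col)" using card_Un_le[of Far Col] by simp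
  finally have "K \<le> int (card G) + int (card Far) + int (card Col)" using cE by linarith
  then have G: "K \<le> 4 * int (card G)" using far col coll unfolding K_def[symmetric] by linarith
  have inj: "inj_on ?f G" unfolding inj_on_def G_def Col_def by blast
  have range: "?f e div M \<in> {- b..b}" if "e \<in> G" for e
  proof -
    have "\<bar>?f e\<bar> \<le> b * M" using that by (auto simp: G_def Far_def)
    then have *: "- (b * M) \<le> ?f e" "?f e \<le> b * M" by auto
    have "(- (b * M)) div M \<le> ?f e div M" by (rule zdiv_mono1[OF *(1) M])
    moreover have "?f e div M \<le> (b * M) div M" by (rule zdiv_mono1[OF *(2) M])
    moreover have "(- (b * M)) div M = - b" using M nonzero_mult_div_cancel_right[of M "- b"] by simp
    ultimately show ?thesis using M by simp
  qed
  \<comment> \<open>The pigeonhole principle over the quotients.\<close>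
  have "\<exists>j\<in>{- b..b}. int (card G) \<le> (2 * b + 1) * int (card {e \<in> G. ?f e div M = j})"
  proof (rule ccontr)
    assume "\<not> ?thesis"
    then have lt: "\<And>j. j \<in> {- b..b} \<Longrightarrow> (2 * b + 1) * int (card {e \<in> G. ?f e div M = j}) < int (card G)" by force
    have un: "(\<Union>j\<in>{- b..b}. {e \<in> G. ?f e div M = j}) = G" using range by auto
    have "card G \<le> (\<Sum>j\<in>{- b..b}. card {e \<in> G. ?f e div M = j})"
      using card_UN_le[of "{- b..b}" "\<lambda>j. {e \<in> G. ?f e div M = j}"] unfolding un by simp
    then have "int (card G) \<le> (\<Sum>j\<in>{- b..b}. int (card {e \<in> G. ?f e div M = j}))"
      by (simp only: of_nat_sum[symmetric] of_nat_le_iff)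
    then have "(2 * b + 1) * int (card G) \<le> (\<Sum>j\<in>{- b..b}. (2 * b + 1) * int (card {e \<in> G. ?f e div M = j}))"
      unfolding sum_distrib_left[symmetric] using b by (intro mult_left_mono) auto
    also have "\<dots> < (\<Sum>j\<in>{- b..b}. int (card G))" using b by (intro sum_strict_mono lt) auto
    also have "\<dots> = (2 * b + 1) * int (card G)" using b by simp
    finally show False by simp
  qed
  then obtain j where j: "j \<in> {- b..b}" "int (card G) \<le> (2 * b + 1) * int (card {e \<in> G. ?f e div M = j})" by blast
  define S where "S = (\<lambda>e. ?f e mod M) ` {e \<in> G. ?f e div M = j}"
  have "inj_on (\<lambda>e. ?f e mod M) {e \<in> G. ?f e div M = j}"
  proof (rule inj_onI)
    fix e e' assume *: "e \<in> {e \<in> G. ?f e div M = j}" "e' \<in> {e \<in> G. ?f e div M = j}" "?f e mod M = ?f e' mod M"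
    then have "?f e = ?f e'" by (metis (mono_tags, lifting) div_mult_mod_eq mem_Collect_eq)
    then show "e = e'" using inj * by (auto dest: inj_onD)
  qed
  then have cS: "card S = card {e \<in> G. ?f e div M = j}" by (simp add: S_def card_image)
  have "K \<le> 4 * ((2 * b + 1) * int (card S))" using G j(2) unfolding cS by linarith
  then have "K \<le> 4 * (2 * b + 1) * int (card S)" by (simp only: mult.assoc)
  moreover have "S \<subseteq> {0..<M}" using M by (auto simp: S_def)
  moreover have "\<exists>e\<in>?E. ?f e = j * M + s" if "s \<in> S" for s
  proof -
    from that obtain e where e: "e \<in> G" "?f e div M = j" "s = ?f e mod M" by (auto simp: S_def)
    then have "?f e = j * M + s" by (metis div_mult_mod_eq)
    then show ?thesis using e by (auto simp: G_def)
  qed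
  moreover have "\<bar>j\<bar> \<le> b" using j by auto
  ultimately show ?thesis unfolding K_def by blast
qed

text \<open>The blocks are exposed in an order in which each meets fixed data: the first gives j and
  S, the second moves the remaining target greedily to some r in {0..<M}, the third lets S grow past
  M / 2, and one entry of the fourth links r to the enlarged set. The last m coordinates get
  coefficient 0.\<close>

lemma solvable_blocks:
  fixes D :: int
  assumes M: "4 \<le> M" and D: "1 \<le> D" and b: "1 \<le> b" "2 * int k * D\<^sup>2 \<le> b\<^sup>2"
    and \<tau>: "16 * (\<bar>\<tau>\<bar> + b * M) \<le> int q * M"
  shows "ratio M (k + (q + (q + (q + m)))) (\<lambda>x. \<not> solvable {- D..D} \<tau> x)
    \<le> 4 * real_of_int (2 * D + 1) ^ k / real_of_int M + ((9/10) ^ q +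
       ((5/6) ^ q * (4 * (2 * real_of_int b + 1) * real_of_int M / real_of_int (2 * D + 1) ^ k) + ((3/4) ^ q + 0)))"
    (is "_ \<le> ?\<alpha> + (_ + (?\<gamma> + _))")
proof -
  have M0: "0 < M" using M by simp
  let ?Q = "\<lambda>x. \<not> solvable {- D..D} \<tau> x"
  have \<gamma>: "0 \<le> ?\<gamma>" using b M D by (intro mult_nonneg_nonneg divide_nonneg_nonneg) auto
  show ?thesis
  proof (rule ratio_append[OF M0 ratio_collisions[OF M0, of D k]])
    show "0 \<le> D" using D by simp
    show "0 \<le> (9/10) ^ q + (?\<gamma> + ((3/4) ^ q + 0))" using \<gamma> by simp
    fix xs assume xs: "xs \<in> input_vectors k M" and "\<not> (2 * D + 1) ^ k \<le> 4 * int (card (collisions D xs))"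
    then obtain j S where j: "\<bar>j\<bar> \<le> b" and S: "S \<subseteq> {0..<M}" "(2 * D + 1) ^ k \<le> 4 * (2 * b + 1) * int (card S)"
      "\<And>s. s \<in> S \<Longrightarrow> \<exists>e\<in>vecs {- D..D} k. dot ((!) e) xs = j * M + s"
      using spread_values[OF M0 _ _ _ b, of xs] D by (auto simp: input_vectors_vecs not_le)
    have "0 < (2 * D + 1) ^ k" using D by simp
    then have "card S \<noteq> 0" using S(2) by (intro notI) simp
    then have Sne: "S \<noteq> {}" and cS: "0 < card S" by auto
    show "ratio M (q + (q + (q + m))) (\<lambda>v. ?Q (xs @ v)) \<le> (9/10) ^ q + (?\<gamma> + ((3/4) ^ q + 0))"
    proof (rule ratio_append[OF M0 ratio_heavy[OF M]])
      show "0 \<le> ?\<gamma> + ((3/4) ^ q + 0)" using \<gamma> by simp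
      fix us assume us: "us \<in> input_vectors q M" and heavy: "\<not> 16 * sum_list us < int q * M"
      have "\<bar>j * M\<bar> \<le> b * M" using j M by (simp add: abs_mult)
      moreover have "\<bar>\<tau> - j * M\<bar> \<le> \<bar>\<tau>\<bar> + \<bar>j * M\<bar>" by (rule abs_triangle_ineq4)
      moreover have "int q * M \<le> 16 * sum_list us" using heavy by simp
      moreover have "16 * \<bar>\<tau>\<bar> + 16 * (b * M) \<le> int q * M" using \<tau> by (simp only: distrib_left)
      ultimately have "\<bar>\<tau> - j * M\<bar> \<le> sum_list us"
        by smt
      then obtain u where u: "length u = length us" "set u \<subseteq> {-1..1}"
        "0 \<le> \<tau> - j * M - dot ((!) u) us" "\<tau> - j * M - dot ((!) u) us < M"
        using greedy[OF M0, of us "\<tau> - j * M"] us by (auto simp: input_vectors_vecs vecs_def)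
      define r where "r = \<tau> - j * M - dot ((!) u) us"
      have r: "r \<in> {0..<M}" using u by (simp add: r_def)
      show "ratio M (q + (q + m)) (\<lambda>v. ?Q (xs @ us @ v)) \<le> ?\<gamma> + ((3/4) ^ q + 0)"
      proof (rule ratio_append[OF M0])
        have "real_of_int ((2 * D + 1) ^ k) \<le> real_of_int (4 * (2 * b + 1) * int (card S))"
          using S(2) by (simp only: of_int_le_iff)
        then have "real_of_int (2 * D + 1) ^ k \<le> 4 * (2 * real_of_int b + 1) * real (card S)" by simp
        moreover define P where "P = real_of_int (2 * D + 1) ^ k"
        ultimately have "real_of_int M * P \<le> real_of_int M * (4 * (2 * real_of_int b + 1) * real (card S))"
          using M by (intro mult_left_mono) auto
        moreover have "0 < P" using D by (simp add: P_def)
        ultimately have "real_of_int M / real (card S) \<le> 4 * (2 * real_of_int b + 1) * real_of_int M / P"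
          using cS by (simp add: field_simps)
        then have "real_of_int M / real (card S) \<le> 4 * (2 * real_of_int b + 1) * real_of_int M / real_of_int (2 * D + 1) ^ k"
          by (simp only: P_def)
        then show "ratio M q (\<lambda>gs. 2 * int (card (grows M S gs)) < M) \<le> ?\<gamma>"
          by (intro order_trans[OF ratio_grows[OF M0 S(1) Sne, of q]] mult_left_mono) auto
        show "0 \<le> (3/4) ^ q + (0::real)" by simp
        fix gs assume gs: "gs \<in> input_vectors q M" and big: "\<not> 2 * int (card (grows M S gs)) < M"
        let ?S = "grows M S gs"
        show "ratio M (q + m) (\<lambda>v. ?Q (xs @ us @ gs @ v)) \<le> (3/4) ^ q + 0"
        proof (rule ratio_append[OF M0 ratio_miss[OF M0 _ _ r]])
          show "?S \<subseteq> {0..<M}" using grows_subset[OF S(1)] by blast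
          show "M \<le> 2 * int (card ?S)" using big by simp
          fix hs assume hs: "hs \<in> input_vectors q M" and "\<not> (\<forall>a\<in>set hs. r - a \<notin> ?S \<and> r + a \<notin> ?S)"
          then obtain i s where i: "i < q" "r - s * hs ! i \<in> ?S" "s = 1 \<or> s = -1"
          proof -
            assume *: "\<And>i s. i < q \<Longrightarrow> r - s * hs ! i \<in> ?S \<Longrightarrow> s = 1 \<or> s = -1 \<Longrightarrow> thesis"
            from \<open>\<not> (\<forall>a\<in>set hs. r - a \<notin> ?S \<and> r + a \<notin> ?S)\<close> obtain i where "i < length hs"
              "r - hs ! i \<in> ?S \<or> r + hs ! i \<in> ?S" by (auto simp: in_set_conv_nth)
            then show thesis using *[of i 1] *[of i "-1"] input_vectorsD(1)[OF hs] by auto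
          qed
          from grows_repr[OF i(2)] obtain t v where v: "t \<in> S" "length v = length gs" "set v \<subseteq> {-1..1}"
            "r - s * hs ! i = t + dot ((!) v) gs" by blast
          from S(3)[OF v(1)] obtain e where e: "e \<in> vecs {- D..D} k" "dot ((!) e) xs = j * M + t" by blast
          \<comment> \<open>A single entry of this block is used, with sign s.\<close>
          define h where "h = (replicate q 0)[i := s]"
          have h: "length h = q" "set h \<subseteq> {-1..1}" using i(1,3) set_update_subset_insert[of "replicate q 0" i s]
            by (auto simp: h_def)
          have lens: "length xs = k" "length us = q" "length gs = q" "length hs = q" "length e = k"
            using xs us gs hs e by (auto dest: input_vectorsD(1) simp: vecs_def)
          have "(\<Sum>l<q. h ! l * hs ! l) = (\<Sum>l<q. if l = i then s * hs ! i else 0)"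
            using i(1) by (intro sum.cong) (auto simp: h_def nth_list_update)
          then have dh: "dot ((!) h) hs = s * hs ! i" unfolding dot_def using i(1) lens by simp
          show "ratio M m (\<lambda>w. ?Q (xs @ us @ gs @ hs @ w)) \<le> 0"
          proof (rule ratio_zero, unfold not_not)
            fix w assume "w \<in> input_vectors m M"
            then have w: "length w = m" by (rule input_vectorsD(1))
            define c where "c = e @ u @ v @ h @ replicate m (0::int)"
            have "dot ((!) (replicate m 0)) w = 0" unfolding dot_def using w by (intro sum.neutral) auto
            then have "dot ((!) c) (xs @ us @ gs @ hs @ w) = \<tau>"
              unfolding c_def using lens u(1) v(2) h(1) w
              by (simp add: dot_nth_append e(2) dh) (use v(4) r_def in linarith)
            moreover have "set c \<subseteq> {- D..D}"
              using e(1) u(2) v(3) h(2) D unfolding c_def vecs_def by (auto simp: subset_iff)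
            ultimately have "is_solution {- D..D} (xs @ us @ gs @ hs @ w) \<tau> c"
              unfolding is_solution_dot c_def using lens u(1) v(2) h(1) w by simp
            then show "solvable {- D..D} \<tau> (xs @ us @ gs @ hs @ w)" unfolding solvable_def by blast
          qed
        qed simp
      qed
    qed
  qed
qed

text \<open>The free choice is the length k of the first block. With \<beta> = 2 D + 1, the number
  \<beta>^k has to be smaller than M by an exponential factor to make collisions rare, but only by
  one that the growth can make up. Keeping it within a factor \<beta> of M / (11/10)^q leaves
  (10/11)^q for the collisions and (5/6 * 11/10)^q = (11/12)^q for the growth.\<close>

lemma exists_whp:
  fixes D :: nat
  assumes D: "1 \<le> D"
  shows "\<exists>s>0. \<exists>\<eta>>0. \<exists>C n0. \<forall>n\<ge>n0. \<forall>M \<tau>. 4 ^ n \<le> M \<longrightarrow> 3 ^ n * M \<le> 2 ^ n * (2 * int D + 1) ^ n \<longrightarrow>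
    real_of_int \<bar>\<tau>\<bar> \<le> \<eta> * real n * real_of_int M \<longrightarrow>
    ratio M n (\<lambda>x. \<not> solvable {- int D..int D} \<tau> x) \<le> C * real (n + 1) * (11/12) ^ (n div s)"
proof -
  define B where "B = 2 * int D + 1"
  define \<beta> where "\<beta> = real_of_int B"
  have B: "3 \<le> B" "3 \<le> \<beta>" using D by (simp_all add: B_def \<beta>_def)
  \<comment> \<open>Three further blocks of length q = n div s cost a factor \<beta>^(3 q) of at
    most (3/2)^n, which the density hypothesis \<beta>^n \<ge> (3/2)^n M provides.\<close>
  obtain s where s': "\<beta> ^ 3 < (3/2) ^ s" using real_arch_pow[of "3/2" "\<beta> ^ 3"] by auto
  have "1 \<le> \<beta> ^ 3" using B by (intro one_le_power) auto
  then have s: "\<beta> ^ 3 \<le> (3/2) ^ s" "0 < s" using s' by (auto intro!: gr0I)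
  define \<eta> where "\<eta> = 1 / (64 * real s)"
  \<comment> \<open>As b will be at least n / (128 s), the first summand ensures 2 k D^2 \<le> b^2;
    the second makes b at least 1.\<close>
  define n0 where "n0 = 2 * D\<^sup>2 * (128 * s)\<^sup>2 + 128 * s"
  have main: "ratio M n (\<lambda>x. \<not> solvable {- int D..int D} \<tau> x) \<le> 10 * \<beta> * real (n + 1) * (11/12) ^ (n div s)"
    if n: "n0 \<le> n" and M: "4 ^ n \<le> M" and dense: "3 ^ n * M \<le> 2 ^ n * B ^ n"
      and \<tau>: "real_of_int \<bar>\<tau>\<bar> \<le> \<eta> * real n * real_of_int M" for n M \<tau>
  proof -
    define q where "q = n div s"
    define \<mu> where "\<mu> = real_of_int M"
    have n1: "1 \<le> n" "128 * s \<le> n" "2 * D\<^sup>2 * (128 * s)\<^sup>2 \<le> n" using n s by (auto simp: n0_def)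
    have "(4::int) ^ 1 \<le> 4 ^ n" using n1 by (intro power_increasing) auto
    then have M4: "4 \<le> M" using M by simp
    have \<mu>: "4 ^ n \<le> \<mu>" "0 < \<mu>" "4 \<le> \<mu>" using M M4 unfolding \<mu>_def
      by (metis of_int_le_iff of_int_numeral of_int_power, simp, simp)
    have sq: "s * q \<le> n" by (simp add: q_def)
    have qs: "real n \<le> real s * (real q + 1)"
    proof -
      have "n < s * (q + 1)" unfolding q_def using s(2) by (metis Suc_eq_plus1 dividend_less_times_div mult_Suc_right add.commute)
      then have "real n \<le> real (s * (q + 1))" by (intro of_nat_mono) simp
      then show ?thesis by (simp add: distrib_left)
    qed
    have qn: "q \<le> n" by (simp add: q_def)
    have q_lower: "real n / (2 * real s) \<le> real q"
    proof -
      have "2 * real s \<le> real n" using n1(2) s by linarith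
      then have "real n \<le> 2 * (real s * real q)" using qs by (simp add: algebra_simps)
      then show ?thesis using s by (simp add: field_simps)
    qed
    have B3q: "\<beta> ^ (3 * q) \<le> (3/2) ^ n"
    proof -
      have "\<beta> ^ (3 * q) = (\<beta> ^ 3) ^ q" by (simp add: power_mult)
      also have "\<dots> \<le> ((3/2) ^ s) ^ q" using s B by (intro power_mono) auto
      also have "\<dots> = (3/2) ^ (s * q)" by (simp add: power_mult)
      also have "\<dots> \<le> (3/2) ^ n" using sq by (intro power_increasing) auto
      finally show ?thesis .
    qed
    have dense': "(3/2) ^ n * \<mu> \<le> \<beta> ^ n"
    proof -
      have "real_of_int (3 ^ n * M) \<le> real_of_int (2 ^ n * B ^ n)" using dense by (simp only: of_int_le_iff)
      then have "3 ^ n * \<mu> \<le> 2 ^ n * \<beta> ^ n" by (simp add: \<mu>_def \<beta>_def)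
      then show ?thesis by (simp add: power_divide field_simps)
    qed
    \<comment> \<open>The least such k puts \<beta>^k at or below M / (11/10)^q and \<beta>^(k+1)
      above it; for k = 0 the first bound comes from M \<ge> 4^n.\<close>
    define P where "P k \<longleftrightarrow> \<mu> < \<beta> ^ (k + 1) * (11/10) ^ q" for k
    have "\<exists>k. P k"
    proof -
      obtain k where "\<mu> < \<beta> ^ k" using real_arch_pow[of \<beta> \<mu>] B by auto
      also have "\<dots> \<le> \<beta> ^ (k + 1)" using B by (intro power_increasing) auto
      also have "\<dots> \<le> \<beta> ^ (k + 1) * (11/10) ^ q" using B by simp
      finally show ?thesis unfolding P_def by blast
    qed
    define k where "k = (LEAST k. P k)"
    have Pk: "\<mu> < \<beta> ^ (k + 1) * (11/10) ^ q" using LeastI_ex[OF \<open>\<exists>k. P k\<close>] by (simp add: k_def P_def)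
    have Pk': "\<beta> ^ k * (11/10) ^ q \<le> \<mu>"
    proof (cases k)
      case 0
      have "(11/10) ^ q \<le> (4::real) ^ q" by (intro power_mono) auto
      also have "\<dots> \<le> 4 ^ n" using qn by (intro power_increasing) auto
      finally show ?thesis using 0 \<mu> by simp
    next
      case (Suc k')
      then have "\<not> P k'" using not_less_Least[of k' P] by (simp add: k_def)
      then show ?thesis using Suc by (simp add: P_def)
    qed
    have k3q: "k + 3 * q \<le> n"
    proof -
      have "\<beta> ^ k * 1 \<le> \<beta> ^ k * (11/10) ^ q" using B by (intro mult_left_mono) auto
      then have "\<beta> ^ k \<le> \<mu>" using Pk' by simp
      then have "\<beta> ^ (k + 3 * q) \<le> \<mu> * (3/2) ^ n" unfolding power_add
        using B3q \<mu> B by (intro mult_mono) auto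
      also have "\<dots> \<le> \<beta> ^ n" using dense' by (simp add: mult.commute)
      finally show ?thesis using B by (intro power_le_imp_le_exp[of \<beta>]) auto
    qed
    define m where "m = n - (k + 3 * q)"
    have nm: "n = k + (q + (q + (q + m)))" using k3q by (simp add: m_def)
    \<comment> \<open>With this choice 16 b M takes at most half of q M, and the other half is left
      for 16 |\<tau>|; this also explains \<eta>.\<close>
    define b where "b = int (q div 32)"
    have b_lower: "real n / (128 * real s) \<le> real_of_int b"
    proof -
      have "q < 32 * (q div 32 + 1)" by presburger
      then have "real q \<le> real (32 * (q div 32 + 1))" by (intro of_nat_mono) simp
      then have "real q / 32 - 1 \<le> real_of_int b" by (simp add: b_def)
      moreover have "1 \<le> real n / (128 * real s)" using n1(2) s by (simp add: pos_le_divide_eq)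
      moreover have "real n / (128 * real s) + real n / (128 * real s) = real n / (2 * real s) / 32" by simp
      ultimately show ?thesis using q_lower by linarith
    qed
    have b1: "1 \<le> b"
    proof -
      have "1 \<le> real n / (128 * real s)" using n1(2) s by (simp add: pos_le_divide_eq)
      then have "1 \<le> real_of_int b" using b_lower by linarith
      then show ?thesis by simp
    qed
    have b2: "2 * int k * (int D)\<^sup>2 \<le> b\<^sup>2"
    proof -
      have "2 * real k * (real D)\<^sup>2 \<le> 2 * real n * (real D)\<^sup>2" using k3q by (intro mult_right_mono) auto
      also have "\<dots> \<le> (real n / (128 * real s))\<^sup>2"
      proof -
        have "real (2 * D\<^sup>2 * (128 * s)\<^sup>2) \<le> real n" using n1(3) by (simp only: of_nat_le_iff)
        then have "2 * (real D)\<^sup>2 * (128 * real s)\<^sup>2 * real n \<le> real n * real n" by (intro mult_right_mono) auto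
        then show ?thesis using s by (simp add: power_divide pos_le_divide_eq power2_eq_square mult_ac)
      qed
      also have "\<dots> \<le> (real_of_int b)\<^sup>2" using b_lower by (intro power_mono) auto
      finally have "real_of_int (2 * int k * (int D)\<^sup>2) \<le> real_of_int (b\<^sup>2)" by simp
      then show ?thesis by (simp only: of_int_le_iff)
    qed
    have \<tau>': "16 * (\<bar>\<tau>\<bar> + b * M) \<le> int q * M"
    proof -
      have "\<eta> * real n \<le> real q / 32" using q_lower s by (simp add: \<eta>_def field_simps)
      then have "\<eta> * real n * \<mu> \<le> real q / 32 * \<mu>" using \<mu> by (intro mult_right_mono) auto
      then have "32 * real_of_int \<bar>\<tau>\<bar> \<le> real q * \<mu>" using \<tau> by (simp add: \<mu>_def)
      then have "real_of_int (32 * \<bar>\<tau>\<bar>) \<le> real_of_int (int q * M)" by (simp add: \<mu>_def)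
      then have 1: "32 * \<bar>\<tau>\<bar> \<le> int q * M" by (simp only: of_int_le_iff)
      have "32 * (q div 32) \<le> q" by simp
      then have "32 * b \<le> int q" unfolding b_def by (metis of_nat_le_iff of_nat_mult of_nat_numeral)
      then have "32 * b * M \<le> int q * M" using M4 by (intro mult_right_mono) auto
      with 1 show ?thesis by (simp add: distrib_left mult.assoc)
    qed
    define r where "r = (11/12 :: real) ^ q"
    have "ratio M n (\<lambda>x. \<not> solvable {- int D..int D} \<tau> x) \<le> 4 * \<beta> ^ k / \<mu> + ((9/10) ^ q +
       ((5/6) ^ q * (4 * (2 * real_of_int b + 1) * \<mu> / \<beta> ^ k) + ((3/4) ^ q + 0)))"
      unfolding nm \<mu>_def \<beta>_def B_def by (rule solvable_blocks[OF M4 _ b1 b2 \<tau>']) (use D in simp)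
    also have "\<dots> \<le> 4 * r + (r + (4 * (real n + 1) * \<beta> * r + (r + 0)))"
    proof (intro add_mono)
      have "\<beta> ^ k / \<mu> \<le> 1 / (11/10) ^ q" using Pk' \<mu> by (simp add: field_simps)
      also have "\<dots> = (10/11) ^ q" by (simp add: power_divide)
      also have "\<dots> \<le> r" unfolding r_def by (intro power_mono) auto
      finally show "4 * \<beta> ^ k / \<mu> \<le> 4 * r" by simp
      show "(9/10) ^ q \<le> r" "(3/4) ^ q \<le> r" unfolding r_def by (intro power_mono; simp)+
      have bn: "2 * real_of_int b + 1 \<le> real n + 1"
      proof -
        have "2 * (q div 32) \<le> n" using qn by linarith
        then have "real (2 * (q div 32)) \<le> real n" by (simp only: of_nat_le_iff)
        then show ?thesis by (simp add: b_def)
      qed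
      have "\<mu> / \<beta> ^ k \<le> \<beta> * (11/10) ^ q" using Pk B by (simp add: field_simps)
      then have "(4 * (2 * real_of_int b + 1)) * (\<mu> / \<beta> ^ k) \<le> (4 * (real n + 1)) * (\<beta> * (11/10) ^ q)"
        using bn b1 \<mu> B by (intro mult_mono) auto
      then have "(5/6) ^ q * ((4 * (2 * real_of_int b + 1)) * (\<mu> / \<beta> ^ k)) \<le> (5/6) ^ q * ((4 * (real n + 1)) * (\<beta> * (11/10) ^ q))"
        by (intro mult_left_mono) auto
      also have "\<dots> = 4 * (real n + 1) * \<beta> * ((5/6) ^ q * (11/10) ^ q)" by simp
      also have "(5/6) ^ q * (11/10) ^ q = r" unfolding r_def by (simp flip: power_mult_distrib)
      finally show "(5/6) ^ q * (4 * (2 * real_of_int b + 1) * \<mu> / \<beta> ^ k) \<le> 4 * (real n + 1) * \<beta> * r" by simp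
    qed simp
    also have "\<dots> \<le> 10 * \<beta> * real (n + 1) * r"
    proof -
      have "6 \<le> 6 * \<beta> * real (n + 1)" using mult_mono[of 1 \<beta> 1 "real (n + 1)"] B by simp
      then have "6 * r \<le> 6 * \<beta> * real (n + 1) * r" by (intro mult_right_mono) (auto simp: r_def)
      then show ?thesis by (simp add: algebra_simps)
    qed
    finally show ?thesis unfolding r_def q_def .
  qed
  have \<eta>: "0 < \<eta>" using s by (simp add: \<eta>_def)
  show ?thesis
  proof (rule exI[of _ s], rule conjI[OF s(2)], rule exI[of _ \<eta>], rule conjI[OF \<eta>],
      rule exI[of _ "10 * \<beta>"], rule exI[of _ n0])
    show "\<forall>n\<ge>n0. \<forall>M \<tau>. 4 ^ n \<le> M \<longrightarrow> 3 ^ n * M \<le> 2 ^ n * (2 * int D + 1) ^ n \<longrightarrow>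
      real_of_int \<bar>\<tau>\<bar> \<le> \<eta> * real n * real_of_int M \<longrightarrow>
      ratio M n (\<lambda>x. \<not> solvable {- int D..int D} \<tau> x) \<le> 10 * \<beta> * real (n + 1) * (11/12) ^ (n div s)"
      using main unfolding B_def by blast
  qed
qed

subsection \<open>Completeness of the levels\<close>

text \<open>Chosen so that about \<rho>^n candidates e in one parity class produce of the order of
  (5/2)^n hits, more than the 2^n classes in the union bound.\<close>

definition width :: "int \<Rightarrow> nat \<Rightarrow> nat \<Rightarrow> int" where
  "width M n \<rho> = (M * 5 ^ n) div (2 * int \<rho>) ^ n"

definition passes :: "int \<Rightarrow> int \<Rightarrow> nat \<Rightarrow> nat \<Rightarrow> nat \<Rightarrow> int \<Rightarrow> bool" where
  "passes M \<tau> n j \<rho> y \<longleftrightarrow> (if j = 0 then y = \<tau> else win M (2 ^ j * width M n \<rho>) (2 ^ j * y - \<tau>))"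

definition level :: "int \<Rightarrow> int \<Rightarrow> nat \<Rightarrow> int list \<Rightarrow> nat \<Rightarrow> nat \<Rightarrow> nat \<Rightarrow> int list set" where
  "level M \<tau> n x j \<rho> R = {c \<in> vecs {- int R..int R} n. passes M \<tau> n j \<rho> (dot ((!) c) x)}"

text \<open>The event on which the recursion loses nothing: each split finds its e, and each list
  below the top stays short of the capacity. The top list is left out, since there only emptiness
  matters and an empty list is not full.\<close>

fun good :: "int \<Rightarrow> int \<Rightarrow> nat \<Rightarrow> int list \<Rightarrow> nat \<Rightarrow> nat \<Rightarrow> nat list \<Rightarrow> bool" where
  "good M \<tau> n x j \<rho> (R # R' # rs) \<longleftrightarrow> covers M (int (2 * R' - R)) (width M n (2 * R' - R)) x \<and>
     int (card (level M \<tau> n x (Suc j) (2 * R' - R) R')) < 43 ^ n div 5 ^ n \<and>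
     good M \<tau> n x (Suc j) (2 * R' - R) (R' # rs)"
| "good M \<tau> n x j \<rho> rs \<longleftrightarrow> True"

text \<open>\<open>18 \<le> 2 * R' - R\<close> keeps the windows shorter than M. The inequality with
  392/125 bounds (2 R' + 1) / \<rho>, and multiplied by 5/2 it gives the growth 196/25 of a
  level.\<close>

fun levels_ok :: "nat \<Rightarrow> nat list \<Rightarrow> bool" where
  "levels_ok D (R # R' # rs) \<longleftrightarrow> R' < R \<and> R \<le> D \<and> R < 2 * R' \<and> 18 \<le> 2 * R' - R \<and>
     125 * (2 * R' + 1) \<le> 392 * (2 * R' - R) \<and> levels_ok D (R' # rs)"
| "levels_ok D rs \<longleftrightarrow> True"

text \<open>Smaller \<rho> means a wider window, so along the levels the windows may only widen.
  Level 0 is an exact equation and imposes no condition.\<close>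

fun decreasing :: "nat \<Rightarrow> nat \<Rightarrow> nat list \<Rightarrow> bool" where
  "decreasing j \<rho> (R # R' # rs) \<longleftrightarrow> (j = 0 \<or> 2 * R' - R \<le> \<rho>) \<and> R < 2 * R' \<and> decreasing (Suc j) (2 * R' - R) (R' # rs)"
| "decreasing j \<rho> rs \<longleftrightarrow> True"

lemma levels_ok_radii: "R \<le> D \<Longrightarrow> levels_ok D (radii R)"
proof (induction R rule: less_induct)
  case (less R)
  show ?case
  proof (cases "R \<le> 36")
    case True
    then show ?thesis by (simp add: radii.simps)
  next
    case False
    define R' where "R' = (3 * R + 3) div 4"
    have R': "R' < R" "3 * R \<le> 4 * R'" "4 * R' \<le> 3 * R + 3" using False by (auto simp: R'_def)
    obtain rs where rs: "radii R' = R' # rs" using radii_Cons by blast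
    have "levels_ok D (radii R')" using R' less.prems by (intro less.IH) auto
    moreover have "R < 2 * R'" "18 \<le> 2 * R' - R" "392 * R + 125 \<le> 534 * R'"
      using R' False by linarith+
    moreover from this have "125 * (2 * R' + 1) \<le> 392 * (2 * R' - R)"
    proof -
      define \<rho> where "\<rho> = 2 * R' - R"
      have "2 * R' = R + \<rho>" using \<open>R < 2 * R'\<close> by (simp add: \<rho>_def)
      then show ?thesis unfolding \<rho>_def[symmetric] using \<open>392 * R + 125 \<le> 534 * R'\<close> by simp
    qed
    ultimately show ?thesis using False R'(1) less.prems
      by (subst radii.simps) (simp add: R'_def[symmetric] rs)
  qed
qed

text \<open>The next \<rho> is 2 R' - R, which is at most (R + 3) / 2 because R' is 3 R / 4 rounded
  up; the hypothesis compares this with the current one. It is inherited because R' + 3 \<le> 2 (2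
  R' - R) for radii above 36.\<close>

lemma decreasing_radii: "j = 0 \<or> (R \<le> 36 \<or> R + 3 \<le> 2 * \<rho>) \<Longrightarrow> decreasing j \<rho> (radii R)"
proof (induction R arbitrary: j \<rho> rule: less_induct)
  case (less R)
  show ?case
  proof (cases "R \<le> 36")
    case True
    then show ?thesis by (simp add: radii.simps)
  next
    case False
    define R' where "R' = (3 * R + 3) div 4"
    have R': "R' < R" "3 * R \<le> 4 * R'" "4 * R' \<le> 3 * R + 3" using False by (auto simp: R'_def)
    obtain rs where rs: "radii R' = R' # rs" using radii_Cons by blast
    have "decreasing (Suc j) (2 * R' - R) (radii R')" using R' False by (intro less.IH) auto
    then show ?thesis using False R' less.prems by (subst radii.simps) (auto simp: R'_def[symmetric] rs)
  qed
qed

lemma win_combine: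
  assumes M: "0 < M" and W: "0 \<le> V" "0 \<le> W" and V: "V + K * W \<le> V'" "0 \<le> K"
    and 1: "win M V y" and 2: "win M W z"
  shows "win M V' (y + K * z)" "win M V' (y - K * z)"
proof -
  obtain v where v: "\<bar>v\<bar> \<le> V" "M dvd y - v" using 1 win_iff[OF M W(1)] by blast
  obtain w where w: "\<bar>w\<bar> \<le> W" "M dvd z - w" using 2 win_iff[OF M W(2)] by blast
  have V': "0 \<le> V'" using V W mult_nonneg_nonneg[of K W] by linarith
  have Kw: "\<bar>K * w\<bar> \<le> K * W" using w V by (simp add: abs_mult mult_left_mono)
  have "M dvd (y - v) + K * (z - w)" "M dvd (y - v) - K * (z - w)" using v w by auto
  then have "M dvd y + K * z - (v + K * w)" "M dvd y - K * z - (v - K * w)" by (simp_all add: algebra_simps)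
  moreover have "\<bar>v + K * w\<bar> \<le> V'" "\<bar>v - K * w\<bar> \<le> V'" using Kw v V by linarith+
  ultimately show "win M V' (y + K * z)" "win M V' (y - K * z)" using win_iff[OF M V'] by blast+
qed

lemma width_mono: "0 \<le> M \<Longrightarrow> 1 \<le> \<rho>' \<Longrightarrow> \<rho>' \<le> \<rho> \<Longrightarrow> width M n \<rho> \<le> width M n \<rho>'"
  unfolding width_def by (intro zdiv_mono2 power_mono) auto

lemma width_nonneg:
  assumes "0 \<le> M"
  shows "0 \<le> width M n \<rho>"
proof -
  have "0 \<le> a div b" if "0 \<le> a" "0 \<le> b" for a b :: int
    using that by (cases "b = 0") (auto simp: pos_imp_zdiv_nonneg_iff)
  then show ?thesis unfolding width_def using assms by simp
qed

section \<open>Correctness of the answer on good instances\<close>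

context instance_data begin

lemma V_width: "V j \<rho> = 2 ^ j * width M n \<rho>" by (simp add: V_def width_def)

lemma filtv_passes: "in_window j \<rho> y \<longleftrightarrow> passes M \<tau> n j \<rho> y"
  by (simp add: in_window_def passes_def win_def V_width)

lemma dt_dot: "partial_dot v n = dot (digit d n v) x" by (simp add: partial_dot_def dot_def len)

definition level_words :: "nat \<Rightarrow> nat \<Rightarrow> nat \<Rightarrow> int set" where
  "level_words j \<rho> R = {v \<in> box_words R. accepts j \<rho> R v}"

lemma finite_boxe: "finite (box_words R)" unfolding boxe_image by simp

lemma finite_lev: "finite (level_words j \<rho> R)" unfolding level_words_def by (simp add: finite_boxe)

lemma dg_enc_nth: "R \<le> d \<Longrightarrow> (\<And>i. i < n \<Longrightarrow> \<bar>c i\<bar> \<le> int R) \<Longrightarrow> i < n \<Longrightarrow> digit d n (enc d n c) i = c i"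
  by (rule dg_enc) force+

lemma enc_lev:
  assumes "R \<le> d" "\<And>i. i < n \<Longrightarrow> \<bar>c i\<bar> \<le> int R" "passes M \<tau> n j \<rho> (dot c x)"
  shows "enc d n c \<in> level_words j \<rho> R"
proof -
  note D = dg_enc_nth[OF assms(1,2)]
  have "dot (digit d n (enc d n c)) x = dot c x" unfolding dot_def len by (intro sum.cong) (auto simp: D)
  then show ?thesis using assms(2,3) D
    by (auto simp: level_words_def box_words_def accepts_def filtv_passes dt_dot)
qed

lemma levD:
  assumes "v \<in> level_words j \<rho> R" "R \<le> d"
  shows "enc d n (digit d n v) = v" "\<And>i. i < n \<Longrightarrow> \<bar>digit d n v i\<bar> \<le> int R" "passes M \<tau> n j \<rho> (dot (digit d n v) x)"
  using assms boxe_bound[of R v] enc_dg[of v d n] by (auto simp: level_words_def accepts_def filtv_passes dt_dot)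

lemma card_lev: "R \<le> d \<Longrightarrow> card (level_words j \<rho> R) \<le> card (level M \<tau> n x j \<rho> R)"
proof -
  assume R: "R \<le> d"
  have "level_words j \<rho> R \<subseteq> (\<lambda>c. enc d n ((!) c)) ` level M \<tau> n x j \<rho> R"
  proof
    fix v assume v: "v \<in> level_words j \<rho> R"
    note D = levD[OF v R]
    define c where "c = map (digit d n v) [0..<n]"
    have 1: "enc d n ((!) c) = v" using D(1) by (simp add: c_def enc_def)
    have 2: "dot ((!) c) x = dot (digit d n v) x" unfolding dot_def len by (intro sum.cong) (auto simp: c_def)
    have "c \<in> vecs {- int R..int R} n" using D(2) by (force simp: c_def vecs_def abs_le_iff)
    then have "c \<in> level M \<tau> n x j \<rho> R" using D(3) 2 by (simp add: level_def)
    then show "v \<in> (\<lambda>c. enc d n ((!) c)) ` level M \<tau> n x j \<rho> R" using 1 by force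
  qed
  moreover have "finite (level M \<tau> n x j \<rho> R)" unfolding level_def by (simp add: finite_vecs)
  ultimately show ?thesis by (rule surj_card_le[rotated])
qed

text \<open>Let e be the vector provided by \<open>covers\<close> for the parity class of c. The
  halves (c + e) / 2 and (c - e) / 2 have entries at most (R + 2 R' - R) / 2 = R', and 2^(j+1) times
  their scalar products are 2^j (c . x) plus or minus 2^j (e . x), so the windows add.\<close>

lemma halve:
  assumes v: "v \<in> level_words j \<rho> R" and R: "R \<le> d" "R' \<le> d" "R < 2 * R'"
    and cov: "covers M (int (2 * R' - R)) (width M n (2 * R' - R)) x" and dec: "j = 0 \<or> 2 * R' - R \<le> \<rho>"
  shows "\<exists>u w. u \<in> level_words (Suc j) (2 * R' - R) R' \<and> w \<in> level_words (Suc j) (2 * R' - R) R' \<and> v = u + w"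
proof -
  define \<rho>' where "\<rho>' = 2 * R' - R"
  have \<rho>': "1 \<le> \<rho>'" "int \<rho>' = 2 * int R' - int R" using R by (auto simp: \<rho>'_def)
  define c where "c = digit d n v"
  note D = levD[OF v R(1), folded c_def]
  obtain e where e: "\<And>i. i < n \<Longrightarrow> \<bar>e i\<bar> \<le> int \<rho>' \<and> even (c i - e i)" "win M (width M n \<rho>') (dot e x)"
    using cov unfolding covers_def \<rho>'_def[symmetric] len by blast
  define a where "a i = (c i + e i) div 2" for i
  define b where "b i = (c i - e i) div 2" for i
  have ab: "2 * a i = c i + e i" "2 * b i = c i - e i" if "i < n" for i
    using e(1)[OF that] by (auto simp: a_def b_def)
  have aR: "\<bar>a i\<bar> \<le> int R'" "\<bar>b i\<bar> \<le> int R'" if "i < n" for i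
    using ab[OF that] e(1)[OF that] D(2)[OF that] \<rho>'(2) by linarith+
  have "2 * (a i * y) = c i * y + e i * y" "2 * (b i * y) = c i * y - e i * y" if "i < n" for i y
    by (simp_all only: mult.assoc[symmetric] ab[OF that] distrib_right left_diff_distrib)
  then have dot_ab: "2 * dot a x = dot c x + dot e x" "2 * dot b x = dot c x - dot e x"
    unfolding dot_def len sum_distrib_left sum.distrib[symmetric] sum_subtractf[symmetric]
    by (auto intro: sum.cong)
  have dots: "2 ^ Suc j * dot a x - \<tau> = (2 ^ j * dot c x - \<tau>) + 2 ^ j * dot e x"
    "2 ^ Suc j * dot b x - \<tau> = (2 ^ j * dot c x - \<tau>) - 2 ^ j * dot e x"
    using arg_cong[OF dot_ab(1), of "\<lambda>t. 2 ^ j * t"] arg_cong[OF dot_ab(2), of "\<lambda>t. 2 ^ j * t"]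
    by (simp_all add: algebra_simps)
  \<comment> \<open>At level 0 the equation is exact and counts as a window of half width 0.\<close>
  define V0 where "V0 = (if j = 0 then 0 else 2 ^ j * width M n \<rho>)"
  have M0: "0 \<le> M" using M_pos by simp
  have V0: "0 \<le> V0" using width_nonneg[OF M0] by (simp add: V0_def)
  have "win M V0 (2 ^ j * dot c x - \<tau>)"
    using D(3) M_pos by (auto simp: passes_def V0_def win_def)
  moreover have "V0 + 2 ^ j * width M n \<rho>' \<le> 2 ^ Suc j * width M n \<rho>'"
  proof (cases "j = 0")
    case True then show ?thesis using width_nonneg[OF M0, of n \<rho>'] by (simp add: V0_def)
  next
    case False
    then have "width M n \<rho> \<le> width M n \<rho>'" using dec \<rho>'(1) M0 by (intro width_mono) (auto simp: \<rho>'_def)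
    then have "2 ^ j * width M n \<rho> \<le> 2 ^ j * width M n \<rho>'" by (intro mult_left_mono) auto
    then show ?thesis using False by (simp add: V0_def)
  qed
  ultimately have "passes M \<tau> n (Suc j) \<rho>' (dot a x)" "passes M \<tau> n (Suc j) \<rho>' (dot b x)"
    unfolding passes_def dots using win_combine[OF M_pos V0 width_nonneg[OF M0] _ _ _ e(2)] by auto
  then have "enc d n a \<in> level_words (Suc j) \<rho>' R'" "enc d n b \<in> level_words (Suc j) \<rho>' R'"
    using aR R(2) by (auto intro: enc_lev)
  moreover have "v = enc d n a + enc d n b"
  proof -
    have "enc d n c = enc d n (\<lambda>i. a i + b i)" unfolding enc_def
      by (intro sum.cong) (use ab in \<open>force+\<close>)
    then show ?thesis using D(1) by (simp add: enc_add)
  qed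
  ultimately show ?thesis unfolding \<rho>'_def by blast
qed

text \<open>From the deepest level upwards: the list below is contained in its level, which is
  smaller than the capacity, so that list is not full and equals the level. \<open>halve\<close>
  then finds every vector of the present level among the sums.\<close>

lemma Res_complete:
  assumes "Res j \<rho> rs S" "valid_radii d j \<rho> rs" "decreasing j \<rho> rs" "good M \<tau> n x j \<rho> rs"
  shows "S \<subseteq> level_words j \<rho> (hd rs) \<and> (int (card S) < cap \<longrightarrow> S = level_words j \<rho> (hd rs))"
  using assms
proof (induction j \<rho> rs S rule: Res.induct)
  case (2 j \<rho> R S)
  then show ?case by (auto simp: trunc_def level_words_def)
next
  case (3 j \<rho> R R' rs S)
  obtain S' where S': "Res (Suc j) (2 * R' - R) (R' # rs) S'"
    "trunc (accepts j \<rho> R) {u + v |u v. u \<in> S' \<and> v \<in> S'} S" using 3 by auto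
  have v': "valid_radii d (Suc j) (2 * R' - R) (R' # rs)" and R: "R \<le> d" "R < 2 * R'"
    and dec: "j = 0 \<or> 2 * R' - R \<le> \<rho>" "decreasing (Suc j) (2 * R' - R) (R' # rs)"
    and g: "covers M (int (2 * R' - R)) (width M n (2 * R' - R)) x"
      "int (card (level M \<tau> n x (Suc j) (2 * R' - R) R')) < cap" "good M \<tau> n x (Suc j) (2 * R' - R) (R' # rs)"
    using 3 by (auto simp: cap_def)
  have R'd: "R' \<le> d" using v' by (cases rs) auto
  have IH: "S' \<subseteq> level_words (Suc j) (2 * R' - R) R'" "int (card S') < cap \<longrightarrow> S' = level_words (Suc j) (2 * R' - R) R'"
    using 3(1)[OF S'(1) v' dec(2) g(3)] by auto
  have "card S' \<le> card (level_words (Suc j) (2 * R' - R) R')" by (rule card_mono[OF finite_lev IH(1)])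
  also have "\<dots> \<le> card (level M \<tau> n x (Suc j) (2 * R' - R) R')" by (rule card_lev[OF R'd])
  finally have S'eq: "S' = level_words (Suc j) (2 * R' - R) R'" using IH(2) g(2) by simp
  have "{v \<in> {u + v |u v. u \<in> S' \<and> v \<in> S'}. accepts j \<rho> R v} = level_words j \<rho> R"
  proof (intro equalityI subsetI)
    fix v assume "v \<in> {v \<in> {u + v |u v. u \<in> S' \<and> v \<in> S'}. accepts j \<rho> R v}"
    then obtain u w where uw: "v = u + w" "u \<in> S'" "w \<in> S'" and a: "accepts j \<rho> R v" by blast
    have "\<bar>v\<bar> \<le> H" unfolding uw(1)
      by (rule abs_add_le_offset) (use Res_D[OF S'(1) v'] uw in force)+
    then have "v = enc d n (digit d n v)" by (simp add: enc_dg)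
    then have "v \<in> box_words R" using a unfolding box_words_def accepts_def by blast
    then show "v \<in> level_words j \<rho> R" using a by (simp add: level_words_def)
  next
    fix v assume v: "v \<in> level_words j \<rho> R"
    then show "v \<in> {v \<in> {u + v |u v. u \<in> S' \<and> v \<in> S'}. accepts j \<rho> R v}"
      using halve[OF v R(1) R'd R(2) g(1) dec(1)] unfolding S'eq by (auto simp: level_words_def)
  qed
  then show ?case using S'(2) by (auto simp: trunc_def)
qed simp

text \<open>A reported vector is checked exactly at level 0, so it is always a solution. If
  \<open>None\<close> is reported, the top list of the good radius D is empty and hence complete, so
  no solution of radius D exists: for D = d this is the claim, otherwise it contradicts
  solvability.\<close>

lemma answer_correct:
  assumes ans: "answer_spec ans" and D: "D \<le> d" and g: "good M \<tau> n x 0 1 (radii D)"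
    and s: "D = d \<or> solvable {- int D..int D} \<tau> x"
  shows "correct_answer {- int d..int d} x \<tau> ans"
proof -
  obtain Sf where Sf: "\<And>D. D \<le> d \<Longrightarrow> Res 0 1 (radii D) (Sf D)"
    "ans = None \<and> (\<forall>D\<le>d. Sf D = {}) \<or> (\<exists>D\<le>d. \<exists>v\<in>Sf D. ans = Some (map (digit d n v) [0..<n]))"
    using ans unfolding answer_spec_def by blast
  have val: "valid_radii d 0 1 (radii D)" if "D \<le> d" for D using that by (intro valid_radii_radii) auto
  have hd: "hd (radii D) = D" for D using radii_Cons[of D] by auto
  from Sf(2) show ?thesis
  proof
    assume none: "ans = None \<and> (\<forall>D\<le>d. Sf D = {})"
    have "int (card (Sf D)) < cap" using none D cap_bounds by simp
    then have "level_words 0 1 D = {}"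
      using Res_complete[OF Sf(1)[OF D] val[OF D] decreasing_radii g] none D hd by auto
    have "\<not> solvable {- int D..int D} \<tau> x"
    proof
      assume "solvable {- int D..int D} \<tau> x"
      then obtain c where c: "length c = n" "set c \<subseteq> {- int D..int D}" "dot ((!) c) x = \<tau>"
        by (auto simp: solvable_def is_solution_dot len)
      have "enc d n ((!) c) \<in> level_words 0 1 D"
      proof (rule enc_lev[OF D])
        show "\<bar>c ! i\<bar> \<le> int D" if "i < n" for i
        proof -
          have "c ! i \<in> {- int D..int D}" using nth_mem[of i c] c that by blast
          then show ?thesis by auto
        qed
        show "passes M \<tau> n 0 1 (dot ((!) c) x)" using c by (simp add: passes_def)
      qed
      then show False using \<open>level_words 0 1 D = {}\<close> by simp
    qed
    then show ?thesis using s none by (auto simp: correct_answer_def solvable_def)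
  next
    assume "\<exists>D\<le>d. \<exists>v\<in>Sf D. ans = Some (map (digit d n v) [0..<n])"
    then obtain D v where Dv: "D \<le> d" "v \<in> Sf D" "ans = Some (map (digit d n v) [0..<n])" by blast
    have "accepts 0 1 D v" "\<forall>i<n. \<bar>digit d n v i\<bar> \<le> int D" using Res_D[OF Sf(1)[OF Dv(1)] val[OF Dv(1)]] Dv(2) hd by auto
    moreover have "dot ((!) (map (digit d n v) [0..<n])) x = dot (digit d n v) x"
      unfolding dot_def len by (intro sum.cong) auto
    ultimately have "is_solution {- int d..int d} x \<tau> (map (digit d n v) [0..<n])"
      using Dv(1) unfolding is_solution_dot len
      by (auto simp: accepts_def in_window_def dt_dot) (force simp: abs_le_iff)+
    then show ?thesis using Dv(3) by (simp add: correct_answer_def)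
  qed
qed

end

section \<open>Probability that an instance is good\<close>

lemma ratio_mono: "0 < M \<Longrightarrow> (\<And>x. x \<in> input_vectors n M \<Longrightarrow> P x \<Longrightarrow> Q x) \<Longrightarrow> ratio M n P \<le> ratio M n Q"
  unfolding ratio_def
  by (intro divide_right_mono of_nat_mono card_mono) (auto simp: finite_input_vectors)

lemma ratio_disj:
  assumes "0 < M" shows "ratio M n (\<lambda>x. P x \<or> Q x) \<le> ratio M n P + ratio M n Q"
proof -
  have "(\<Sum>x\<in>vecs {0..<M} n. of_bool (P x \<or> Q x)) \<le> (\<Sum>x\<in>vecs {0..<M} n. of_bool (P x) + of_bool (Q x) :: real)"
    by (intro sum_mono) auto
  then show ?thesis using assms
    by (simp add: ratio_sum sum.distrib add_divide_distrib[symmetric] divide_right_mono del: sum_of_bool_eq)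
qed

text \<open>Rounding down loses less than 1, which the passage from W to 2 W + 1 makes up
  for.\<close>

lemma width_bounds:
  assumes "0 \<le> M" "1 \<le> \<rho>"
  shows "real_of_int (width M n \<rho>) \<le> real_of_int M * (5/2) ^ n / real \<rho> ^ n"
    "real_of_int M * (5/2) ^ n / real \<rho> ^ n \<le> real_of_int (2 * width M n \<rho> + 1)"
proof -
  define a b where "a = M * 5 ^ n" and "b = (2 * int \<rho>) ^ n"
  have b: "0 < b" using assms by (simp add: b_def)
  have eq: "real_of_int M * (5/2) ^ n / real \<rho> ^ n = real_of_int a / real_of_int b"
    by (simp add: a_def b_def power_divide power_mult_distrib)
  have w: "width M n \<rho> = a div b" by (simp add: width_def a_def b_def)
  have "b * (a div b) \<le> a" using pos_mod_sign[OF b, of a] minus_mod_eq_mult_div[of a b] by linarith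
  then have "real_of_int (b * (a div b)) \<le> real_of_int a" by (simp only: of_int_le_iff)
  then show "real_of_int (width M n \<rho>) \<le> real_of_int M * (5/2) ^ n / real \<rho> ^ n"
    unfolding eq w using b by (simp add: pos_le_divide_eq mult.commute)
  have "a < b * (a div b) + b" using pos_mod_bound[OF b, of a] minus_mod_eq_mult_div[of a b] by linarith
  then have "a \<le> b * (a div b + 1)" by (simp add: distrib_left)
  then have "real_of_int a \<le> real_of_int (b * (a div b + 1))" by (simp only: of_int_le_iff)
  then have "real_of_int a / real_of_int b \<le> real_of_int (a div b + 1)"
    using b by (simp add: pos_divide_le_eq mult.commute)
  also have "\<dots> \<le> real_of_int (2 * (a div b) + 1)" using width_nonneg[OF assms(1), of n \<rho>] w by simp
  finally show "real_of_int M * (5/2) ^ n / real \<rho> ^ n \<le> real_of_int (2 * width M n \<rho> + 1)" unfolding eq w .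
qed

text \<open>Both terms of the covering bound become multiples of \<rho> (2/5)^n, and the 2^n classes
  leave (4/5)^n. In the second term, where the excess 2 \<rho> is divided by the length of the
  window, the hypothesis \<rho>^n \<le> M enters.\<close>

lemma ratio_covers:
  assumes n: "1 \<le> n" and M: "4 \<le> M" and \<rho>: "18 \<le> \<rho>" and \<rho>M: "int \<rho> ^ n \<le> M"
  shows "ratio M n (\<lambda>x. \<not> covers M (int \<rho>) (width M n \<rho>) x) \<le> 3 * real \<rho> * (4/5) ^ n"
proof -
  define m where "m = real_of_int M"
  define r where "r = real \<rho>"
  define L where "L = real_of_int (2 * width M n \<rho> + 1)"
  have m: "4 \<le> m" "r ^ n \<le> m" and r: "18 \<le> r" using M \<rho> \<rho>M unfolding m_def r_def
    by (simp, metis of_int_le_iff of_int_of_nat_eq of_int_power, simp)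
  have w0: "0 \<le> width M n \<rho>" using M by (intro width_nonneg) simp
  have L: "m * (5/2) ^ n / r ^ n \<le> L" using width_bounds(2)[of M \<rho> n] M \<rho> by (simp add: L_def m_def r_def)
  have wM: "2 * width M n \<rho> + 1 \<le> M"
  proof -
    have "real_of_int (width M n \<rho>) \<le> m * ((5/2) / r) ^ n"
      using width_bounds(1)[of M \<rho> n] M \<rho> by (simp add: m_def r_def power_divide)
    also have "((5/2) / r) ^ n \<le> ((5/2) / r) ^ 1"
      using n r by (intro power_decreasing) (auto simp: field_simps)
    also have "((5/2) / r) ^ 1 \<le> 5/36" using r by (simp add: field_simps)
    finally have "real_of_int (width M n \<rho>) \<le> m * (5/36)" using m by simp
    then have "real_of_int (2 * width M n \<rho> + 1) \<le> m" using m by simp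
    then show ?thesis unfolding m_def by (simp only: of_int_le_iff)
  qed
  have Lpos: "0 < L" using w0 by (simp add: L_def)
  have "real (card {x \<in> input_vectors n M. \<not> covers M (int \<rho>) (width M n \<rho>) x})
    \<le> 2 ^ n * (m ^ n * (m / (r ^ (n - 1) * L) + 2 * r / L))"
    using covers_prob[of M "width M n \<rho>" "int \<rho>" n] M w0 wM \<rho> by (simp add: m_def r_def L_def)
  then have "ratio M n (\<lambda>x. \<not> covers M (int \<rho>) (width M n \<rho>) x) \<le> 2 ^ n * (m / (r ^ (n - 1) * L) + 2 * r / L)"
    unfolding ratio_def m_def[symmetric] using m by (simp add: pos_divide_le_eq mult_ac)
  also have "\<dots> \<le> 2 ^ n * (r * (2/5) ^ n + 2 * r * (2/5) ^ n)"
  proof (intro mult_left_mono add_mono)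
    have pos: "0 < m * (5/2) ^ n / r ^ n" using m r by simp
    have rr: "r ^ n = r ^ (n - 1) * r" using n by (cases n) auto
    have "m / (r ^ (n - 1) * L) \<le> m / (r ^ (n - 1) * (m * (5/2) ^ n / r ^ n))"
      using L pos m r Lpos by (intro divide_left_mono mult_left_mono mult_pos_pos) auto
    also have "\<dots> = r * (2/5) ^ n" using m r unfolding rr by (simp add: field_simps power_divide)
    finally show "m / (r ^ (n - 1) * L) \<le> r * (2/5) ^ n" .
    have "2 * r / L \<le> 2 * r / (m * (5/2) ^ n / r ^ n)" using L pos r Lpos by (intro divide_left_mono mult_pos_pos) auto
    also have "\<dots> = 2 * r * (2/5) ^ n * (r ^ n / m)" using m r by (simp add: field_simps power_divide)
    also have "\<dots> \<le> 2 * r * (2/5) ^ n * 1" using m r by (intro mult_left_mono) auto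
    finally show "2 * r / L \<le> 2 * r * (2/5) ^ n" by simp
  qed simp
  also have "\<dots> = 3 * r * (2 ^ n * (2/5) ^ n)" by (simp add: algebra_simps)
  also have "2 ^ n * (2/5) ^ n = (4/5 :: real) ^ n" by (simp flip: power_mult_distrib)
  finally show ?thesis by (simp add: r_def)
qed

text \<open>First moment and Markov's inequality. The part proportional to the window grows like
  (196/25)^n by the choice of radii; the part from common factors with M is at most a constant times
  (2 R + 1)^n / M \<le> (2 D)^n / M \<le> 2^n. Half of (43/5)^n is a lower bound for the rounded
  capacity, and 196/215 \<le> 23/25.\<close>

lemma ratio_level:
  assumes n: "1 \<le> n" and M: "4 \<le> M" and R: "1 \<le> \<rho>" "125 * (2 * R + 1) \<le> 392 * \<rho>" "R < D" and D: "int D ^ n \<le> M"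
  shows "ratio M n (\<lambda>x. 43 ^ n div 5 ^ n \<le> int (card (level M \<tau> n x (Suc j) \<rho> R)))
    \<le> 2 * (1 + 2 ^ Suc (Suc j) + 2 ^ Suc j * real R) * (23/25) ^ n"
proof -
  let ?V = "vecs {0..<M} n" and ?E = "vecs {- int R..int R} n"
  define m where "m = real_of_int M"
  define J where "J = Suc j"
  define W where "W = 2 ^ J * width M n \<rho>"
  have M0: "0 < M" "0 \<le> M" using M by auto
  have W0: "0 \<le> W" using width_nonneg[OF M0(2)] by (simp add: W_def)
  have m: "4 \<le> m" using M by (simp add: m_def)
  define a where "a = real (2 * R + 1)"
  define N where "N = a ^ n"
  have cE: "real (card ?E) = N"
  proof -
    have "nat (1 + 2 * int R) = 2 * R + 1" by simp
    then show ?thesis by (simp add: card_vecs N_def a_def add.commute)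
  qed
  define T where "T = m ^ n * (2 * real_of_int W + 2 ^ J * real R) / m"
  have T0: "0 \<le> T" using W0 m by (simp add: T_def)
  \<comment> \<open>The zero vector is no random variable: it may lie in the window for all
    \<open>x\<close> and is counted in full.\<close>
  have one: "(\<Sum>x\<in>?V. of_bool (win M W (2 ^ J * dot ((!) c) x + (- \<tau>)))) \<le> (if c = replicate n 0 then m ^ n else 0) + T"
    if c: "c \<in> ?E" for c
  proof (cases "c = replicate n 0")
    case True
    have "(\<Sum>x\<in>?V. of_bool (win M W (2 ^ J * dot ((!) c) x + (- \<tau>)))) \<le> (\<Sum>x\<in>?V. 1 :: real)" by (intro sum_mono) auto
    also have "\<dots> = m ^ n" using card_vecs_M[OF M0(1)] by (simp add: m_def)
    finally show ?thesis using True T0 by simp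
  next
    case False
    have "length c = n" using c by (simp add: vecs_def)
    then obtain i where i: "i < n" "c ! i \<noteq> 0" using False nth_equalityI[of c "replicate n 0"] by auto
    then have "c ! i \<in> set c" using \<open>length c = n\<close> by simp
    then have cR: "\<bar>c ! i\<bar> \<le> int R" using c by (auto simp: vecs_def abs_le_iff subset_iff)
    have "(\<Sum>x\<in>?V. of_bool (win M W (2 ^ J * dot ((!) c) x + (- \<tau>)))) * m \<le> m ^ n * real_of_int (2 * W + \<bar>2 ^ J * c ! i\<bar>)"
      using sum_win_dot[OF M0(1) W0 i(1), of "2 ^ J" "(!) c" "- \<tau>"] i(2) by (simp only: input_vectors_vecs m_def) simp
    also have "\<dots> \<le> m ^ n * (2 * real_of_int W + 2 ^ J * real R)"
    proof (intro mult_left_mono)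
      have "\<bar>2 ^ J * c ! i\<bar> \<le> 2 ^ J * int R" using cR by (simp add: abs_mult)
      then have "real_of_int (2 * W + \<bar>2 ^ J * c ! i\<bar>) \<le> real_of_int (2 * W + 2 ^ J * int R)" by (simp only: of_int_le_iff)
      then show "real_of_int (2 * W + \<bar>2 ^ J * c ! i\<bar>) \<le> 2 * real_of_int W + 2 ^ J * real R" by simp
    qed (use m in simp)
    finally show ?thesis using m False by (simp add: T_def pos_le_divide_eq)
  qed
  have "(\<Sum>x\<in>?V. real (card (level M \<tau> n x J \<rho> R))) = (\<Sum>x\<in>?V. \<Sum>c\<in>?E. of_bool (win M W (2 ^ J * dot ((!) c) x + (- \<tau>))))"
    by (intro sum.cong refl, unfold level_def passes_def J_def W_def, subst card_of_bool) (auto simp: finite_vecs)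
  also have "\<dots> = (\<Sum>c\<in>?E. \<Sum>x\<in>?V. of_bool (win M W (2 ^ J * dot ((!) c) x + (- \<tau>))))" by (rule sum.swap)
  also have "\<dots> \<le> (\<Sum>c\<in>?E. (if c = replicate n 0 then m ^ n else 0) + T)" by (intro sum_mono one)
  also have "\<dots> = (\<Sum>c\<in>?E. (if c = replicate n 0 then m ^ n else 0)) + N * T" by (simp add: sum.distrib cE)
  also have "(\<Sum>c\<in>?E. (if c = replicate n 0 then m ^ n else 0)) \<le> m ^ n"
    using m by (simp add: sum.delta finite_vecs)
  finally have total: "(\<Sum>x\<in>?V. real (card (level M \<tau> n x J \<rho> R))) \<le> (1 + N * (2 * real_of_int W + 2 ^ J * real R) / m) * m ^ n"
    by (simp add: T_def algebra_simps)
  have "N * (2 * real_of_int W + 2 ^ J * real R) / m \<le> (2 ^ Suc J + 2 ^ J * real R) * (196/25) ^ n"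
  proof -
    have "N * (2 * real_of_int W) / m \<le> 2 ^ Suc J * (196/25) ^ n"
    proof -
      have "real_of_int W \<le> 2 ^ J * (m * (5/2) ^ n / real \<rho> ^ n)"
        unfolding W_def m_def of_int_mult of_int_power of_int_numeral
        by (intro mult_left_mono width_bounds(1)[OF M0(2) R(1)]) simp
      then have "N * (2 * real_of_int W) / m \<le> N * (2 * (2 ^ J * (m * (5/2) ^ n / real \<rho> ^ n))) / m"
        using m by (intro divide_right_mono mult_left_mono) (auto simp: N_def a_def)
      also have "\<dots> = 2 ^ Suc J * (a * (5/2) / real \<rho>) ^ n"
        using m by (simp add: N_def power_mult_distrib power_divide)
      also have "\<dots> \<le> 2 ^ Suc J * (196/25) ^ n"
      proof (intro mult_left_mono power_mono)
        have "real (125 * (2 * R + 1)) \<le> real (392 * \<rho>)" using R(2) by (simp only: of_nat_le_iff)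
        then show "a * (5/2) / real \<rho> \<le> 196/25" using R(1) by (simp add: a_def field_simps)
      qed (auto simp: a_def)
      finally show ?thesis .
    qed
    moreover have "N * (2 ^ J * real R) / m \<le> 2 ^ J * real R * (196/25) ^ n"
    proof -
      have Dm: "real D ^ n \<le> m" unfolding m_def using D by (metis of_int_le_iff of_int_of_nat_eq of_int_power)
      have "N \<le> (2 * real D) ^ n" unfolding N_def a_def using R(3) by (intro power_mono) auto
      also have "\<dots> = 2 ^ n * real D ^ n" by (simp add: power_mult_distrib)
      also have "\<dots> \<le> (196/25) ^ n * m" using Dm by (intro mult_mono power_mono) auto
      finally have "N / m \<le> (196/25) ^ n" using m by (simp add: pos_divide_le_eq)
      then have "(2 ^ J * real R) * (N / m) \<le> (2 ^ J * real R) * (196/25) ^ n" by (intro mult_left_mono) auto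
      then show ?thesis by (simp add: mult_ac)
    qed
    ultimately show ?thesis by (simp add: distrib_left distrib_right add_divide_distrib)
  qed
  moreover have "(1::real) \<le> (196/25) ^ n" by (intro one_le_power) simp
  moreover have "(1 + 2 ^ Suc J + 2 ^ J * real R) * (196/25) ^ n =
    (196/25) ^ n + (2 ^ Suc J + 2 ^ J * real R) * (196/25) ^ n" by (simp add: distrib_right)
  ultimately have F: "1 + N * (2 * real_of_int W + 2 ^ J * real R) / m \<le> (1 + 2 ^ Suc J + 2 ^ J * real R) * (196/25) ^ n"
    by linarith
  have cap: "(43/5) ^ n / 2 \<le> real_of_int (43 ^ n div 5 ^ n)"
  proof -
    define a b :: int where "a = 43 ^ n" and "b = 5 ^ n"
    have b: "0 < b" by (simp add: b_def)
    have "b \<le> a" unfolding a_def b_def by (intro power_mono) auto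
    then have "1 \<le> a div b" using b by (simp add: pos_imp_zdiv_pos_iff int_one_le_iff_zero_less)
    moreover have "a < b * (a div b) + b" using pos_mod_bound[OF b, of a] minus_mod_eq_mult_div[of a b] by linarith
    moreover have "b * 1 \<le> b * (a div b)" using b \<open>1 \<le> a div b\<close> by (intro mult_left_mono) auto
    ultimately have "a \<le> 2 * (b * (a div b))" by linarith
    then have "real_of_int a \<le> real_of_int (2 * (b * (a div b)))" by (simp only: of_int_le_iff)
    then have "real_of_int a / real_of_int b / 2 \<le> real_of_int (a div b)" using b by (simp add: field_simps)
    then show ?thesis by (simp add: a_def b_def power_divide)
  qed
  have "ratio M n (\<lambda>x. 43 ^ n div 5 ^ n \<le> int (card (level M \<tau> n x J \<rho> R)))
    \<le> (1 + N * (2 * real_of_int W + 2 ^ J * real R) / m) / ((43/5) ^ n / 2)"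
  proof (rule ratio_Markov[OF M0(1), where f = "\<lambda>x. real (card (level M \<tau> n x J \<rho> R))"])
    fix x assume "43 ^ n div 5 ^ n \<le> int (card (level M \<tau> n x J \<rho> R))"
    then have "real_of_int (43 ^ n div 5 ^ n) \<le> real_of_int (int (card (level M \<tau> n x J \<rho> R)))" by (simp only: of_int_le_iff)
    then show "(43/5) ^ n / 2 \<le> real (card (level M \<tau> n x J \<rho> R))" using cap by simp
  qed (use total in \<open>auto simp: m_def\<close>)
  also have "\<dots> \<le> ((1 + 2 ^ Suc J + 2 ^ J * real R) * (196/25) ^ n) / ((43/5) ^ n / 2)"
    by (intro divide_right_mono F) simp
  also have "\<dots> = 2 * (1 + 2 ^ Suc J + 2 ^ J * real R) * (196/215) ^ n"
    by (simp add: field_simps flip: power_mult_distrib power_divide)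
  also have "\<dots> \<le> 2 * (1 + 2 ^ Suc J + 2 ^ J * real R) * (23/25) ^ n"
    by (intro mult_left_mono power_mono) auto
  finally show ?thesis by (simp add: J_def)
qed

text \<open>A union bound over the levels, whose number and constants depend on the radii only and
  are uniform in n, M and \<tau>.\<close>

lemma ratio_good:
  assumes "levels_ok D rs"
  shows "\<exists>C\<ge>0. \<forall>n\<ge>1. \<forall>M \<tau>. 4 ^ n \<le> M \<longrightarrow> int D ^ n \<le> M \<longrightarrow>
     ratio M n (\<lambda>x. \<not> good M \<tau> n x j \<rho> rs) \<le> C * (23/25) ^ n"
  using assms
proof (induction D rs arbitrary: j \<rho> rule: levels_ok.induct)
  case (1 D R R' rs)
  define \<rho>' where "\<rho>' = 2 * R' - R"
  have lo: "R' < R" "R \<le> D" "18 \<le> \<rho>'" "125 * (2 * R' + 1) \<le> 392 * \<rho>'" "levels_ok D (R' # rs)"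
    using 1(2) by (simp_all add: \<rho>'_def)
  have \<rho>'D: "\<rho>' \<le> D" using lo 1(2) by (simp add: \<rho>'_def)
  obtain C where C: "0 \<le> C" "\<And>n M \<tau>. 1 \<le> n \<Longrightarrow> 4 ^ n \<le> M \<Longrightarrow> int D ^ n \<le> M \<Longrightarrow>
     ratio M n (\<lambda>x. \<not> good M \<tau> n x (Suc j) \<rho>' (R' # rs)) \<le> C * (23/25) ^ n"
    using 1(1)[OF lo(5), of "Suc j" \<rho>'] by blast
  define C1 where "C1 = 2 * (1 + 2 ^ Suc (Suc j) + 2 ^ Suc j * real R')"
  have main: "ratio M n (\<lambda>x. \<not> good M \<tau> n x j \<rho> (R # R' # rs)) \<le> (3 * real \<rho>' + (C1 + C)) * (23/25) ^ n"
    if n: "1 \<le> n" and M: "4 ^ n \<le> M" "int D ^ n \<le> M" for n M \<tau>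
  proof -
    have "(4::int) ^ 1 \<le> 4 ^ n" using n by (intro power_increasing) auto
    then have M4: "4 \<le> M" using M by simp
    have \<rho>M: "int \<rho>' ^ n \<le> M" using power_mono[of "int \<rho>'" "int D" n] \<rho>'D M(2) by simp
    let ?A = "\<lambda>x. \<not> covers M (int \<rho>') (width M n \<rho>') x"
    let ?B = "\<lambda>x. 43 ^ n div 5 ^ n \<le> int (card (level M \<tau> n x (Suc j) \<rho>' R'))"
    let ?C = "\<lambda>x. \<not> good M \<tau> n x (Suc j) \<rho>' (R' # rs)"
    have "ratio M n (\<lambda>x. \<not> good M \<tau> n x j \<rho> (R # R' # rs)) \<le> ratio M n (\<lambda>x. ?A x \<or> (?B x \<or> ?C x))"
      using M4 by (intro ratio_mono) (auto simp: \<rho>'_def)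
    also have "\<dots> \<le> ratio M n ?A + (ratio M n ?B + ratio M n ?C)"
      using M4 ratio_disj[of M n ?A "\<lambda>x. ?B x \<or> ?C x"] ratio_disj[of M n ?B ?C] by simp
    also have "\<dots> \<le> 3 * real \<rho>' * (4/5) ^ n + (C1 * (23/25) ^ n + C * (23/25) ^ n)"
    proof (intro add_mono)
      show "ratio M n ?A \<le> 3 * real \<rho>' * (4/5) ^ n" by (rule ratio_covers[OF n M4 lo(3) \<rho>M])
      show "ratio M n ?B \<le> C1 * (23/25) ^ n" unfolding C1_def
        by (rule ratio_level[OF n M4 _ lo(4) _ M(2)]) (use lo in auto)
      show "ratio M n ?C \<le> C * (23/25) ^ n" by (rule C(2)[OF n M])
    qed
    also have "\<dots> \<le> 3 * real \<rho>' * (23/25) ^ n + (C1 * (23/25) ^ n + C * (23/25) ^ n)"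
      by (intro add_right_mono mult_left_mono power_mono) auto
    finally show ?thesis by (simp add: algebra_simps)
  qed
  show ?case
    by (rule exI[of _ "3 * real \<rho>' + (C1 + C)"]) (use main C(1) in \<open>auto simp: C1_def\<close>)
qed (auto intro!: exI[of _ 0] simp: ratio_def)

subsection \<open>Running time and success probability\<close>

lemma log2_bounds:
  assumes "0 < (y::real)"
  shows "2 ^ a \<le> y ^ b \<Longrightarrow> real a \<le> real b * log 2 y" "y ^ b \<le> 2 ^ a \<Longrightarrow> real b * log 2 y \<le> real a"
  using assms log_le_cancel_iff[of 2 "2 ^ a" "y ^ b"] log_le_cancel_iff[of 2 "y ^ b" "2 ^ a"]
  by (simp_all add: log_nat_power)

text \<open>The square of the constant is 648 pi e, between 5533.6 and 5533.8. Its logarithm is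
  enclosed by comparing integer powers: 373/30 and 286/23 are rational approximations from below and
  above.\<close>

lemma constant_bounds:
  defines "X \<equiv> 18 * sqrt (2 * pi * exp 1)"
  shows "1849/25 \<le> X" "\<bar>log 2 X - 6.217\<bar> \<le> 0.0005"
proof -
  define Y where "Y = 648 * pi * exp (1::real)"
  have e: "2.71828 \<le> exp (1::real)" "exp (1::real) \<le> 2.71829"
  proof -
    have "exp (1::real) \<le> 5837465777 / 2147483648 + inverse (2 ^ 32)" "5837465777 / 2147483648 - inverse (2 ^ 32) \<le> exp (1::real)"
      using e_approx_32 by linarith+
    then show "2.71828 \<le> exp (1::real)" "exp (1::real) \<le> 2.71829" by simp_all
  qed
  have p: "3.14159 \<le> pi" "pi \<le> 3.1416" using pi_approx by simp_all
  have "3.14159 * 2.71828 \<le> pi * exp 1" "pi * exp 1 \<le> 3.1416 * 2.71829"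
    using p e by (intro mult_mono; simp)+
  then have Y: "5533.6 \<le> Y" "Y \<le> 5533.8" by (simp_all add: Y_def)
  have X2: "X\<^sup>2 = Y" by (simp add: X_def Y_def power_mult_distrib)
  have X0: "0 \<le> X" by (simp add: X_def)
  have "(1849/25)\<^sup>2 \<le> X\<^sup>2" unfolding X2 using Y by (simp add: power2_eq_square)
  then show X1: "1849/25 \<le> X" using X0 by (rule power2_le_imp_le)
  have "log 2 Y = 2 * log 2 X" unfolding X2[symmetric] using X1 by (simp add: log_nat_power)
  moreover have "373 \<le> 30 * log 2 Y"
  proof -
    have "(2::real) ^ 373 \<le> 5533.6 ^ 30" by (simp add: power_divide)
    also have "\<dots> \<le> Y ^ 30" using Y by (intro power_mono) auto
    finally show ?thesis using log2_bounds(1)[of Y 373 30] Y by simp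
  qed
  moreover have "23 * log 2 Y \<le> 286"
  proof -
    have "Y ^ 23 \<le> 5533.8 ^ 23" using Y by (intro power_mono) auto
    also have "\<dots> \<le> (2::real) ^ 286" by (simp add: power_divide)
    finally show ?thesis using log2_bounds(2)[of Y 23 286] Y by simp
  qed
  ultimately have "373 \<le> 60 * log 2 X" "23 * log 2 X \<le> 143" by linarith+
  moreover have "0.0005 = (1 / 2000 :: real)" "6.217 = (6217 / 1000 :: real)" by simp_all
  ultimately have "log 2 X - 6.217 \<le> 0.0005" "- (log 2 X - 6.217) \<le> 0.0005" by linarith+
  then show "\<bar>log 2 X - 6.217\<bar> \<le> 0.0005" by (rule abs_leI)
qed

text \<open>With X = M + |\<tau>| + 2 \<ge> 4^n one has a^n \<le> X^a for every natural number a, so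
  the exponent only has to exceed the bases that occur, 4 d + 1 and 43 among them, with some room
  for products.\<close>

definition word_exponent :: "nat \<Rightarrow> nat" where "word_exponent d = 4 * d + 50"

lemma instance_word_bound:
  assumes M: "4 ^ n \<le> M" and x: "x \<in> input_vectors n M"
  shows "instance_data d n M \<tau> ((M + \<bar>\<tau>\<bar> + 2) ^ word_exponent d) x"
proof -
  define X where "X = M + \<bar>\<tau>\<bar> + 2"
  have M0: "0 < M" by (rule less_le_trans[OF _ M]) simp
  have X: "4 ^ n \<le> X" "M \<le> X" "\<bar>\<tau>\<bar> \<le> X" "2 \<le> X" using M M0 by (auto simp: X_def)
  have up: "X ^ i \<le> X ^ word_exponent d" if "i \<le> word_exponent d" for i
    using that X by (intro power_increasing) auto
  have two: "2 ^ a \<le> X ^ a" for a using X by (intro power_mono) auto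
  have pw: "int a ^ n \<le> X ^ a" for a
  proof -
    have "a < 2 ^ a" by (rule less_exp)
    also have "\<dots> \<le> 4 ^ a" by (intro power_mono) auto
    finally have "int a \<le> int (4 ^ a)" by (intro of_nat_mono) simp
    then have "int a ^ n \<le> (4 ^ a) ^ n" by (intro power_mono) auto
    also have "\<dots> = (4 ^ n) ^ a" by (simp flip: power_mult add: mult.commute)
    also have "\<dots> \<le> X ^ a" using X by (intro power_mono) auto
    finally show ?thesis .
  qed
  show ?thesis unfolding X_def[symmetric]
  proof (unfold_locales)
    show "4 ^ n \<le> M" "x \<in> input_vectors n M" by (rule M, rule x)
    have "base d ^ n \<le> X ^ (4 * d + 1)" using pw[of "4 * d + 1"] by (simp add: base_def add.commute)
    also have "\<dots> \<le> X ^ word_exponent d" by (rule up) (simp add: word_exponent_def)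
    finally show "base d ^ n \<le> X ^ word_exponent d" .
    have "int n + 1 \<le> 4 ^ n" by (induction n) auto
    moreover have "2 * int d + 1 \<le> 2 ^ (2 * d + 1)"
    proof -
      have "2 * d + 1 < 2 ^ (2 * d + 1)" by (rule less_exp)
      then have "int (2 * d + 1) \<le> int (2 ^ (2 * d + 1))" by (intro of_nat_mono) simp
      then show ?thesis by simp
    qed
    ultimately have "(int n + 1) * (2 * int d + 1) * M \<le> X * X ^ (2 * d + 1) * X"
      using X two[of "2 * d + 1"] M0 by (intro mult_mono) (auto intro: order_trans)
    also have "\<dots> = X ^ (2 * d + 3)" by (simp add: eval_nat_numeral)
    also have "\<dots> \<le> X ^ word_exponent d" by (rule up) (simp add: word_exponent_def)
    finally show "(int n + 1) * (2 * int d + 1) * M \<le> X ^ word_exponent d" .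
    show "\<bar>\<tau>\<bar> \<le> X ^ word_exponent d" using X(3) up[of 1] by (simp add: word_exponent_def)
    show "43 ^ n \<le> X ^ word_exponent d" using pw[of 43] up[of 43] by (simp add: word_exponent_def)
    have "2 ^ d * (M * 5 ^ n) \<le> X ^ d * (X * X ^ 5)"
      using X two[of d] pw[of 5] M0 by (intro mult_mono) auto
    also have "\<dots> = X ^ (d + 6)" by (simp add: power_add eval_nat_numeral)
    also have "\<dots> \<le> X ^ word_exponent d" by (rule up) (simp add: word_exponent_def)
    finally show "2 ^ d * (M * 5 ^ n) \<le> X ^ word_exponent d" .
    have "(2 * (int d + 1)) ^ n \<le> X ^ (2 * (d + 1))" using pw[of "2 * (d + 1)"] by (simp add: add.commute)
    also have "\<dots> \<le> X ^ word_exponent d" by (rule up) (simp add: word_exponent_def)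
    finally show "(2 * (int d + 1)) ^ n \<le> X ^ word_exponent d" .
  qed
qed

definition time_bound :: "nat \<Rightarrow> nat \<Rightarrow> real" where
  "time_bound d n = (400 + (real d + 1) * ((real d + 1) * 6000 + 20)) * ((real n + 1) * (18 * sqrt (2 * pi * exp 1)) ^ n)"

lemma (in instance_data) time_le:
  "real (400 * (n + 1) + (d + 1) * ((d + 1) * level_time + 20)) \<le> time_bound d n"
proof -
  define X where "X = 18 * sqrt (2 * pi * exp 1)"
  define P where "P = (real n + 1) * X ^ n"
  have X: "1849/25 \<le> X" using constant_bounds(1) by (simp add: X_def)
  have "73 ^ n \<le> X ^ n" using X by (intro power_mono) auto
  moreover have "real (nat cap ^ 2) \<le> X ^ n"
  proof -
    have "5 ^ n * cap \<le> 43 ^ n"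
    proof -
      define a b :: int where "a = 43 ^ n" and "b = 5 ^ n"
      have "b * (a div b) \<le> a"
      proof -
        have "0 \<le> a mod b" by (rule pos_mod_sign) (simp add: b_def)
        then show ?thesis using minus_mod_eq_mult_div[of a b] by linarith
      qed
      then show ?thesis by (simp add: cap_def a_def b_def)
    qed
    then have "real_of_int (5 ^ n * cap) \<le> real_of_int (43 ^ n)" by (simp only: of_int_le_iff)
    then have "real_of_int cap \<le> (43/5) ^ n" by (simp add: power_divide pos_le_divide_eq mult.commute)
    then have "(real_of_int cap)\<^sup>2 \<le> ((43/5) ^ n)\<^sup>2" using cap_bounds by (intro power_mono) auto
    also have "\<dots> = (1849/25) ^ n" by (simp add: power2_eq_square flip: power_mult_distrib)
    also have "\<dots> \<le> X ^ n" using X by (intro power_mono) auto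
    finally show ?thesis using cap_bounds by simp
  qed
  ultimately have "real (73 ^ n + nat cap ^ 2) \<le> 2 * X ^ n" by simp
  then have "3000 * (real n + 1) * real (73 ^ n + nat cap ^ 2) \<le> 3000 * (real n + 1) * (2 * X ^ n)"
    by (intro mult_left_mono) auto
  then have level_time: "real level_time \<le> 6000 * P" by (simp add: level_time_def P_def algebra_simps)
  have "1 \<le> X ^ n" using X by (intro one_le_power) auto
  then have "(real n + 1) * 1 \<le> P" unfolding P_def by (intro mult_left_mono) auto
  then have P: "real n + 1 \<le> P" "1 \<le> P" by auto
  have "real (400 * (n + 1) + (d + 1) * ((d + 1) * level_time + 20)) = 400 * (real n + 1) + (real d + 1) * ((real d + 1) * real level_time + 20)"
    by (simp add: algebra_simps)
  also have "\<dots> \<le> 400 * P + (real d + 1) * ((real d + 1) * (6000 * P) + 20 * P)"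
    using P level_time by (intro add_mono mult_left_mono) auto
  also have "\<dots> = time_bound d n" by (simp add: time_bound_def P_def X_def algebra_simps)
  finally show ?thesis .
qed

lemma time_bound_soft_O: "time_bound d \<in> soft_O (\<lambda>n. (18 * sqrt (2 * pi * exp 1)) ^ n)"
proof -
  define X where "X = 18 * sqrt (2 * pi * exp 1)"
  define K where "K = 400 + (real d + 1) * ((real d + 1) * 6000 + 20)"
  have X: "0 \<le> X" by (simp add: X_def)
  have K: "0 \<le> K" by (simp add: K_def)
  have "time_bound d \<in> O(\<lambda>n. real n ^ 1 * X ^ n)"
  proof (rule bigoI[of _ "2 * K"])
    show "\<forall>\<^sub>F n in sequentially. norm (time_bound d n) \<le> 2 * K * norm (real n ^ 1 * X ^ n)"
      using eventually_ge_at_top[of 1]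
    proof eventually_elim
      case (elim n)
      have "norm (time_bound d n) = K * ((real n + 1) * X ^ n)"
        unfolding time_bound_def X_def[symmetric] K_def[symmetric] using K X by simp
      also have "\<dots> \<le> K * ((2 * real n) * X ^ n)"
        using elim K X by (intro mult_left_mono mult_right_mono) auto
      also have "\<dots> = 2 * K * norm (real n ^ 1 * X ^ n)" using X by simp
      finally show ?case .
    qed
  qed
  then show ?thesis unfolding soft_O_def X_def by blast
qed

text \<open>\<open>U\<close> bounds the cells and \<open>U ^ k\<close> the intermediate values, so
  the two exponents multiply to \<open>\<kappa>\<close>. The statement concerns each single
  instance; all that is random is confined to \<open>good\<close> and
  \<open>solvable\<close>.\<close>

lemma solver_correct:
  "\<exists>\<kappa>. \<forall>n M \<tau> x. 4 ^ n \<le> M \<longrightarrow> x \<in> input_vectors n M \<longrightarrow>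
     (\<exists>t ans. answers_in_time (solver d) \<kappa> M \<tau> x t ans \<and> real t \<le> time_bound d n \<and>
       (\<forall>D\<le>d. good M \<tau> n x 0 1 (radii D) \<longrightarrow> D = d \<or> solvable {- int D..int D} \<tau> x \<longrightarrow>
          correct_answer {- int d..int d} x \<tau> ans))"
proof -
  obtain k where k: "\<And>U. U \<ge> 2 \<Longrightarrow> psafe U (U ^ k) (solver d)" using psafe_ex[of "solver d"] by blast
  have "\<exists>t ans. answers_in_time (solver d) (word_exponent d * k) M \<tau> x t ans \<and> real t \<le> time_bound d n \<and>
       (\<forall>D\<le>d. good M \<tau> n x 0 1 (radii D) \<longrightarrow> D = d \<or> solvable {- int D..int D} \<tau> x \<longrightarrow>
          correct_answer {- int d..int d} x \<tau> ans)"
    if M: "4 ^ n \<le> M" and x: "x \<in> input_vectors n M" for n M \<tau> x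
  proof -
    define U where "U = (M + \<bar>\<tau>\<bar> + 2) ^ word_exponent d"
    interpret instance_data d n M \<tau> U x unfolding U_def by (rule instance_word_bound[OF M x])
    have X: "2 \<le> M + \<bar>\<tau>\<bar> + 2" using M_pos by simp
    have "(M + \<bar>\<tau>\<bar> + 2) ^ 1 \<le> U" unfolding U_def using X
      by (intro power_increasing) (auto simp: word_exponent_def)
    then have "2 \<le> U" using X by simp
    then have "psafe U (U ^ k) (solver d)" by (rule k)
    moreover have "U ^ k = word_bound (word_exponent d * k) M \<tau>" by (simp add: word_bound_def U_def power_mult)
    ultimately obtain t m where level_time: "exec (word_bound (word_exponent d * k) M \<tau>) (solver d) (input_memory M \<tau> x) t m"
      "t \<le> 400 * (n + 1) + (d + 1) * ((d + 1) * level_time + 20)" "answer_spec (output_answer n m)"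
      using runs_solver bnd_input unfolding runs_def by metis
    have "answers_in_time (solver d) (word_exponent d * k) M \<tau> x t (output_answer n m)"
      unfolding answers_in_time_def len using level_time(1) by blast
    moreover have "real t \<le> time_bound d n" using time_le of_nat_mono[OF level_time(2), where 'a = real] by linarith
    ultimately show ?thesis using answer_correct[OF level_time(3)] by blast
  qed
  then show ?thesis by blast
qed

section \<open>From counting to the asymptotic statement\<close>

lemma success_prob_ratio:
  assumes "0 < M"
  shows "success_prob p \<kappa> C n M \<tau> = 1 - ratio M n (\<lambda>x. \<not> succeeds p \<kappa> C M \<tau> x)"
proof -
  let ?I = "input_vectors n M" and ?S = "{x. succeeds p \<kappa> C M \<tau> x}"
  have card: "real (card ?I) = real_of_int M ^ n" using assms by (intro card_input_vectors) simp
  have "success_prob p \<kappa> C n M \<tau> = real (card (?I \<inter> ?S)) / real (card ?I)"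
    unfolding success_prob_def
    by (rule measure_pmf_of_set[OF input_vectors_nonempty[OF assms] finite_input_vectors])
  moreover have "card ?I = card (?I \<inter> ?S) + card {x \<in> ?I. \<not> succeeds p \<kappa> C M \<tau> x}"
    by (subst card_Un_disjoint[symmetric]) (auto simp: finite_input_vectors intro!: arg_cong[where f = card])
  then have "real (card (?I \<inter> ?S)) = real (card ?I) - real (card {x \<in> ?I. \<not> succeeds p \<kappa> C M \<tau> x})" by simp
  ultimately show ?thesis using assms by (simp add: ratio_def card diff_divide_distrib)
qed

text \<open>Half of the decay rate is given away: for x = exp (- c) the two exponentials are at most
  x^(2 n) up to a factor 2, and one factor x^n absorbs the constants and the polynomial.\<close>

lemma exponential_decay:
  fixes A B :: real
  assumes "0 < s"
  shows "\<exists>c>0. \<forall>\<^sub>F n in sequentially. A * (23/25) ^ n + B * real (n + 1) * (11/12) ^ (n div s) \<le> exp (- (c * real n))"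
proof -
  define c where "c = min (ln (12/11) / real s) (ln (25/23)) / 2"
  have c: "0 < c" using assms by (simp add: c_def)
  define K where "K = \<bar>A\<bar> + 2 * \<bar>B\<bar>"
  define x where "x = exp (- c)"
  have x: "0 < x" "x < 1" using c by (auto simp: x_def)
  have 1: "(23/25) ^ n \<le> x ^ n * x ^ n" for n
  proof -
    have "2 * c \<le> ln (25/23)" by (simp add: c_def)
    then have "- ln (25/23) \<le> - c + - c" by simp
    then have "exp (- ln (25/23)) \<le> x * x" unfolding x_def by (simp flip: exp_add)
    then have "(23/25) \<le> x * x" by (simp add: exp_minus)
    then have "(23/25) ^ n \<le> (x * x) ^ n" by (intro power_mono) auto
    then show ?thesis by (simp add: power_mult_distrib)
  qed
  have 2: "(11/12) ^ (n div s) \<le> 2 * (x ^ n * x ^ n)" for n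
  proof -
    have "2 * c \<le> ln (12/11) / real s" by (simp add: c_def)
    then have "2 * c * real s \<le> ln (12/11)" using assms by (simp add: pos_le_divide_eq)
    then have "- ln (12/11) \<le> - (2 * c * real s)" by simp
    then have "exp (- ln (12/11)) \<le> exp (- (2 * c * real s))" by simp
    then have e: "11/12 \<le> exp (- (2 * c * real s))" by (simp add: exp_minus)
    \<comment> \<open>Raising the exponent by 1 costs at most a factor 2 and turns the rounded
      quotient into an upper bound for n / s.\<close>
    have "(11/12 :: real) ^ (n div s) \<le> 2 * (11/12) ^ Suc (n div s)" by simp
    also have "\<dots> \<le> 2 * exp (- (2 * c * real s)) ^ Suc (n div s)"
      using e by (intro mult_left_mono power_mono) auto
    also have "exp (- (2 * c * real s)) ^ Suc (n div s) = exp (real (Suc (n div s)) * (- (2 * c * real s)))"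
      by (rule exp_of_nat_mult[symmetric])
    also have "\<dots> \<le> exp (- (2 * c * real n))"
    proof -
      have "n < s * Suc (n div s)" using assms dividend_less_times_div[of s n] by simp
      then have "real n \<le> real (s * Suc (n div s))" by (intro of_nat_mono) simp
      then have "real n \<le> real s * real (Suc (n div s))" by (simp only: of_nat_mult)
      then have "2 * c * real n \<le> 2 * c * (real s * real (Suc (n div s)))" using c by (intro mult_left_mono) auto
      then show ?thesis by (simp add: mult_ac)
    qed
    also have "exp (- (2 * c * real n)) = x ^ n * x ^ n"
      unfolding x_def by (simp flip: exp_of_nat_mult exp_add add: algebra_simps)
    finally show ?thesis by simp
  qed
  have "(\<lambda>n. K * (real n * x ^ n + x ^ n)) \<longlonglongrightarrow> K * (0 + 0)"
    using x by (intro tendsto_intros powser_times_n_limit_0 LIMSEQ_power_zero) auto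
  then have "\<forall>\<^sub>F n in sequentially. K * (real n * x ^ n + x ^ n) < 1"
    by (intro order_tendstoD) auto
  then have "\<forall>\<^sub>F n in sequentially. A * (23/25) ^ n + B * real (n + 1) * (11/12) ^ (n div s) \<le> exp (- (c * real n))"
  proof eventually_elim
    case (elim n)
    define y where "y = x ^ n"
    have y: "0 \<le> y" using x by (simp add: y_def)
    have "A * (23/25) ^ n \<le> \<bar>A\<bar> * (y * y)" using 1[of n] by (intro mult_mono) (auto simp: y_def)
    also have "\<dots> \<le> \<bar>A\<bar> * (real (n + 1) * (y * y))"
      using mult_right_mono[of 1 "real (n + 1)" "y * y"] by (intro mult_left_mono) auto
    finally have a: "A * (23/25) ^ n \<le> \<bar>A\<bar> * (real (n + 1) * (y * y))" .
    have "B * real (n + 1) * (11/12) ^ (n div s) \<le> (\<bar>B\<bar> * real (n + 1)) * (2 * (y * y))"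
      using 2[of n] by (intro mult_mono mult_right_mono) (auto simp: y_def)
    with a have "A * (23/25) ^ n + B * real (n + 1) * (11/12) ^ (n div s) \<le> (K * (real n * y + y)) * y"
      by (simp add: K_def algebra_simps)
    also have "\<dots> \<le> 1 * y" using elim y by (intro mult_right_mono) (auto simp: y_def)
    also have "1 * y = exp (- (c * real n))" by (simp add: y_def x_def mult.commute flip: exp_of_nat_mult)
    finally show ?case .
  qed
  then show ?thesis using c by blast
qed

text \<open>For a fixed radius D, failure means that the instance is not good for D or, if D is not
  d, that it has no solution of radius D. The constants and the threshold for n are uniform in M and
  \<tau>, which both vary with n later on.\<close>

lemma solver_fails:
  fixes d D :: nat
  assumes \<kappa>: "\<And>n M \<tau> x. 4 ^ n \<le> M \<Longrightarrow> x \<in> input_vectors n M \<Longrightarrow>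
     (\<exists>t ans. answers_in_time (solver d) \<kappa> M \<tau> x t ans \<and>
       (\<forall>D\<le>d. good M \<tau> n x 0 1 (radii D) \<longrightarrow> D = d \<or> solvable {- int D..int D} \<tau> x \<longrightarrow>
          correct_answer {- int d..int d} x \<tau> ans))"
    and D: "D \<le> d"
  shows "\<exists>c>0. \<exists>\<eta>>0. \<forall>\<^sub>F n in sequentially. \<forall>M \<tau>. 4 ^ n \<le> M \<longrightarrow> int D ^ n \<le> M \<longrightarrow>
     D = d \<or> (1 \<le> D \<and> 3 ^ n * M \<le> 2 ^ n * (2 * int D + 1) ^ n \<and> real_of_int \<bar>\<tau>\<bar> \<le> \<eta> * real n * real_of_int M) \<longrightarrow>
     ratio M n (\<lambda>x. \<not> succeeds (solver d) \<kappa> {- int d..int d} M \<tau> x) \<le> exp (- (c * real n))"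
proof -
  obtain A where A: "0 \<le> A" "\<And>n M \<tau>. 1 \<le> n \<Longrightarrow> 4 ^ n \<le> M \<Longrightarrow> int D ^ n \<le> M \<Longrightarrow>
     ratio M n (\<lambda>x. \<not> good M \<tau> n x 0 1 (radii D)) \<le> A * (23/25) ^ n"
    using ratio_good[OF levels_ok_radii[of D D], of 0 1] by auto
  obtain s \<eta> B n0 where s: "0 < s" and \<eta>: "0 < \<eta>" and B: "\<And>n M \<tau>. 1 \<le> D \<Longrightarrow> n0 \<le> n \<Longrightarrow> 4 ^ n \<le> M \<Longrightarrow>
    3 ^ n * M \<le> 2 ^ n * (2 * int D + 1) ^ n \<Longrightarrow> real_of_int \<bar>\<tau>\<bar> \<le> \<eta> * real n * real_of_int M \<Longrightarrow>
    ratio M n (\<lambda>x. \<not> solvable {- int D..int D} \<tau> x) \<le> B * real (n + 1) * (11/12) ^ (n div s)"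
  proof (cases "1 \<le> D")
    case True
    then show ?thesis using exists_whp[OF True] that by metis
  next
    case False
    then show ?thesis using that[of 1 1] by auto
  qed
  obtain c where c: "0 < c" "\<forall>\<^sub>F n in sequentially. A * (23/25) ^ n + \<bar>B\<bar> * real (n + 1) * (11/12) ^ (n div s) \<le> exp (- (c * real n))"
    using exponential_decay[OF s] by blast
  have "\<forall>\<^sub>F n in sequentially. \<forall>M \<tau>. 4 ^ n \<le> M \<longrightarrow> int D ^ n \<le> M \<longrightarrow>
     D = d \<or> (1 \<le> D \<and> 3 ^ n * M \<le> 2 ^ n * (2 * int D + 1) ^ n \<and> real_of_int \<bar>\<tau>\<bar> \<le> \<eta> * real n * real_of_int M) \<longrightarrow>
     ratio M n (\<lambda>x. \<not> succeeds (solver d) \<kappa> {- int d..int d} M \<tau> x) \<le> exp (- (c * real n))"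
    using c(2) eventually_ge_at_top[of "max 1 n0"]
  proof eventually_elim
    case (elim n)
    then have n: "1 \<le> n" "n0 \<le> n" by auto
    show ?case
    proof (intro allI impI)
      fix M \<tau> assume M: "4 ^ n \<le> M" "int D ^ n \<le> M" and
        or: "D = d \<or> (1 \<le> D \<and> 3 ^ n * M \<le> 2 ^ n * (2 * int D + 1) ^ n \<and> real_of_int \<bar>\<tau>\<bar> \<le> \<eta> * real n * real_of_int M)"
      have M0: "0 < M" by (rule less_le_trans[OF _ M(1)]) simp
      let ?F = "\<lambda>x. \<not> succeeds (solver d) \<kappa> {- int d..int d} M \<tau> x"
      let ?G = "\<lambda>x. \<not> good M \<tau> n x 0 1 (radii D)" and ?S = "\<lambda>x. D \<noteq> d \<and> \<not> solvable {- int D..int D} \<tau> x"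
      have "ratio M n ?F \<le> ratio M n (\<lambda>x. ?G x \<or> ?S x)"
      proof (rule ratio_mono[OF M0])
        fix x assume x: "x \<in> input_vectors n M" and F: "?F x"
        show "?G x \<or> ?S x"
        proof (rule ccontr)
          assume "\<not> (?G x \<or> ?S x)"
          with \<kappa>[OF M(1) x, of \<tau>] D obtain t ans where "answers_in_time (solver d) \<kappa> M \<tau> x t ans"
            "correct_answer {- int d..int d} x \<tau> ans" by blast
          then show False using F by (auto simp: succeeds_def)
        qed
      qed
      also have "\<dots> \<le> ratio M n ?G + ratio M n ?S" by (rule ratio_disj[OF M0])
      also have "\<dots> \<le> A * (23/25) ^ n + \<bar>B\<bar> * real (n + 1) * (11/12) ^ (n div s)"
      proof (rule add_mono[OF A(2)[OF n(1) M]])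
        show "ratio M n ?S \<le> \<bar>B\<bar> * real (n + 1) * (11/12) ^ (n div s)"
        proof (cases "D = d")
          case True
          then have "ratio M n ?S \<le> 0" by (intro ratio_zero) simp
          also have "0 \<le> \<bar>B\<bar> * real (n + 1) * (11/12) ^ (n div s)" by simp
          finally show ?thesis .
        next
          case False
          have "ratio M n ?S \<le> ratio M n (\<lambda>x. \<not> solvable {- int D..int D} \<tau> x)"
            by (rule ratio_mono[OF M0]) simp
          also have "\<dots> \<le> B * real (n + 1) * (11/12) ^ (n div s)" using or False M n by (intro B) auto
          also have "\<dots> \<le> \<bar>B\<bar> * real (n + 1) * (11/12) ^ (n div s)" by (intro mult_right_mono) auto
          finally show ?thesis .
        qed
      qed
      also have "\<dots> \<le> exp (- (c * real n))" by (rule elim(1))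
      finally show "ratio M n ?F \<le> exp (- (c * real n))" .
    qed
  qed
  then show ?thesis using c(1) \<eta> by blast
qed

text \<open>If solutions are not abundant for any radius up to \<open>d\<close>, the search has to be complete up to \<open>d\<close>
  itself. The bounds on the levels require the last radius to be at most \<open>M\<close> to the power \<open>1 / n\<close>.\<close>

lemma radius_choice:
  fixes d :: nat
  assumes n: "1 \<le> n" and M: "4 ^ n \<le> M"
  shows "\<exists>D\<le>d. int D ^ n \<le> M \<and> (D = d \<or> 1 \<le> D \<and> 3 ^ n * M \<le> 2 ^ n * (2 * int D + 1) ^ n)"
proof -
  define dense where "dense D \<longleftrightarrow> 3 ^ n * M \<le> 2 ^ n * (2 * int D + 1) ^ n" for D :: nat
  have M0: "0 < M" using M by (meson less_le_trans zero_less_numeral zero_less_power)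
  \<comment> \<open>Sparseness at D' says that M exceeds (2/3 (2 D' + 1))^n. This dominates D^n for
    D' = D, and also for D' = D - 1 as soon as D is at least 2.\<close>
  have small: "int D ^ n \<le> M" if "3 * int D \<le> 2 * (2 * int D' + 1)" "\<not> dense D'" for D D' :: nat
  proof -
    have "3 ^ n * int D ^ n = (3 * int D) ^ n" by (simp add: power_mult_distrib)
    also have "\<dots> \<le> (2 * (2 * int D' + 1)) ^ n" using that(1) by (intro power_mono) auto
    also have "\<dots> = 2 ^ n * (2 * int D' + 1) ^ n" by (rule power_mult_distrib)
    also have "\<dots> \<le> 3 ^ n * M" using that(2) by (simp add: dense_def)
    finally show ?thesis by simp
  qed
  show ?thesis
  proof (cases "\<exists>D\<le>d. dense D")
    case False
    then have "int d ^ n \<le> M" by (intro small[of d d]) auto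
    then show ?thesis by blast
  next
    case True
    \<comment> \<open>The least dense radius: solutions abound for it, and sparseness of its
      predecessor bounds it by M to the power 1 / n.\<close>
    define D where "D = (LEAST D. dense D)"
    have D: "dense D" using True LeastI_ex[of dense] by (auto simp: D_def)
    have Dd: "D \<le> d" using True Least_le[of dense] order_trans by (fastforce simp: D_def)
    have "D \<noteq> 0"
    proof
      assume "D = 0"
      then have "3 ^ n * M \<le> 2 ^ n" using D by (simp add: dense_def)
      moreover have "(2::int) ^ n < 3 ^ n" using n by (intro power_strict_mono) auto
      moreover have "3 ^ n * 1 \<le> 3 ^ n * M" using M0 by (intro mult_left_mono) auto
      ultimately show False by linarith
    qed
    have "\<not> dense (D - 1)" using \<open>D \<noteq> 0\<close> not_less_Least[of "D - 1" dense] by (simp add: D_def)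
    have "int D ^ n \<le> M"
    proof (cases "D = 1")
      case True
      then show ?thesis using M0 by simp
    next
      case False
      then show ?thesis using \<open>D \<noteq> 0\<close> \<open>\<not> dense (D - 1)\<close> by (intro small[of D "D - 1"]) auto
    qed
    then show ?thesis using D Dd \<open>D \<noteq> 0\<close> by (auto simp: dense_def intro!: exI[of _ D])
  qed
qed

theorem theorem5p6:
  fixes d :: nat
  shows "(\<exists>p \<kappa>.
      (\<exists>T \<in> soft_O (\<lambda>n. (18 * sqrt (2 * pi * exp 1)) ^ n). runs_in_time p \<kappa> T) \<and>
      (\<forall>(M :: nat \<Rightarrow> int) (\<tau> :: nat \<Rightarrow> int).
         (\<forall>n. 4 ^ n \<le> M n) \<longrightarrow>
         (\<lambda>n. real_of_int (\<tau> n)) \<in> o(\<lambda>n. real n * real_of_int (M n)) \<longrightarrow>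
         (\<exists>c > 0. \<forall>\<^sub>F n in sequentially.
            success_prob p \<kappa> {- int d..int d} n (M n) (\<tau> n) \<ge> 1 - exp (- (c * real n)))))
    \<and> \<bar>log 2 (18 * sqrt (2 * pi * exp 1)) - 6.217\<bar> \<le> 0.0005"
proof -
  obtain \<kappa> where \<kappa>: "\<And>n M \<tau> x. 4 ^ n \<le> M \<Longrightarrow> x \<in> input_vectors n M \<Longrightarrow>
     (\<exists>t ans. answers_in_time (solver d) \<kappa> M \<tau> x t ans \<and> real t \<le> time_bound d n \<and>
       (\<forall>D\<le>d. good M \<tau> n x 0 1 (radii D) \<longrightarrow> D = d \<or> solvable {- int D..int D} \<tau> x \<longrightarrow>
          correct_answer {- int d..int d} x \<tau> ans))"
    using solver_correct[of d] by blast
  have time: "runs_in_time (solver d) \<kappa> (time_bound d)"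
    unfolding runs_in_time_def using \<kappa> by meson
  \<comment> \<open>The two constants are packed into a pair so that one application of choice
    selects both for every radius.\<close>
  have fails: "\<forall>D\<in>{..d}. \<exists>p :: real \<times> real. 0 < fst p \<and> 0 < snd p \<and> (\<forall>\<^sub>F n in sequentially. \<forall>M \<tau>. 4 ^ n \<le> M \<longrightarrow> int D ^ n \<le> M \<longrightarrow>
     D = d \<or> (1 \<le> D \<and> 3 ^ n * M \<le> 2 ^ n * (2 * int D + 1) ^ n \<and> real_of_int \<bar>\<tau>\<bar> \<le> snd p * real n * real_of_int M) \<longrightarrow>
     ratio M n (\<lambda>x. \<not> succeeds (solver d) \<kappa> {- int d..int d} M \<tau> x) \<le> exp (- (fst p * real n)))"
  proof
    fix D assume "D \<in> {..d}"
    then have "D \<le> d" by simp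
    from solver_fails[OF _ this, of \<kappa>] \<kappa> obtain c \<eta> where "0 < c" "0 < \<eta>" "\<forall>\<^sub>F n in sequentially. \<forall>M \<tau>. 4 ^ n \<le> M \<longrightarrow> int D ^ n \<le> M \<longrightarrow>
     D = d \<or> (1 \<le> D \<and> 3 ^ n * M \<le> 2 ^ n * (2 * int D + 1) ^ n \<and> real_of_int \<bar>\<tau>\<bar> \<le> \<eta> * real n * real_of_int M) \<longrightarrow>
     ratio M n (\<lambda>x. \<not> succeeds (solver d) \<kappa> {- int d..int d} M \<tau> x) \<le> exp (- (c * real n))"
      by meson
    then show "\<exists>p :: real \<times> real. 0 < fst p \<and> 0 < snd p \<and> (\<forall>\<^sub>F n in sequentially. \<forall>M \<tau>. 4 ^ n \<le> M \<longrightarrow> int D ^ n \<le> M \<longrightarrow>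
     D = d \<or> (1 \<le> D \<and> 3 ^ n * M \<le> 2 ^ n * (2 * int D + 1) ^ n \<and> real_of_int \<bar>\<tau>\<bar> \<le> snd p * real n * real_of_int M) \<longrightarrow>
     ratio M n (\<lambda>x. \<not> succeeds (solver d) \<kappa> {- int d..int d} M \<tau> x) \<le> exp (- (fst p * real n)))"
      by (intro exI[of _ "(c, \<eta>)"]) simp
  qed
  obtain p :: "nat \<Rightarrow> real \<times> real" where p: "\<And>D. D \<le> d \<Longrightarrow> 0 < fst (p D)" "\<And>D. D \<le> d \<Longrightarrow> 0 < snd (p D)"
    "\<And>D. D \<le> d \<Longrightarrow> \<forall>\<^sub>F n in sequentially. \<forall>M \<tau>. 4 ^ n \<le> M \<longrightarrow> int D ^ n \<le> M \<longrightarrow>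
     D = d \<or> (1 \<le> D \<and> 3 ^ n * M \<le> 2 ^ n * (2 * int D + 1) ^ n \<and> real_of_int \<bar>\<tau>\<bar> \<le> snd (p D) * real n * real_of_int M) \<longrightarrow>
     ratio M n (\<lambda>x. \<not> succeeds (solver d) \<kappa> {- int d..int d} M \<tau> x) \<le> exp (- (fst (p D) * real n))"
  proof -
    obtain p where "\<forall>D\<in>{..d}. 0 < fst (p D) \<and> 0 < snd (p D) \<and> (\<forall>\<^sub>F n in sequentially. \<forall>M \<tau>. 4 ^ n \<le> M \<longrightarrow> int D ^ n \<le> M \<longrightarrow>
     D = d \<or> (1 \<le> D \<and> 3 ^ n * M \<le> 2 ^ n * (2 * int D + 1) ^ n \<and> real_of_int \<bar>\<tau>\<bar> \<le> snd (p D) * real n * real_of_int M) \<longrightarrow>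
     ratio M n (\<lambda>x. \<not> succeeds (solver d) \<kappa> {- int d..int d} M \<tau> x) \<le> exp (- (fst (p D) * real n)))"
      using bchoice[OF fails] by (rule exE)
    then show thesis by (intro that[of p]) simp_all
  qed
  \<comment> \<open>The suitable radius depends on M n and so on n, but only d + 1 radii occur; the
    minimum of their constants is positive and serves all of them.\<close>
  define c where "c = Min (fst ` p ` {..d})"
  define \<eta> where "\<eta> = Min (snd ` p ` {..d})"
  have c: "0 < c" "\<And>D. D \<le> d \<Longrightarrow> c \<le> fst (p D)" using p(1) by (auto simp: c_def)
  have \<eta>: "0 < \<eta>" "\<And>D. D \<le> d \<Longrightarrow> \<eta> \<le> snd (p D)" using p(2) by (auto simp: \<eta>_def)
  have succ: "\<forall>\<^sub>F n in sequentially. 1 - exp (- (c * real n)) \<le> success_prob (solver d) \<kappa> {- int d..int d} n (M n) (\<tau> n)"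
    if M: "\<And>n. 4 ^ n \<le> M n" and \<tau>: "(\<lambda>n. real_of_int (\<tau> n)) \<in> o(\<lambda>n. real n * real_of_int (M n))" for M \<tau> :: "nat \<Rightarrow> int"
  proof -
    have "\<forall>\<^sub>F n in sequentially. \<forall>D\<in>{..d}. \<forall>M \<tau>. 4 ^ n \<le> M \<longrightarrow> int D ^ n \<le> M \<longrightarrow>
     D = d \<or> (1 \<le> D \<and> 3 ^ n * M \<le> 2 ^ n * (2 * int D + 1) ^ n \<and> real_of_int \<bar>\<tau>\<bar> \<le> snd (p D) * real n * real_of_int M) \<longrightarrow>
     ratio M n (\<lambda>x. \<not> succeeds (solver d) \<kappa> {- int d..int d} M \<tau> x) \<le> exp (- (fst (p D) * real n))"
      by (rule eventually_ball_finite) (use p(3) in auto)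
    moreover have "\<forall>\<^sub>F n in sequentially. norm (real_of_int (\<tau> n)) \<le> \<eta> * norm (real n * real_of_int (M n))"
      by (rule landau_o.smallD[OF \<tau> \<eta>(1)])
    ultimately show ?thesis using eventually_ge_at_top[of 1]
    proof eventually_elim
      case (elim n)
      have M0: "0 < M n" using M[of n] by (meson less_le_trans zero_less_numeral zero_less_power)
      obtain D where D: "D \<le> d" "int D ^ n \<le> M n" "D = d \<or> 1 \<le> D \<and> 3 ^ n * M n \<le> 2 ^ n * (2 * int D + 1) ^ n"
        using radius_choice[OF elim(3) M] by blast
      have "real_of_int \<bar>\<tau> n\<bar> \<le> \<eta> * (real n * real_of_int (M n))" using elim(2) M0 by simp
      also have "\<dots> \<le> snd (p D) * (real n * real_of_int (M n))" using \<eta>(2)[OF D(1)] M0 by (intro mult_right_mono) auto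
      finally have "real_of_int \<bar>\<tau> n\<bar> \<le> snd (p D) * real n * real_of_int (M n)" by (simp only: mult.assoc)
      then have "ratio (M n) n (\<lambda>x. \<not> succeeds (solver d) \<kappa> {- int d..int d} (M n) (\<tau> n) x) \<le> exp (- (fst (p D) * real n))"
        using elim(1) D M[of n] by blast
      also have "\<dots> \<le> exp (- (c * real n))" using c(2)[OF D(1)] by (simp add: mult_right_mono)
      finally show ?case unfolding success_prob_ratio[OF M0] by simp
    qed
  qed
  show ?thesis
    using time time_bound_soft_O succ c(1) constant_bounds(2) by blast
qed

end
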